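(* Let $r$ be a positive integer, let $\kappa<0$ and $p>0$ satisfy $p+(r+1)\kappa=0$, and set $p_i=p+(i-1)\kappa$ for $1\le i\le r+1$. Consider the perturbed chain of integrators $$\dot z=J_rz+(\gamma u+\varphi)e_r,\qquad z\in\mathbb{R}^r,\ u\in\mathbb{R},$$ where $\gamma\equiv\gamma_m$ for a constant $\gamma_m>0$ and $\varphi:\mathbb{R}_+\to\mathbb{R}$ is globally Lipschitz with $|\dot\varphi(t)|\le\overline{\varphi}$ for $t\geq 0$, for some constant $\overline{\varphi}\ge 0$. Assume that there exist a continuous feedback law $u_0:\mathbb{R}^r\to\mathbb{R}$, homogeneous of degree $p_{r+1}$ with respect to $(\delta_\varepsilon)_{\varepsilon>0}$, such that $\dot z=J_rz+u_0(z)e_r$ is finite-time stable, and a function $V_1$ such that: (i) the vector field $z\mapsto J_rz+u_0(z)e_r$ is homogeneous of degree $\kappa$ with respect to $(\delta_\varepsilon)_{\varepsilon>0}$, and $V_1:\mathbb{R}^r\to\mathbb{R}_+$ is continuous, positive definite, $C^1$ except at the origin, homogeneous of degree $2p_{r+1}$ with respect to $(\delta_\varepsilon)_{\varepsilon>0}$, and there exist $c>0$ and $\alpha\in(0,1)$ for which the time derivative of $V_1$ along non-trivial trajectories of $\dot z=J_rz+u_0(z)e_r$ satisfies $\dot V_1\le -cV_1^\alpha$; (ii) $z\mapsto\partial_rV_1(z)$ is homogeneous of non-negative degree with respect to $(\delta_\varepsilon)_{\varepsilon>0}$, and $z\mapsto\partial_rV_1(z)\,u_0(z)$ is non-positive over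 $\mathbb{R}^r$. Then, for all gains $k_P\ge 1$ and $k_I>0$, there exists $\lambda>0$ depending only on the gains and on $\overline{\varphi}$ (with $u_0$ and $V_1$ given) such that the feedback law $$\frac{1}{\gamma_m}u_{ST}(D_\lambda z,\lambda t)=\frac1{\gamma_m}\Big(k_Pu_0(D_\lambda z(t))-k_I\int_0^{\lambda t}\partial_rV_1\big(D_\lambda z(s/\lambda)\big)\,ds\Big)$$ stabilizes the perturbed chain of integrators in finite time. In particular, this feedback law is continuous.
   Context: $z=(z_1,\dots,z_r)^T\in\mathbb{R}^r$; $e_1,\dots,e_r$ is the canonical basis of $\mathbb{R}^r$; $J_r$ is the $r\times r$ nilpotent Jordan block with $(J_rz)_i=z_{i+1}$ for $1\le i\le r-1$ and $(J_rz)_r=0$, so the perturbed chain reads $\dot z_i=z_{i+1}$ for $1\le i\le r-1$, $\dot z_r=\gamma u+\varphi$. $\partial_r$ denotes the partial derivative with respect to $z_r$. For $\lambda>0$, $D_\lambda=\mathrm{diag}(\lambda^r,\lambda^{r-1},\dots,\lambda)$. Dilations: for $\varepsilon>0$, $\delta_\varepsilon(z)=(\varepsilon^{p_1}z_1,\dots,\varepsilon^{p_r}z_r)$. A real-valued function $f$ is homogeneous of degree $q$ with respect to $(\delta_\varepsilon)$ if $f(\delta_\varepsilon(z))=\varepsilon^qf(z)$ for all $\varepsilon>0$ and all $z$ (where $f$ is defined); a vector field $F$ is homogeneous of degree $q$ if $F(\delta_\varepsilon(z))=\varepsilon^q\delta_\varepsilon(F(z))$. The super-twisting feedback is the functional $u_{ST}(y,\tau)=k_Pu_0(y(\tau))-k_I\int_0^\tau\partial_rV_1(y(s))\,ds$;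 in the theorem it is evaluated on the rescaled trajectory $y(\tau)=D_\lambda z(\tau/\lambda)$ at $\tau=\lambda t$. Differential equations with discontinuous right-hand side are understood in the sense of Filippov differential inclusions. A system is finite-time stable if the origin is Lyapunov stable and every trajectory reaches the origin in finite time and stays there afterwards; a controller stabilizes a system in finite time if the resulting closed-loop trajectories $z$ converge to the origin in finite time in this sense. The bound on the derivative of a Lipschitz function is understood at (almost every) time where it exists. *)

theory Defs
  imports "HOL-Analysis.Analysis"
begin

section \<open>Differential inclusions in the sense of Filippov\<close>

definition filippov ::
  "('a::euclidean_space \<Rightarrow> 'b::euclidean_space) \<Rightarrow> 'a \<Rightarrow> 'b set" where
  "filippov F x =
     (\<Inter>\<delta>\<in>{0<..}. \<Inter>N\<in>{N. negligible N}. closure (convex hull (F ` (ball x \<delta> - N))))"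

text \<open>
  A solution on \<open>[0, b)\<close>, with \<open>b\<close> possibly infinite, is a locally absolutely continuous
  function whose derivative \<open>v\<close> is almost everywhere in the Filippov set. Local absolute
  continuity is expressed by saying that the function is the indefinite Lebesgue integral of
  \<open>v\<close>.
\<close>

definition filippov_solution ::
  "(real \<Rightarrow> 'a::euclidean_space \<Rightarrow> 'a) \<Rightarrow> ereal \<Rightarrow> (real \<Rightarrow> 'a) \<Rightarrow> bool" where
  "filippov_solution F b x \<longleftrightarrow> 0 < b \<and>
     (\<exists>v. (\<forall>t\<ge>0. ereal t < b \<longrightarrow>
              v absolutely_integrable_on {0..t} \<and> x t = x 0 + integral {0..t} v) \<and>
          negligible {t. 0 \<le> t \<and> ereal t < b \<and> v t \<notin> filippov (F t) (x t)})"

definition maximal_solution ::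
  "(real \<Rightarrow> 'a::euclidean_space \<Rightarrow> 'a) \<Rightarrow> ereal \<Rightarrow> (real \<Rightarrow> 'a) \<Rightarrow> bool" where
  "maximal_solution F b x \<longleftrightarrow> filippov_solution F b x \<and>
     \<not> (\<exists>b' y. b < b' \<and> filippov_solution F b' y \<and> (\<forall>t\<ge>0. ereal t < b \<longrightarrow> y t = x t))"

definition lyapunov_stable :: "(real \<Rightarrow> 'a::euclidean_space \<Rightarrow> 'a) \<Rightarrow> bool" where
  "lyapunov_stable F \<longleftrightarrow>
     (\<forall>\<epsilon>>0. \<exists>\<delta>>0. \<forall>b x. filippov_solution F b x \<longrightarrow> norm (x 0) < \<delta> \<longrightarrow>
        (\<forall>t\<ge>0. ereal t < b \<longrightarrow> norm (x t) < \<epsilon>))"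

definition finite_time_stable :: "(real \<Rightarrow> 'a::euclidean_space \<Rightarrow> 'a) \<Rightarrow> bool" where
  "finite_time_stable F \<longleftrightarrow> lyapunov_stable F \<and>
     (\<forall>b x. maximal_solution F b x \<longrightarrow> b = \<infinity> \<and> (\<exists>T\<ge>0. \<forall>t\<ge>T. x t = 0))"

section \<open>Chains of integrators, dilations, homogeneity\<close>

text \<open>
  The indices \<open>1, ..., r\<close> are the elements of a finite linearly ordered type in increasing
  order, so \<open>r\<close> is its cardinality, \<open>i - 1\<close> is the number of indices below \<open>i\<close>, and
  \<open>r + 1 - i\<close> is the number of indices not below \<open>i\<close>.
\<close>

definition last_idx :: "'n::{finite,linorder}" where
  "last_idx = Max UNIV"

definition jordan_shift :: "real^'n::{finite,linorder} \<Rightarrow> real^'n::_" where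
  "jordan_shift z = (\<chi> i. if i = last_idx then 0 else z $ Min {j. i < j})"

definition integrator_chain :: "real^'n::{finite,linorder} \<Rightarrow> real \<Rightarrow> real^'n::_" where
  "integrator_chain z v = jordan_shift z + v *\<^sub>R axis last_idx 1"

text \<open>
  At the origin the partial derivative of the functions considered here need not exist, and
  \<open>partial_last\<close> has an unspecified value there. This value is irrelevant to Filippov sets, since
  a single point is negligible.
\<close>

definition partial_last :: "(real^'n::{finite,linorder} \<Rightarrow> real) \<Rightarrow> real^'n::_ \<Rightarrow> real" where
  "partial_last V z = deriv (\<lambda>s. V (z + s *\<^sub>R axis last_idx 1)) 0"

definition weight :: "real \<Rightarrow> real \<Rightarrow> 'n::{finite,linorder} \<Rightarrow> real" where
  "weight p \<kappa> i = p + real (card {j. j < i}) * \<kappa>"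

definition dilation :: "('n::finite \<Rightarrow> real) \<Rightarrow> real \<Rightarrow> real^'n \<Rightarrow> real^'n" where
  "dilation w \<epsilon> z = (\<chi> i. \<epsilon> powr w i * z $ i)"

definition homogeneous_on ::
  "(real^'n::finite) set \<Rightarrow> ('n \<Rightarrow> real) \<Rightarrow> real \<Rightarrow> (real^'n \<Rightarrow> real) \<Rightarrow> bool" where
  "homogeneous_on S w q f \<longleftrightarrow>
     (\<forall>\<epsilon>>0. \<forall>z\<in>S. f (dilation w \<epsilon> z) = \<epsilon> powr q * f z)"

definition homogeneous_field ::
  "('n::finite \<Rightarrow> real) \<Rightarrow> real \<Rightarrow> (real^'n \<Rightarrow> real^'n) \<Rightarrow> bool" where
  "homogeneous_field w q F \<longleftrightarrow>
     (\<forall>\<epsilon>>0. \<forall>z. F (dilation w \<epsilon> z) = \<epsilon> powr q *\<^sub>R dilation w \<epsilon> (F z))"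

definition C1_off_origin :: "('a::euclidean_space \<Rightarrow> real) \<Rightarrow> bool" where
  "C1_off_origin V \<longleftrightarrow>
     (\<exists>G. continuous_on (- {0}) G \<and> (\<forall>z. z \<noteq> 0 \<longrightarrow> (V has_derivative (\<lambda>h. G z \<bullet> h)) (at z)))"

definition positive_definite_fun :: "('a::real_normed_vector \<Rightarrow> real) \<Rightarrow> bool" where
  "positive_definite_fun V \<longleftrightarrow> V 0 = 0 \<and> (\<forall>z. z \<noteq> 0 \<longrightarrow> V z > 0)"

section \<open>Super-twisting feedback\<close>

definition scaling :: "real \<Rightarrow> real^'n::{finite,linorder} \<Rightarrow> real^'n::_" where
  "scaling lam z = (\<chi> i. lam ^ card {j. i \<le> j} * z $ i)"

definition super_twisting ::
  "real \<Rightarrow> real \<Rightarrow> (real^'n::{finite,linorder} \<Rightarrow> real) \<Rightarrow> (real^'n::_ \<Rightarrow> real) \<Rightarrow>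
   (real \<Rightarrow> real^'n::_) \<Rightarrow> real \<Rightarrow> real" where
  "super_twisting kP kI u0 V y \<tau> =
     kP * u0 (y \<tau>) - kI * integral {0..\<tau>} (\<lambda>s. partial_last V (y s))"

text \<open>
  In closed loop the integral \<open>w t\<close> of \<open>partial_last V (scaling lam (z (s / lam)))\<close> for \<open>s\<close> from
  \<open>0\<close> to \<open>lam * t\<close> becomes a further state, with \<open>w 0 = 0\<close> and derivative
  \<open>lam * partial_last V (scaling lam (z t))\<close>. The integro-differential closed loop is thereby the
  differential equation below on \<open>\<real>\<^sup>r \<times> \<real>\<close>, discontinuous where \<open>z = 0\<close>, to which the Filippov
  regularization applies. The lemma \<open>st_control_eq_super_twisting\<close> recovers the integral formula.
\<close>

definition st_control ::
  "real \<Rightarrow> real \<Rightarrow> real \<Rightarrow> real \<Rightarrow> (real^'n::{finite,linorder} \<Rightarrow> real) \<Rightarrow> real^'n::_ \<Rightarrow> real \<Rightarrow> real"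
  where
  "st_control \<gamma> kP kI lam u0 z w = (1 / \<gamma>) * (kP * u0 (scaling lam z) - kI * w)"

definition st_closed_loop ::
  "real \<Rightarrow> real \<Rightarrow> real \<Rightarrow> real \<Rightarrow> (real^'n::{finite,linorder} \<Rightarrow> real) \<Rightarrow> (real^'n::_ \<Rightarrow> real) \<Rightarrow>
   (real \<Rightarrow> real) \<Rightarrow> real \<Rightarrow> (real^'n::_) \<times> real \<Rightarrow> (real^'n::_) \<times> real" where
  "st_closed_loop \<gamma> kP kI lam u0 V \<phi> t = (\<lambda>(z, w).
     (integrator_chain z (\<gamma> * st_control \<gamma> kP kI lam u0 z w + \<phi> t),
      lam * partial_last V (scaling lam z)))"

definition admissible_perturbation :: "real \<Rightarrow> (real \<Rightarrow> real) \<Rightarrow> bool" where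
  "admissible_perturbation M \<phi> \<longleftrightarrow>
     (\<exists>L. L-lipschitz_on {0..} \<phi>) \<and>
     (AE t in lebesgue. 0 \<le> t \<longrightarrow> \<phi> differentiable (at t) \<longrightarrow> \<bar>deriv \<phi> t\<bar> \<le> M)"

text \<open>
  Finite-time stabilization for all perturbations with derivative bound \<open>M\<close>. Lyapunov stability
  refers to the origin in the coordinates \<open>z\<close> and \<open>\<phi> t - kI * w t\<close>, the latter with initial
  value \<open>\<phi> 0\<close>: when \<open>\<phi> 0 \<noteq> 0\<close> no trajectory stays at \<open>z = 0\<close> from time \<open>0\<close> on.
\<close>

definition st_stabilizes ::
  "real \<Rightarrow> real \<Rightarrow> real \<Rightarrow> real \<Rightarrow> real \<Rightarrow> (real^'n::{finite,linorder} \<Rightarrow> real) \<Rightarrow>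
   (real^'n::_ \<Rightarrow> real) \<Rightarrow> bool" where
  "st_stabilizes M \<gamma> kP kI lam u0 V \<longleftrightarrow>
     (\<forall>\<epsilon>>0. \<exists>\<delta>>0. \<forall>\<phi> b z w. admissible_perturbation M \<phi> \<longrightarrow>
        filippov_solution (st_closed_loop \<gamma> kP kI lam u0 V \<phi>) b (\<lambda>t. (z t, w t)) \<longrightarrow> w 0 = 0 \<longrightarrow>
        norm (z 0, \<phi> 0) < \<delta> \<longrightarrow>
        (\<forall>t\<ge>0. ereal t < b \<longrightarrow> norm (z t, \<phi> t - kI * w t) < \<epsilon>)) \<and>
     (\<forall>\<phi> b z w. admissible_perturbation M \<phi> \<longrightarrow>
        maximal_solution (st_closed_loop \<gamma> kP kI lam u0 V \<phi>) b (\<lambda>t. (z t, w t)) \<longrightarrow> w 0 = 0 \<longrightarrow>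
        b = \<infinity> \<and> (\<exists>T\<ge>0. \<forall>t\<ge>T. z t = 0))"

lemma filippov_isCont:
  fixes F :: "'a::euclidean_space \<Rightarrow> 'b::euclidean_space"
  assumes "isCont F x"
  shows "filippov F x = {F x}"
proof (intro equalityI subsetI)
  fix v assume v: "v \<in> filippov F x"
  have "dist v (F x) \<le> e" if "e > 0" for e
  proof -
    obtain d where d: "d > 0" "\<And>y. dist y x < d \<Longrightarrow> dist (F y) (F x) < e"
      using assms \<open>e > 0\<close> unfolding continuous_at_eps_delta by (metis dist_commute)
    have "v \<in> closure (convex hull (F ` (ball x d - {})))"
      using v d(1) negligible_empty unfolding filippov_def by blast
    also have "\<dots> \<subseteq> cball (F x) e"
      using d(2) by (intro closure_minimal hull_minimal)
        (auto simp: dist_commute less_imp_le)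
    finally show ?thesis by (simp add: dist_commute)
  qed
  then show "v \<in> {F x}"
    by (metis dense_ge dist_le_zero_iff singleton_iff)
next
  fix v assume "v \<in> {F x}"
  have "F x \<in> closure (convex hull (F ` (ball x d - N)))" if "d > 0" "negligible N" for d N
    unfolding closure_approachable
  proof (intro allI impI)
    fix e :: real assume "e > 0"
    then obtain d' where d': "d' > 0" "\<And>y. dist y x < d' \<Longrightarrow> dist (F y) (F x) < e"
      using assms unfolding continuous_at_eps_delta by (metis dist_commute)
    have "\<not> ball x (min d d') \<subseteq> N"
      using that d'(1) negligible_subset open_not_negligible[OF open_ball]
      by (metis ball_eq_empty min_less_iff_conj not_less)
    then obtain y where "y \<in> ball x d - N" "dist y x < d'"
      by (auto simp: subset_iff dist_commute)
    then show "\<exists>y\<in>convex hull (F ` (ball x d - N)). dist y (F x) < e"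
      using d'(2) by (meson hull_inc imageI)
  qed
  then show "v \<in> filippov F x"
    using \<open>v \<in> {F x}\<close> by (auto simp: filippov_def)
qed

lemma isCont_vec:
  fixes f :: "'a::t2_space \<Rightarrow> 'n::finite \<Rightarrow> 'b::real_normed_vector"
  shows "(\<And>i. isCont (\<lambda>x. f x i) a) \<Longrightarrow> isCont (\<lambda>x. \<chi> i. f x i) a"
  unfolding isCont_def by (rule tendsto_vec_lambda)

lemma isCont_scaling: "isCont (scaling lam) z"
  unfolding scaling_def by (rule isCont_vec) (intro continuous_intros)

lemma scaling_eq_0: "lam > 0 \<Longrightarrow> scaling lam z = 0 \<longleftrightarrow> z = 0"
  by (auto simp: scaling_def vec_eq_iff)

lemma isCont_closed_loop:
  fixes u0 V :: "real^'n::{finite,linorder} \<Rightarrow> real"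
  assumes "continuous_on UNIV u0" "\<And>y. y \<noteq> 0 \<Longrightarrow> isCont (partial_last V) y" "lam > 0" "z \<noteq> 0"
  shows "isCont (st_closed_loop \<gamma> kP kI lam u0 V \<phi> t) (z, w)"
proof -
  have s: "isCont (\<lambda>x. scaling lam (fst x)) (z, w)"
    by (rule continuous_at_compose[unfolded o_def, where g = "scaling lam"])
      (auto intro!: continuous_intros isCont_scaling)
  have 1: "isCont (\<lambda>x. u0 (scaling lam (fst x))) (z, w)"
    using assms(1) s isCont_o2[OF s] by (auto simp: continuous_on_eq_continuous_at)
  have 2: "isCont (\<lambda>x. partial_last V (scaling lam (fst x))) (z, w)"
    using assms(2)[of "scaling lam z"] assms(3,4) isCont_o2[OF s, of "partial_last V"]
    by (auto simp: scaling_eq_0)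
  have 3: "isCont (\<lambda>x. jordan_shift (fst x)) (z, w)"
    unfolding jordan_shift_def
  proof (rule isCont_vec)
    fix i :: 'n
    show "isCont (\<lambda>x. if i = last_idx then 0 else fst x $ Min {j. i < j}) (z, w)"
      by (cases "i = last_idx") (auto intro!: continuous_intros)
  qed
  show ?thesis
    unfolding st_closed_loop_def st_control_def integrator_chain_def case_prod_beta
    by (intro continuous_intros 1 2 3)
qed

lemma st_control_eq_super_twisting:
  fixes u0 V :: "real^'n::{finite,linorder} \<Rightarrow> real"
  assumes "continuous_on UNIV u0" "\<And>y. y \<noteq> 0 \<Longrightarrow> isCont (partial_last V) y" "lam > 0"
    and sol: "filippov_solution (st_closed_loop \<gamma> kP kI lam u0 V \<phi>) b (\<lambda>t. (z t, w t))"
    and "w 0 = 0" "0 \<le> t" "ereal t < b" "negligible {s. 0 \<le> s \<and> s \<le> t \<and> z s = 0}"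
  shows "st_control \<gamma> kP kI lam u0 (z t) (w t) =
    (1 / \<gamma>) * super_twisting kP kI u0 V (\<lambda>\<tau>. scaling lam (z (\<tau> / lam))) (lam * t)"
proof -
  obtain v where v: "v absolutely_integrable_on {0..t}"
      "(z t, w t) = (z 0, w 0) + integral {0..t} v"
    and neg: "negligible {s. 0 \<le> s \<and> ereal s < b \<and>
      v s \<notin> filippov (st_closed_loop \<gamma> kP kI lam u0 V \<phi> s) (z s, w s)}" (is "negligible ?N")
    using sol assms(6,7) unfolding filippov_solution_def by blast
  have vi: "v integrable_on {0..t}"
    using v(1) set_lebesgue_integral_eq_integral(1) by blast
  let ?g = "\<lambda>s. partial_last V (scaling lam (z s))"
  have "w t = integral {0..t} (\<lambda>s. snd (v s))"
    using v(2) \<open>w 0 = 0\<close> integral_linear[OF vi bounded_linear_snd]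
    by (metis (mono_tags, lifting) add_0 comp_apply snd_add snd_conv integral_cong)
  also have "\<dots> = integral {0..t} (\<lambda>s. lam * ?g s)"
  proof (rule integral_spike)
    show "negligible (?N \<union> {s. 0 \<le> s \<and> s \<le> t \<and> z s = 0})"
      using neg assms(8) by (rule negligible_Un)
    fix s assume s: "s \<in> {0..t} - (?N \<union> {s. 0 \<le> s \<and> s \<le> t \<and> z s = 0})"
    then have "ereal s < b"
      using \<open>ereal t < b\<close> by (auto intro: le_less_trans[of "ereal s" "ereal t"])
    with s have "v s \<in> filippov (st_closed_loop \<gamma> kP kI lam u0 V \<phi> s) (z s, w s)" "z s \<noteq> 0"
      by auto
    then have "v s = st_closed_loop \<gamma> kP kI lam u0 V \<phi> s (z s, w s)"
      using filippov_isCont[OF isCont_closed_loop[OF assms(1-3)]] by blast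
    then show "lam * ?g s = snd (v s)"
      by (simp add: st_closed_loop_def)
  qed
  also have "\<dots> = lam * integral {0..t} ?g"
    by simp
  also have "\<dots> = integral {0..lam * t} (\<lambda>s. ?g (s / lam))"
    using integral_stretch_real[of lam 0 "lam * t" "\<lambda>s. ?g (s / lam)"] \<open>lam > 0\<close> \<open>0 \<le> t\<close>
    by (simp add: image_divide_atLeastAtMost)
  finally have "w t = integral {0..lam * t} (\<lambda>s. ?g (s / lam))" .
  then show ?thesis
    using \<open>lam > 0\<close> by (simp add: st_control_def super_twisting_def)
qed

end

theory Submission
  imports Defs "HOL-Complex_Analysis.Great_Picard"
begin

text \<open>
  Put \<open>y = scaling lam z\<close> and \<open>\<xi> = \<phi> - kI * w\<close>. The closed loop becomes
  \<open>y' = lam * (J y + (kP * u0 y + \<xi>) e)\<close>, \<open>\<xi>' = \<phi>' - lam * kI * q y\<close>, where \<open>J\<close> is the shift, \<open>e\<close> the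
  last basis vector and \<open>q\<close> the last partial derivative of \<open>V1\<close>. Apart from the common factor \<open>lam\<close>
  this is the super-twisting system perturbed by \<open>\<phi>' / lam\<close>, so a large \<open>lam\<close> makes the
  perturbation small.

  Without perturbation, \<open>W = V1 y + \<xi>\<^sup>2 / (2 * kI)\<close> does not increase: the coupling terms
  \<open>\<xi> * q y\<close> cancel, \<open>(kP - 1) * q y * u0 y \<le> 0\<close>, and what remains is the derivative of \<open>V1\<close> along
  the nominal system. This derivative controls \<open>y\<close> only. The cross term in
  \<open>L = W powr (3/2) - eps * \<xi> * y\<^sub>r\<close> supplies the missing dissipation, because the derivative of
  \<open>\<xi> * y\<^sub>r\<close> contains \<open>lam * \<xi>\<^sup>2\<close>. By homogeneity \<open>u0\<close> is of order \<open>V1 powr (1/2)\<close>, \<open>y\<^sub>r\<close> of order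
  \<open>V1\<close>, and \<open>q\<close> is bounded, so all other new terms are at most of order \<open>(W * V1) powr (1/2)\<close>, as is the
  decay of \<open>W powr (3/2)\<close>, and a small \<open>eps\<close> absorbs them. The perturbation contributes a term of
  order \<open>M * W\<close>, which a large \<open>lam\<close> absorbs. Hence \<open>L' \<le> - const * lam * W\<close>, and since \<open>L\<close> is
  comparable to \<open>W powr (3/2)\<close>, its cube root decreases at a constant rate until the state is zero
  (\<open>super_twisting_dissipation\<close>, \<open>lyap_root_rate\<close>). This yields stability and convergence in finite
  time.

  Four points need care. The decay of \<open>V1\<close> is given along solutions of the nominal system; it
  becomes a pointwise inequality because a solution starts at every point
  (\<open>derivative_along_continuous_field\<close>). The perturbation is only Lipschitz, and it has to be
  recovered from its derivative almost everywhere (\<open>Lipschitz_imp_indefinite_integral\<close>). \<open>V1\<close> is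
  not differentiable at the origin; but a trajectory with \<open>y = 0\<close> and \<open>\<xi> \<noteq> 0\<close> leaves \<open>y = 0\<close>
  immediately, which is enough to propagate the decrease by continuity (\<open>leaves_origin_component\<close>,
  \<open>lyap_root_decrease_nonzero\<close>). Finally, a maximal solution has to exist for all times: it is
  bounded by the Lyapunov function, so its velocity is bounded and it extends beyond any finite time by a local solution (\<open>bounded_solution_not_maximal\<close>,
  \<open>closed_loop_local_solution\<close>).
\<close>

section \<open>Lipschitz functions as indefinite integrals\<close>

text \<open>
  The Lebesgue differentiation theorem on the line. The averages in
  \<open>integrable_ccontinuous_explicit\<close> are over intervals to the right of the point; the left
  difference quotients are covered by applying it also to the reflected function.
\<close>
lemma indefinite_integral_has_vector_derivative_AE:
  fixes f :: "real \<Rightarrow> 'a::euclidean_space"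
  assumes int: "\<And>a b. f integrable_on {a..b}"
  obtains N where "negligible N"
    "\<And>a x. x \<notin> N \<Longrightarrow> a < x \<Longrightarrow> ((\<lambda>u. integral {a..u} f) has_vector_derivative f x) (at x)"
proof -
  obtain N1 where N1: "negligible N1"
    "\<And>x e. \<lbrakk>x \<notin> N1; 0 < e\<rbrakk> \<Longrightarrow> \<exists>d>0. \<forall>h. 0 < h \<and> h < d \<longrightarrow>
        norm (integral {x..x + h} f /\<^sub>R h - f x) < e"
    using integrable_ccontinuous_explicit[of f] int by (auto simp: cbox_interval)
  have int': "(\<lambda>x. f (- x)) integrable_on {a..b}" for a b
    using int[of "-b" "-a"] Henstock_Kurzweil_Integration.integrable_reflect_real[where f = f and a = "-b" and b = "-a"] by simp
  obtain N2 where N2: "negligible N2"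
    "\<And>x e. \<lbrakk>x \<notin> N2; 0 < e\<rbrakk> \<Longrightarrow> \<exists>d>0. \<forall>h. 0 < h \<and> h < d \<longrightarrow>
        norm (integral {x..x + h} (\<lambda>x. f (- x)) /\<^sub>R h - f (- x)) < e"
    using integrable_ccontinuous_explicit[of "\<lambda>x. f (- x)"] int' by (auto simp: cbox_interval)
  show ?thesis
  proof
    have "negligible (uminus ` N2)"
      by (rule negligible_differentiable_image_negligible[OF _ N2(1)])
        (auto simp: linear_imp_differentiable_on linear_uminus)
    with N1(1) show "negligible (N1 \<union> uminus ` N2)"
      by (rule negligible_Un)
    fix a x assume x: "x \<notin> N1 \<union> uminus ` N2" and "a < x"
    have "- x \<notin> N2"
      using x by (metis UnI2 add.inverse_inverse imageI)
    let ?F = "\<lambda>u. integral {a..u} f"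
    show "(?F has_vector_derivative f x) (at x)"
      unfolding has_vector_derivative_def has_derivative_at_alt
    proof (intro conjI allI impI)
      show "bounded_linear (\<lambda>h. h *\<^sub>R f x)"
        by (simp add: bounded_linear_scaleR_left)
      fix e :: real assume "e > 0"
      obtain d1 where d1: "d1 > 0" "\<And>h. 0 < h \<Longrightarrow> h < d1 \<Longrightarrow>
          norm (integral {x..x + h} f /\<^sub>R h - f x) < e"
        using N1(2)[of x e] x \<open>e > 0\<close> by auto
      obtain d2 where d2: "d2 > 0" "\<And>h. 0 < h \<Longrightarrow> h < d2 \<Longrightarrow>
          norm (integral {- x..- x + h} (\<lambda>x. f (- x)) /\<^sub>R h - f x) < e"
        using N2(2)[of "-x" e] \<open>- x \<notin> N2\<close> \<open>e > 0\<close> by auto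
      have key: "norm (I - h *\<^sub>R y) \<le> e * h" if "h > 0" "norm (I /\<^sub>R h - y) < e" for I y :: 'a and h
      proof -
        have "I - h *\<^sub>R y = h *\<^sub>R (I /\<^sub>R h - y)"
          using that(1) by (simp add: algebra_simps)
        then have "norm (I - h *\<^sub>R y) = h * norm (I /\<^sub>R h - y)"
          using that(1) by (metis abs_of_pos norm_scaleR)
        then show ?thesis
          using that by (simp add: mult.commute)
      qed
      show "\<exists>d>0. \<forall>y. norm (y - x) < d \<longrightarrow>
          norm (?F y - ?F x - (y - x) *\<^sub>R f x) \<le> e * norm (y - x)"
      proof (intro exI[of _ "min (min d1 d2) (x - a)"] conjI allI impI)
        show "min (min d1 d2) (x - a) > 0"
          using d1 d2 \<open>a < x\<close> by auto
        fix y assume y: "norm (y - x) < min (min d1 d2) (x - a)"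
        consider "y = x" | "y > x" | "y < x" by linarith
        then show "norm (?F y - ?F x - (y - x) *\<^sub>R f x) \<le> e * norm (y - x)"
        proof cases
          case 2
          have "?F y - ?F x = integral {x..x + (y - x)} f"
            using Henstock_Kurzweil_Integration.integral_combine[of a x y f] 2 \<open>a < x\<close> int
            by (auto simp: algebra_simps)
          then show ?thesis
            using key[OF _ d1(2)[of "y - x"]] 2 y by auto
        next
          case 3
          have "?F x - ?F y = integral {y..x} f"
            using Henstock_Kurzweil_Integration.integral_combine[of a y x f] 3 y int
            by (auto simp: algebra_simps)
          also have "\<dots> = integral {- x..- x + (x - y)} (\<lambda>x. f (- x))"
            using Henstock_Kurzweil_Integration.integral_reflect_real[of x y f] by simp
          finally have "norm (?F x - ?F y - (x - y) *\<^sub>R f x) \<le> e * (x - y)"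
            using key[OF _ d2(2)[of "x - y"]] 3 y by auto
          moreover have "?F y - ?F x - (y - x) *\<^sub>R f x = - (?F x - ?F y - (x - y) *\<^sub>R f x)"
            by (simp add: algebra_simps)
          ultimately show ?thesis
            using 3 by (simp only: norm_minus_cancel) simp
        qed auto
      qed
    qed
  qed
qed

text \<open>
  Adding a steep linear function turns \<open>f\<close> into an increasing bi-Lipschitz bijection \<open>F\<close> of the
  line. The image of Lebesgue measure under \<open>inv F\<close> gives each interval the increment of \<open>F\<close> over
  it, and it is absolutely continuous since Lipschitz maps preserve null sets. Its Radon--Nikodym
  density is the derivative of \<open>F\<close>.
\<close>
lemma Lipschitz_imp_indefinite_integral:
  fixes f :: "real \<Rightarrow> real"
  assumes lip: "L-lipschitz_on UNIV f"
  obtains g N where "\<And>a b. g absolutely_integrable_on {a..b}"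
    "\<And>a b. a \<le> b \<Longrightarrow> f b - f a = integral {a..b} g"
    "negligible N" "\<And>x. x \<notin> N \<Longrightarrow> (f has_real_derivative g x) (at x)"
proof -
  have L: "L \<ge> 0" "\<bar>f x - f y\<bar> \<le> L * \<bar>x - y\<bar>" for x y
    using lip by (auto simp: lipschitz_on_def dist_real_def)
  \<comment> \<open>With slope \<open>L + 1\<close> the increments of \<open>F\<close> are at least those of the identity.\<close>
  define F where "F = (\<lambda>x. f x + (L + 1) * x)"
  have F: "y - x \<le> F y - F x" "F y - F x \<le> (2 * L + 1) * (y - x)" if "x \<le> y" for x y
    using L(2)[of y x] that by (auto simp: F_def algebra_simps)
  have strict: "strict_mono F"
    unfolding strict_mono_def by (metis F(1) diff_gt_0_iff_gt less_imp_le less_le_trans)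
  have cont: "continuous_on UNIV F"
    unfolding F_def by (intro continuous_intros lipschitz_on_continuous_on[OF lip])
  have surj: "\<exists>x. F x = y" for y
  proof -
    define c where "c = \<bar>y - F 0\<bar>"
    have "F (-c) \<le> y" "y \<le> F c"
      using F(1)[of "-c" 0] F(1)[of 0 c] by (auto simp: c_def)
    then show ?thesis
      using IVT'[of F "-c" y c] cont continuous_on_subset by (fastforce simp: c_def)
  qed
  define H where "H = inv F"
  have HF: "H (F x) = x" for x
    unfolding H_def using strict by (simp add: strict_mono_imp_inj_on)
  have FH: "F (H x) = x" for x
    unfolding H_def
  proof (rule surj_f_inv_f, rule surjI)
    show "F (SOME x. F x = y) = y" for y
      using surj by (rule someI_ex)
  qed
  have "mono H"
    by (intro monoI) (metis FH strict strict_mono_less_eq)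
  then have Hm: "H \<in> borel_measurable borel"
    by (rule borel_measurable_mono)
  have vim: "H -` A = F ` A" for A :: "real set"
    by (auto simp: HF) (metis FH imageI)
  define \<mu> where "\<mu> = distr lborel borel H"
  have "absolutely_continuous lborel \<mu>"
    unfolding absolutely_continuous_def
  proof
    fix A :: "real set" assume A: "A \<in> null_sets lborel"
    then have "negligible A" 
      by (simp add: negligible_iff_null_sets null_sets_completionI)
    then have "negligible (F ` A)"
    proof (rule negligible_locally_Lipschitz_image[rotated])
      fix x
      have "norm (F y - F x) \<le> (2 * L + 1) * norm (y - x)" for y
        using F[of x y] F[of y x] by (cases "x \<le> y") auto
      then show "\<exists>T B. open T \<and> x \<in> T \<and> (\<forall>y\<in>A \<inter> T. norm (F y - F x) \<le> B * norm (y - x))"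
        by (intro exI[of _ UNIV]) auto
    qed simp
    moreover have "F ` A \<in> sets borel"
      using A measurable_sets_borel[OF Hm, of A] by (auto simp: vim null_sets_def)
    ultimately have "emeasure lborel (F ` A) = 0"
      by (simp add: negligible_iff_null_sets null_sets_def)
    then show "A \<in> null_sets \<mu>"
      using A Hm by (auto simp: \<mu>_def null_sets_def emeasure_distr vim)
  qed
  then obtain g0 where g0: "g0 \<in> borel_measurable lborel" "density lborel g0 = \<mu>"
    using sigma_finite_measure.Radon_Nikodym[OF sigma_finite_lborel, of \<mu>] by (auto simp: \<mu>_def)
  have em: "(\<integral>\<^sup>+x. g0 x * indicator {a..b} x \<partial>lborel) = ennreal (F b - F a)" if "a \<le> b" for a b
  proof -
    have "emeasure (density lborel g0) {a..b} = (\<integral>\<^sup>+x. g0 x * indicator {a..b} x \<partial>lborel)"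
      by (rule emeasure_density[OF g0(1)]) simp
    then have "(\<integral>\<^sup>+x. g0 x * indicator {a..b} x \<partial>lborel) = emeasure \<mu> {a..b}"
      by (simp only: g0(2))
    also have "\<dots> = emeasure lborel (H -` {a..b})"
      using Hm by (simp add: \<mu>_def emeasure_distr)
    also have "H -` {a..b} = {F a..F b}"
    proof -
      have "a \<le> H x \<longleftrightarrow> F a \<le> x" "H x \<le> b \<longleftrightarrow> x \<le> F b" for x
        using strict_mono_less_eq[OF strict, of a "H x"] strict_mono_less_eq[OF strict, of "H x" b]
        by (simp_all add: FH)
      then show ?thesis by auto
    qed
    also have "emeasure lborel {F a..F b} = ennreal (F b - F a)"
      using F(1)[OF that] that by simp
    finally show ?thesis .
  qed
  define G where "G = (\<lambda>x. enn2real (g0 x))"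
  have Gm: "G \<in> borel_measurable borel"
    using g0 by (simp add: G_def)
  have hasint: "(G has_integral (F b - F a)) {a..b}" if "a \<le> b" for a b
  proof -
    have fin: "AE x in lborel. g0 x * indicator {a..b} x \<noteq> \<infinity>"
      by (rule nn_integral_PInf_AE) (use g0(1) em[OF that] in auto)
    have "((\<lambda>x. G x * indicator {a..b} x) has_integral (F b - F a)) UNIV"
    proof (rule nn_integral_has_integral)
      show "(\<lambda>x. G x * indicator {a..b} x) \<in> borel_measurable borel"
        using Gm by simp
      show "0 \<le> G x * indicator {a..b} x" for x
        by (simp add: G_def)
      show "0 \<le> F b - F a"
        using F(1)[OF that] that by simp
      have "(\<integral>\<^sup>+x. ennreal (G x * indicator {a..b} x) \<partial>lborel) = (\<integral>\<^sup>+x. g0 x * indicator {a..b} x \<partial>lborel)"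
        using fin
        by (intro nn_integral_cong_AE, eventually_elim) (auto simp: G_def indicator_def less_top)
      then show "(\<integral>\<^sup>+x. ennreal (G x * indicator {a..b} x) \<partial>lborel) = ennreal (F b - F a)"
        using em[OF that] by simp
    qed
    moreover have "(\<lambda>x. G x * indicator {a..b} x) = (\<lambda>x. if x \<in> {a..b} then G x else 0)"
      by auto
    ultimately show ?thesis
      by (simp only: has_integral_restrict_UNIV)
  qed
  define g where "g = (\<lambda>x. G x - (L + 1))"
  have ghas: "(g has_integral (f b - f a)) {a..b}" if "a \<le> b" for a b
  proof -
    have "((\<lambda>x. G x - (L + 1)) has_integral (F b - F a - (b - a) *\<^sub>R (L + 1))) {a..b}"
      by (rule has_integral_diff[OF hasint[OF that] has_integral_const_real[of "L + 1" a b, simplified content_real[OF that]]])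
    then show ?thesis
      by (simp add: g_def F_def algebra_simps)
  qed
  have gint: "g integrable_on {a..b}" for a b
    using ghas[of a b] by (cases "a \<le> b") auto
  have gabs: "g absolutely_integrable_on {a..b}" for a b
  proof -
    have "G absolutely_integrable_on {a..b}"
      by (rule nonnegative_absolutely_integrable_1) (use hasint[of a b] in \<open>cases "a \<le> b"; auto simp: G_def\<close>)+
    then show ?thesis
      unfolding g_def by (intro set_integral_diff) auto
  qed
  obtain N where N: "negligible N"
    "\<And>a x. x \<notin> N \<Longrightarrow> a < x \<Longrightarrow> ((\<lambda>u. integral {a..u} g) has_vector_derivative g x) (at x)"
    using indefinite_integral_has_vector_derivative_AE[of g] gint by auto
  show ?thesis
  proof
    show "g absolutely_integrable_on {a..b}" for a b by (rule gabs)
    show "f b - f a = integral {a..b} g" if "a \<le> b" for a b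
      using ghas[OF that] by (simp add: integral_unique)
    show "negligible N" by fact
    fix x assume "x \<notin> N"
    then have "((\<lambda>u. integral {x - 1..u} g) has_real_derivative g x) (at x)"
      using N(2)[of x "x - 1"] by (simp add: has_real_derivative_iff_has_vector_derivative)
    then have "((\<lambda>u. f (x - 1) + integral {x - 1..u} g) has_real_derivative g x) (at x)"
      by (auto intro!: derivative_eq_intros)
    then show "(f has_real_derivative g x) (at x)"
      by (rule has_field_derivative_transform_within_open[of _ _ _ "{x - 1<..}"])
        (use integral_unique[OF ghas] in auto)
  qed
qed

lemma Lipschitz_compose_retraction:
  fixes f :: "real \<Rightarrow> 'a::metric_space"
  assumes "L-lipschitz_on S f" "\<And>x. r x \<in> S" "\<And>x y. \<bar>r x - r y\<bar> \<le> \<bar>x - y\<bar>"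
  shows "L-lipschitz_on UNIV (\<lambda>x. f (r x))"
proof (rule lipschitz_onI)
  fix x y :: real
  have "dist (f (r x)) (f (r y)) \<le> L * dist (r x) (r y)"
    using assms(2) by (intro lipschitz_onD[OF assms(1)])
  also have "\<dots> \<le> L * dist x y"
    using lipschitz_on_nonneg[OF assms(1)] assms(3) by (intro mult_left_mono) (auto simp: dist_real_def)
  finally show "dist (f (r x)) (f (r y)) \<le> L * dist x y" .
qed (rule lipschitz_on_nonneg[OF assms(1)])

text \<open>
  A Lipschitz function is differentiable almost everywhere and the integral of its derivative, so a
  bound on those derivatives that exist controls the increment.
\<close>
lemma Lipschitz_increment_le:
  fixes f :: "real \<Rightarrow> real"
  assumes lip: "L-lipschitz_on {a..b} f" and "a \<le> b" and "negligible N"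
    and der: "\<And>x D. a < x \<Longrightarrow> x < b \<Longrightarrow> x \<notin> N \<Longrightarrow> (f has_real_derivative D) (at x) \<Longrightarrow> D \<le> k"
  shows "f b - f a \<le> k * (b - a)"
proof -
  define F where "F = (\<lambda>x. f (max a (min b x)))"
  obtain g N' where g: "\<And>a b. g absolutely_integrable_on {a..b}"
    "\<And>a b. a \<le> b \<Longrightarrow> F b - F a = integral {a..b} g"
    "negligible N'" "\<And>x. x \<notin> N' \<Longrightarrow> (F has_real_derivative g x) (at x)"
  proof (rule Lipschitz_imp_indefinite_integral)
    show "L-lipschitz_on UNIV F"
      unfolding F_def by (rule Lipschitz_compose_retraction[OF lip]) (use \<open>a \<le> b\<close> in auto)
  qed (use that in blast)
  have le: "g x \<le> k" if "a < x" "x < b" "x \<notin> N \<union> N'" for x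
  proof (rule der)
    show "(f has_real_derivative g x) (at x)"
      by (rule has_field_derivative_transform_within_open[of F _ _ "{a<..<b}"])
        (use g(4) that in \<open>auto simp: F_def\<close>)
  qed (use that in auto)
  let ?N = "N \<union> N' \<union> {a, b}"
  let ?g = "\<lambda>x. if x \<in> ?N then k else g x"
  have N: "negligible ?N"
    using assms(3) g(3) by (intro negligible_Un) auto
  have gi: "g integrable_on {a..b}"
    using g(1) set_lebesgue_integral_eq_integral(1) by blast
  have "integral {a..b} g = integral {a..b} ?g"
    by (rule integral_spike[OF N]) auto
  also have "\<dots> \<le> integral {a..b} (\<lambda>_. k)"
  proof (rule integral_le)
    show "?g integrable_on {a..b}"
      by (rule integrable_spike[OF gi N]) auto
  qed (use le in \<open>auto simp: less_le\<close>)
  also have "\<dots> = k * (b - a)"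
    using \<open>a \<le> b\<close> by simp
  finally show ?thesis
    using g(2)[OF \<open>a \<le> b\<close>] \<open>a \<le> b\<close> by (simp add: F_def)
qed

text \<open>
  The bound in \<open>admissible_perturbation\<close> concerns the points of differentiability only; it has
  content because almost every point is one. Replacing the derivative by \<open>0\<close> on a null set makes the
  bound hold everywhere.
\<close>
lemma admissible_perturbation_integral:
  assumes "admissible_perturbation M \<phi>" "M \<ge> 0"
  obtains h N where "\<And>a b. h absolutely_integrable_on {a..b}" "\<And>t. \<bar>h t\<bar> \<le> M"
    "\<And>a b. 0 \<le> a \<Longrightarrow> a \<le> b \<Longrightarrow> \<phi> b - \<phi> a = integral {a..b} h"
    "negligible N" "\<And>t. t > 0 \<Longrightarrow> t \<notin> N \<Longrightarrow> (\<phi> has_real_derivative h t) (at t)"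
proof -
  obtain L where L: "L-lipschitz_on {0..} \<phi>"
    and ae: "AE t in lebesgue. 0 \<le> t \<longrightarrow> \<phi> differentiable (at t) \<longrightarrow> \<bar>deriv \<phi> t\<bar> \<le> M"
    using assms(1) by (auto simp: admissible_perturbation_def)
  obtain N0 where N0: "negligible N0"
    "\<And>t. t \<notin> N0 \<Longrightarrow> 0 \<le> t \<Longrightarrow> \<phi> differentiable (at t) \<Longrightarrow> \<bar>deriv \<phi> t\<bar> \<le> M"
  proof -
    obtain N where "N \<in> null_sets lebesgue"
      "{t \<in> space lebesgue. \<not> (0 \<le> t \<longrightarrow> \<phi> differentiable (at t) \<longrightarrow> \<bar>deriv \<phi> t\<bar> \<le> M)} \<subseteq> N"
      using ae unfolding eventually_ae_filter by auto
    then show thesis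
      by (intro that[of N]) (auto simp: negligible_iff_null_sets)
  qed
  define F where "F = (\<lambda>x. \<phi> (max 0 x))"
  have "L-lipschitz_on UNIV F"
    unfolding F_def by (rule Lipschitz_compose_retraction[OF L]) auto
  then obtain g N where g: "\<And>a b. g absolutely_integrable_on {a..b}"
    "\<And>a b. a \<le> b \<Longrightarrow> F b - F a = integral {a..b} g"
    "negligible N" "\<And>x. x \<notin> N \<Longrightarrow> (F has_real_derivative g x) (at x)"
    using Lipschitz_imp_indefinite_integral by blast
  have der: "(\<phi> has_real_derivative g x) (at x)" if "x > 0" "x \<notin> N" for x
    by (rule has_field_derivative_transform_within_open[of F _ _ "{0<..}"])
      (use g(4) that in \<open>auto simp: F_def\<close>)
  have bd: "\<bar>g x\<bar> \<le> M" if "x \<notin> N \<union> N0 \<union> {0}" for x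
  proof (cases "x > 0")
    case True
    then have "\<phi> differentiable (at x)" "deriv \<phi> x = g x"
      using der[of x] that real_differentiable_def DERIV_imp_deriv by auto
    then show ?thesis
      using N0(2)[of x] that True by simp
  next
    case False
    have "((\<lambda>_. \<phi> 0) has_real_derivative 0) (at x)" by simp
    then have "(F has_real_derivative 0) (at x)"
      by (rule has_field_derivative_transform_within_open[of _ _ _ "{..<0}"])
        (use False that in \<open>auto simp: F_def\<close>)
    then have "g x = 0"
      using g(4)[of x] that DERIV_unique by blast
    then show ?thesis using assms(2) by simp
  qed
  define h where "h = (\<lambda>x. if \<bar>g x\<bar> \<le> M then g x else 0)"
  show ?thesis
  proof
    show N: "negligible (N \<union> N0 \<union> {0})"
      using g(3) N0(1) by (intro negligible_Un) auto
    show "h absolutely_integrable_on {a..b}" for a b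
      by (rule absolutely_integrable_spike[OF g(1) N]) (use bd in \<open>auto simp: h_def\<close>)
    show "\<bar>h t\<bar> \<le> M" for t
      using assms(2) by (simp add: h_def)
    show "\<phi> b - \<phi> a = integral {a..b} h" if "0 \<le> a" "a \<le> b" for a b
    proof -
      have "integral {a..b} h = integral {a..b} g"
        by (rule integral_spike[OF N]) (use bd in \<open>auto simp: h_def\<close>)
      then show ?thesis
        using g(2)[of a b] that by (simp add: F_def max_def)
    qed
    show "(\<phi> has_real_derivative h t) (at t)" if "t > 0" "t \<notin> N \<union> N0 \<union> {0}" for t
      using der[of t] bd[of t] that by (auto simp: h_def)
  qed
qed

lemma norm_integral_le_AE:
  fixes v :: "real \<Rightarrow> 'a::euclidean_space"
  assumes v: "v integrable_on {s..t}" and "negligible N" "s \<le> t" "K \<ge> 0"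
    and bound: "\<And>\<tau>. s \<le> \<tau> \<Longrightarrow> \<tau> \<le> t \<Longrightarrow> \<tau> \<notin> N \<Longrightarrow> norm (v \<tau>) \<le> K"
  shows "norm (integral {s..t} v) \<le> K * (t - s)"
proof -
  let ?v = "\<lambda>\<tau>. if \<tau> \<in> N then 0 else v \<tau>"
  have "?v integrable_on {s..t}"
    by (rule integrable_spike[OF v \<open>negligible N\<close>]) auto
  then have "norm (integral {s..t} ?v) \<le> integral {s..t} (\<lambda>_. K)"
    by (rule integral_norm_bound_integral) (use bound \<open>K \<ge> 0\<close> in auto)
  moreover have "integral {s..t} ?v = integral {s..t} v"
    by (rule integral_spike[OF \<open>negligible N\<close>]) auto
  ultimately show ?thesis
    using \<open>s \<le> t\<close> by (simp add: mult.commute)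
qed

section \<open>Decrease along trajectories\<close>

lemma compact_continuous_norm_bound:
  fixes f :: "'a::topological_space \<Rightarrow> 'b::real_normed_vector"
  assumes "compact S" "continuous_on S f"
  obtains K where "K \<ge> 0" "\<And>x. x \<in> S \<Longrightarrow> norm (f x) \<le> K"
proof -
  obtain K where "\<forall>x\<in>S. norm (f x) \<le> K"
    using compact_imp_bounded[OF compact_continuous_image[OF assms(2,1)]] by (auto simp: bounded_iff)
  then show ?thesis
    by (intro that[of "max K 0"]) (auto simp: le_max_iff_disj)
qed

lemma continuous_le_at_left_end:
  fixes g :: "real \<Rightarrow> real"
  assumes "continuous_on {u..t} g" "u < t" "\<And>v. u < v \<Longrightarrow> v < t \<Longrightarrow> C \<le> g v"
  shows "C \<le> g u"
proof (rule tendsto_lowerbound)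
  have "(g \<longlongrightarrow> g u) (at u within {u..t})"
    using assms(1,2) by (auto simp: continuous_on_def)
  then show "(g \<longlongrightarrow> g u) (at_right u)"
    using assms(2) by (simp add: at_within_Icc_at_right)
  show "\<forall>\<^sub>F v in at_right u. C \<le> g v"
    using assms(2,3) by (intro eventually_at_rightI[of u t]) auto
qed simp

text \<open>
  The set of times at which \<open>g\<close> is at most \<open>g a\<close> is closed, and its supremum can be pushed to the
  right unless it is \<open>b\<close>. One-sided neighbourhoods suffice, so an isolated singular time does no
  harm.
\<close>
lemma continuous_locally_decreasing_imp_le:
  fixes g :: "real \<Rightarrow> real"
  assumes cont: "continuous_on {a..b} g" and "a \<le> b"
    and loc: "\<And>t. a \<le> t \<Longrightarrow> t < b \<Longrightarrow> \<exists>\<delta>>0. \<forall>s. t < s \<longrightarrow> s < t + \<delta> \<longrightarrow> s \<le> b \<longrightarrow> g s \<le> g t"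
  shows "g b \<le> g a"
proof -
  define S where "S = {t\<in>{a..b}. g t \<le> g a}"
  have S: "closed S" "S \<noteq> {}" "bdd_above S"
    using continuous_closed_preimage[OF cont closed_atLeastAtMost, of "{..g a}"] \<open>a \<le> b\<close>
    by (auto simp: S_def vimage_def Int_def bdd_above_def)
  have sup: "Sup S \<in> S"
    using closed_contains_Sup[OF S(2,3,1)] .
  have "Sup S = b"
  proof (rule ccontr)
    assume "Sup S \<noteq> b"
    with sup have lt: "a \<le> Sup S" "Sup S < b" "g (Sup S) \<le> g a"
      by (auto simp: S_def)
    then obtain \<delta> where \<delta>: "\<delta> > 0" "\<And>s. Sup S < s \<Longrightarrow> s < Sup S + \<delta> \<Longrightarrow> s \<le> b \<Longrightarrow> g s \<le> g (Sup S)"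
      using loc by blast
    define s where "s = min b (Sup S + \<delta> / 2)"
    have s: "Sup S < s" "s < Sup S + \<delta>" "s \<le> b"
      using \<delta>(1) lt(2) by (auto simp: s_def)
    then have "s \<in> S"
      using \<delta>(2)[OF s] lt by (simp add: S_def)
    then show False
      using cSup_upper[OF \<open>s \<in> S\<close> S(3)] s(1) by simp
  qed
  with sup show ?thesis by (simp add: S_def)
qed

text \<open>
  The composition of a continuously differentiable function with a Lipschitz curve is locally
  Lipschitz, so that its derivative almost everywhere determines its increments.
\<close>
lemma decreasing_along_gradient:
  fixes x :: "real \<Rightarrow> 'a::euclidean_space"
  assumes "open S" and der: "\<And>y. y \<in> S \<Longrightarrow> (\<Phi> has_derivative (\<lambda>h. Gr y \<bullet> h)) (at y)"
    and cont: "continuous_on S Gr"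
    and lip: "K-lipschitz_on {a..b} x" and xS: "\<And>t. a \<le> t \<Longrightarrow> t \<le> b \<Longrightarrow> x t \<in> S"
    and "negligible N"
    and rate: "\<And>t. a < t \<Longrightarrow> t < b \<Longrightarrow> t \<notin> N \<Longrightarrow>
        \<exists>v. (x has_vector_derivative v) (at t) \<and> Gr (x t) \<bullet> v \<le> - r"
    and "a \<le> b"
  shows "\<Phi> (x b) \<le> \<Phi> (x a) - r * (b - a)"
proof -
  have K0: "K \<ge> 0" using lip by (rule lipschitz_on_nonneg)
  have xcont: "continuous_on {a..b} x"
    using lip by (rule lipschitz_on_continuous_on)
  have \<Phi>cont: "continuous_on S \<Phi>"
    using der by (meson continuous_at_imp_continuous_on has_derivative_continuous)
  define g where "g = (\<lambda>t. \<Phi> (x t) + r * t)"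
  have "g b \<le> g a"
  proof (rule continuous_locally_decreasing_imp_le[OF _ \<open>a \<le> b\<close>])
    show "continuous_on {a..b} g"
      unfolding g_def using xS by (intro continuous_intros continuous_on_compose2[OF \<Phi>cont xcont]) auto
    fix t assume t: "a \<le> t" "t < b"
    obtain \<rho> where \<rho>: "\<rho> > 0" "cball (x t) \<rho> \<subseteq> S"
      using \<open>open S\<close> xS[of t] t by (meson less_imp_le open_contains_cball)
    obtain B where B0: "B \<ge> 0" and B: "\<And>y. y \<in> cball (x t) \<rho> \<Longrightarrow> norm (Gr y) \<le> B"
      using compact_continuous_norm_bound[OF compact_cball continuous_on_subset[OF cont \<rho>(2)]] by blast
    have \<Phi>lip: "\<bar>\<Phi> y - \<Phi> y'\<bar> \<le> B * norm (y - y')" if "y \<in> cball (x t) \<rho>" "y' \<in> cball (x t) \<rho>" for y y'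
    proof -
      have "norm (\<Phi> y - \<Phi> y') \<le> B * norm (y - y')"
      proof (rule differentiable_bound[OF convex_cball _ _ that])
        fix y assume y: "y \<in> cball (x t) \<rho>"
        show "(\<Phi> has_derivative (\<lambda>h. Gr y \<bullet> h)) (at y within cball (x t) \<rho>)"
          using der y \<rho>(2) by (blast intro: has_derivative_at_withinI)
        show "onorm (\<lambda>h. Gr y \<bullet> h) \<le> B"
        proof (rule onorm_bound[OF B0])
          fix h
          have "\<bar>Gr y \<bullet> h\<bar> \<le> norm (Gr y) * norm h"
            by (rule Cauchy_Schwarz_ineq2)
          also have "\<dots> \<le> B * norm h"
            using B y by (intro mult_right_mono) auto
          finally show "norm (Gr y \<bullet> h) \<le> B * norm h" by simp
        qed
      qed
      then show ?thesis by simp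
    qed
    define \<delta> where "\<delta> = \<rho> / (K + 1)"
    have \<delta>: "\<delta> > 0" "K * \<delta> \<le> \<rho>"
      using K0 \<rho>(1) by (auto simp: \<delta>_def field_simps)
    show "\<exists>\<delta>>0. \<forall>s. t < s \<longrightarrow> s < t + \<delta> \<longrightarrow> s \<le> b \<longrightarrow> g s \<le> g t"
    proof (intro exI[of _ \<delta>] conjI allI impI \<delta>(1))
      fix s assume s: "t < s" "s < t + \<delta>" "s \<le> b"
      have xlip: "norm (x u - x u') \<le> K * \<bar>u - u'\<bar>" if "u \<in> {t..s}" "u' \<in> {t..s}" for u u'
        using lipschitz_onD[OF lip, of u u'] that s t by (auto simp: dist_norm)
      have inball: "x u \<in> cball (x t) \<rho>" if "u \<in> {t..s}" for u
      proof -
        have "norm (x u - x t) \<le> K * \<bar>u - t\<bar>" using xlip[of u t] that by auto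
        also have "\<dots> \<le> K * \<delta>" using that s K0 by (intro mult_left_mono) auto
        finally show ?thesis using \<delta>(2) by (simp add: dist_norm norm_minus_commute)
      qed
      have "(B * K)-lipschitz_on {t..s} (\<lambda>u. \<Phi> (x u))"
      proof (rule lipschitz_onI)
        fix u u' assume u: "u \<in> {t..s}" "u' \<in> {t..s}"
        have "\<bar>\<Phi> (x u) - \<Phi> (x u')\<bar> \<le> B * norm (x u - x u')"
          by (intro \<Phi>lip inball u)
        also have "\<dots> \<le> B * (K * \<bar>u - u'\<bar>)"
          by (intro mult_left_mono xlip u B0)
        finally show "dist (\<Phi> (x u)) (\<Phi> (x u')) \<le> B * K * dist u u'"
          by (simp add: dist_real_def mult.assoc)
      qed (use B0 K0 in simp)
      then have "\<Phi> (x s) - \<Phi> (x t) \<le> - r * (s - t)"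
      proof (rule Lipschitz_increment_le[OF _ _ \<open>negligible N\<close>])
        fix u D assume u: "t < u" "u < s" "u \<notin> N" and D: "((\<lambda>u. \<Phi> (x u)) has_real_derivative D) (at u)"
        obtain v where v: "(x has_vector_derivative v) (at u)" "Gr (x u) \<bullet> v \<le> - r"
          using rate[of u] u s t by auto
        have "((\<lambda>u. \<Phi> (x u)) has_derivative (\<lambda>h. Gr (x u) \<bullet> (h *\<^sub>R v))) (at u)"
          using has_derivative_compose[OF v(1)[unfolded has_vector_derivative_def] der] xS[of u] u s t by simp
        then have "((\<lambda>u. \<Phi> (x u)) has_real_derivative (Gr (x u) \<bullet> v)) (at u)"
          by (simp add: has_field_derivative_def mult.commute[of _ "Gr (x u) \<bullet> v"])
        then show "D \<le> - r"
          using D v(2) DERIV_unique by metis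
      qed (use s in simp)
      then show "g s \<le> g t" by (simp add: g_def algebra_simps)
    qed
  qed
  then show ?thesis by (simp add: g_def algebra_simps)
qed

section \<open>Filippov sets and Filippov solutions\<close>

lemma convex_filippov: "convex (filippov F x)"
  unfolding filippov_def by (intro convex_INT convex_closure convex_convex_hull)

lemma filippov_subset_closed_convex:
  assumes "\<And>y. F y \<in> C" "closed C" "convex C"
  shows "filippov F x \<subseteq> C"
proof -
  have "filippov F x \<subseteq> closure (convex hull (F ` (ball x 1 - {})))"
    unfolding filippov_def using negligible_empty by fastforce
  also have "\<dots> \<subseteq> C"
    using assms by (intro closure_minimal hull_minimal) auto
  finally show ?thesis .
qed

lemma filippov_bounded_linear:
  assumes "bounded_linear h" "v \<in> filippov F x"
  shows "h v \<in> filippov (\<lambda>y. h (F y)) x"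
proof -
  have "h v \<in> closure (convex hull ((\<lambda>y. h (F y)) ` (ball x \<delta> - N)))" if "\<delta> > 0" "negligible N" for \<delta> N
  proof -
    have "v \<in> closure (convex hull (F ` (ball x \<delta> - N)))"
      using assms(2) that by (auto simp: filippov_def)
    then have "h v \<in> h ` closure (convex hull (F ` (ball x \<delta> - N)))"
      by blast
    also have "\<dots> \<subseteq> closure (h ` (convex hull (F ` (ball x \<delta> - N))))"
      using linear_continuous_on[OF assms(1)]
      by (rule image_closure_subset[OF _ closed_closure closure_subset])
    also have "h ` (convex hull (F ` (ball x \<delta> - N))) = convex hull ((\<lambda>y. h (F y)) ` (ball x \<delta> - N))"
      using assms(1) by (simp add: convex_hull_linear_image bounded_linear.linear image_image)
    finally show ?thesis .
  qed
  then show ?thesis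
    by (auto simp: filippov_def)
qed

text \<open>
  At a point of discontinuity the Filippov set contains the limits of the values at nearby points
  of continuity, because such values cannot be removed by discarding a null set.
\<close>
lemma filippov_limit:
  assumes "X \<longlonglongrightarrow> x" "\<And>n. isCont F (X n)" "(\<lambda>n. F (X n)) \<longlonglongrightarrow> l"
  shows "l \<in> filippov F x"
proof -
  have "l \<in> closure (convex hull (F ` (ball x \<delta> - N)))" if "\<delta> > 0" "negligible N" for \<delta> N
  proof (rule Lim_in_closed_set[OF closed_closure _ _ assms(3)])
    have "\<forall>\<^sub>F n in sequentially. dist (X n) x < \<delta>"
      using tendstoD[OF assms(1) \<open>\<delta> > 0\<close>] .
    then show "\<forall>\<^sub>F n in sequentially. F (X n) \<in> closure (convex hull (F ` (ball x \<delta> - N)))"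
    proof eventually_elim
      case (elim n)
      obtain d where d: "d > 0" "ball (X n) d \<subseteq> ball x \<delta>"
        using elim by (meson open_ball open_contains_ball mem_ball dist_commute_lessI)
      have "F (X n) \<in> filippov F (X n)"
        using filippov_isCont[OF assms(2)] by blast
      then have "F (X n) \<in> closure (convex hull (F ` (ball (X n) d - N)))"
        using d(1) that(2) by (auto simp: filippov_def)
      also have "\<dots> \<subseteq> closure (convex hull (F ` (ball x \<delta> - N)))"
        using d(2) by (intro closure_mono hull_mono) auto
      finally show ?case .
    qed
  qed auto
  then show ?thesis
    by (auto simp: filippov_def)
qed

text \<open>
  The form in which solutions are used below: on a compact time interval, the velocity in the
  definition of a solution is also the derivative of the solution almost everywhere.
\<close>
lemma filippov_solution_velocity:
  assumes "filippov_solution F b x" "0 \<le> T" "ereal T < b"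
  obtains v N where "v absolutely_integrable_on {0..T}"
    "\<And>s t. 0 \<le> s \<Longrightarrow> s \<le> t \<Longrightarrow> t \<le> T \<Longrightarrow> x t - x s = integral {s..t} v"
    "negligible N"
    "\<And>t. 0 \<le> t \<Longrightarrow> t \<le> T \<Longrightarrow> t \<notin> N \<Longrightarrow> v t \<in> filippov (F t) (x t)"
    "\<And>t. 0 < t \<Longrightarrow> t < T \<Longrightarrow> t \<notin> N \<Longrightarrow> (x has_vector_derivative v t) (at t)"
proof -
  obtain v where v: "\<And>t. 0 \<le> t \<Longrightarrow> ereal t < b \<Longrightarrow> v absolutely_integrable_on {0..t}"
      "\<And>t. 0 \<le> t \<Longrightarrow> ereal t < b \<Longrightarrow> x t = x 0 + integral {0..t} v"
    and N: "negligible {t. 0 \<le> t \<and> ereal t < b \<and> v t \<notin> filippov (F t) (x t)}" (is "negligible ?N")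
    using assms(1) unfolding filippov_solution_def by blast
  have lt: "ereal t < b" if "t \<le> T" for t
    using that assms(3) by (auto intro: le_less_trans[of "ereal t" "ereal T"])
  have vint: "v integrable_on {0..T}"
    using v(1)[OF assms(2,3)] set_lebesgue_integral_eq_integral(1) by blast
  have inc: "x t - x s = integral {s..t} v" if "0 \<le> s" "s \<le> t" "t \<le> T" for s t
  proof -
    have "integral {0..s} v + integral {s..t} v = integral {0..t} v"
      using that vint by (intro Henstock_Kurzweil_Integration.integral_combine)
        (auto intro: integrable_on_subinterval)
    then show ?thesis
      using v(2)[of s] v(2)[of t] that lt by (simp add: algebra_simps)
  qed
  define w where "w = (\<lambda>t. if t \<in> {0..T} then v t else 0)"
  have "w integrable_on {c..d}" for c d
    by (rule integrable_on_subinterval[of _ UNIV])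
      (use vint in \<open>simp_all only: w_def integrable_restrict_UNIV subset_UNIV\<close>)
  then obtain N' where N': "negligible N'"
    "\<And>a x. x \<notin> N' \<Longrightarrow> a < x \<Longrightarrow> ((\<lambda>u. integral {a..u} w) has_vector_derivative w x) (at x)"
    using indefinite_integral_has_vector_derivative_AE[of w] by auto
  show ?thesis
  proof
    show "negligible (?N \<union> N')"
      using N N'(1) by (rule negligible_Un)
    show "v absolutely_integrable_on {0..T}"
      using v(1)[OF assms(2,3)] .
    show "v t \<in> filippov (F t) (x t)" if "0 \<le> t" "t \<le> T" "t \<notin> ?N \<union> N'" for t
      using that lt by auto
    show "(x has_vector_derivative v t) (at t)" if t: "0 < t" "t < T" "t \<notin> ?N \<union> N'" for t
    proof (rule has_vector_derivative_transform_within_open[of _ _ _ "{0<..<T}"])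
      have "((\<lambda>u. integral {0..u} w) has_vector_derivative v t) (at t)"
        using N'(2)[of t 0] t by (simp add: w_def)
      then show "((\<lambda>u. x 0 + integral {0..u} w) has_vector_derivative v t) (at t)"
        by (auto intro!: derivative_eq_intros)
      fix u assume u: "u \<in> {0<..<T}"
      then have "integral {0..u} w = integral {0..u} v"
        by (intro integral_cong) (auto simp: w_def)
      then show "x 0 + integral {0..u} w = x u"
        using inc[of 0 u] u by (simp add: algebra_simps)
    qed (use t in auto)
  qed (use inc in auto)
qed

lemma filippov_solution_continuous:
  assumes "filippov_solution F b x"
  shows "continuous_on {t. 0 \<le> t \<and> ereal t < b} x"
proof -
  have "continuous (at t within {t. 0 \<le> t \<and> ereal t < b}) x" if t: "0 \<le> t" "ereal t < b" for t
  proof -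
    obtain T where T: "t < T" "ereal T < b"
      using t(2) ereal_dense2[of "ereal t" b] by auto
    obtain v N where v: "v absolutely_integrable_on {0..T}"
      "\<And>s t. 0 \<le> s \<Longrightarrow> s \<le> t \<Longrightarrow> t \<le> T \<Longrightarrow> x t - x s = integral {s..t} v"
    proof (rule filippov_solution_velocity[OF assms _ T(2)])
      show "0 \<le> T" using t T by simp
    qed (use that in blast)
    have "v integrable_on {0..T}"
      using v(1) set_lebesgue_integral_eq_integral(1) by blast
    then have "continuous_on {0..T} (\<lambda>u. x 0 + integral {0..u} v)"
      by (intro continuous_intros indefinite_integral_continuous_1)
    moreover have "x 0 + integral {0..u} v = x u" if "u \<in> {0..T}" for u
      using v(2)[of 0 u] that by (simp add: algebra_simps)
    ultimately have "continuous_on {0..T} x"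
      by (rule continuous_on_eq)
    then have "continuous (at t within {0..T}) x"
      using t T by (auto simp: continuous_on_eq_continuous_within)
    moreover have "at t within {0..T} = at t within {t. 0 \<le> t \<and> ereal t < b}"
    proof (rule at_within_nhd[of _ "{..<T}"])
      show "{0..T} \<inter> {..<T} - {t} = {t. 0 \<le> t \<and> ereal t < b} \<inter> {..<T} - {t}"
        using T by (auto intro: less_trans[of _ "ereal T"])
    qed (use T in auto)
    ultimately show ?thesis by simp
  qed
  then show ?thesis
    by (auto simp: continuous_on_eq_continuous_within)
qed

text \<open>
  With a bounded velocity the solution is Lipschitz and has a limit at the finite end time; a local
  solution from the limit point is glued on there.
\<close>
lemma bounded_solution_not_maximal:
  assumes sol: "filippov_solution F (ereal T) x"
    and bound: "\<And>t v. 0 \<le> t \<Longrightarrow> t < T \<Longrightarrow> v \<in> filippov (F t) (x t) \<Longrightarrow> norm v \<le> K"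
    and continue: "\<And>x1. (x \<longlongrightarrow> x1) (at_left T) \<Longrightarrow>
        \<exists>\<delta>>0. \<exists>y. filippov_solution (\<lambda>s. F (T + s)) (ereal \<delta>) y \<and> y 0 = x1"
  shows "\<not> maximal_solution F (ereal T) x"
proof -
  have "T > 0"
    using sol by (simp add: filippov_solution_def)
  obtain v0 where v0: "\<And>t. 0 \<le> t \<Longrightarrow> t < T \<Longrightarrow> v0 absolutely_integrable_on {0..t}"
      "\<And>t. 0 \<le> t \<Longrightarrow> t < T \<Longrightarrow> x t = x 0 + integral {0..t} v0"
    and N: "negligible {t. 0 \<le> t \<and> t < T \<and> v0 t \<notin> filippov (F t) (x t)}" (is "negligible ?N")
    using sol unfolding filippov_solution_def by auto
  \<comment> \<open>The value \<open>0\<close> at the end time and on the exceptional null set keeps \<open>v\<close> bounded everywhere.\<close>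
  define v where "v = (\<lambda>t. if 0 \<le> t \<and> t < T \<and> t \<notin> ?N then v0 t else 0)"
  define K' where "K' = max K 0"
  have vK: "norm (v t) \<le> K'" for t
    using bound[of t "v0 t"] by (auto simp: v_def K'_def)
  have v1: "v integrable_on {0..t}" "x t = x 0 + integral {0..t} v" if t: "0 \<le> t" "t < T" for t
  proof -
    show "v integrable_on {0..t}"
    proof (rule integrable_spike[OF _ N])
      show "v0 integrable_on {0..t}"
        using v0(1)[OF t] set_lebesgue_integral_eq_integral(1) by blast
    qed (use t in \<open>simp add: v_def\<close>)
    have "integral {0..t} v = integral {0..t} v0"
      by (intro integral_spike[OF N]) (use t in \<open>auto simp: v_def\<close>)
    then show "x t = x 0 + integral {0..t} v"
      using v0(2)[OF t] by simp
  qed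
  have vint: "v integrable_on {0..T}"
  proof (rule dominated_convergence(1))
    let ?t = "\<lambda>n. T - T / real (Suc n)"
    let ?f = "\<lambda>n t. if t \<in> {0..?t n} then v t else 0"
    show "?f n integrable_on {0..T}" for n
    proof -
      have "v integrable_on {0..?t n}"
        using \<open>T > 0\<close> by (intro v1) (auto simp: field_simps)
      then have "?f n integrable_on UNIV"
        by (simp only: integrable_restrict_UNIV)
      then show ?thesis
        by (rule integrable_on_subinterval) auto
    qed
    show "norm (?f n t) \<le> K'" for n t
      using vK[of t] by (auto simp: K'_def)
    show "(\<lambda>n. ?f n t) \<longlonglongrightarrow> v t" if t: "t \<in> {0..T}" for t
    proof (cases "t = T")
      case True
      then have "v t = 0" by (simp add: v_def)
      then show ?thesis by (simp cong: if_cong)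
    next
      case False
      have "?t \<longlonglongrightarrow> T - 0"
        by (intro tendsto_diff tendsto_const LIMSEQ_Suc lim_const_over_n)
      then have "\<forall>\<^sub>F n in sequentially. t < ?t n"
        using False t by (intro order_tendstoD(1)) auto
      then have "\<forall>\<^sub>F n in sequentially. ?f n t = v t"
        by eventually_elim (use t in auto)
      then show ?thesis
        by (rule tendsto_eventually)
    qed
  qed auto
  define x1 where "x1 = x 0 + integral {0..T} v"
  have xlim: "(x \<longlongrightarrow> x1) (at_left T)"
  proof -
    have "continuous_on {0..T} (\<lambda>u. x 0 + integral {0..u} v)"
      using vint by (intro continuous_intros indefinite_integral_continuous_1)
    then have "((\<lambda>u. x 0 + integral {0..u} v) \<longlongrightarrow> x1) (at T within {0..T})"
      using \<open>T > 0\<close> by (simp add: continuous_on_def x1_def)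
    then have "((\<lambda>u. x 0 + integral {0..u} v) \<longlongrightarrow> x1) (at_left T)"
      using \<open>T > 0\<close> by (simp add: at_within_Icc_at_left)
    then show ?thesis
    proof (rule Lim_transform_eventually)
      have "\<forall>\<^sub>F u in at_left T. u \<in> {0<..<T}"
        using \<open>T > 0\<close> by (rule eventually_at_leftI[rotated])
      then show "\<forall>\<^sub>F u in at_left T. x 0 + integral {0..u} v = x u"
        by eventually_elim (simp add: v1(2)[symmetric])
    qed
  qed
  obtain \<delta> y where "\<delta> > 0" and y: "filippov_solution (\<lambda>s. F (T + s)) (ereal \<delta>) y" "y 0 = x1"
    using continue[OF xlim] by blast
  obtain u where u: "\<And>t. 0 \<le> t \<Longrightarrow> t < \<delta> \<Longrightarrow> u absolutely_integrable_on {0..t}"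
      "\<And>t. 0 \<le> t \<Longrightarrow> t < \<delta> \<Longrightarrow> y t = x1 + integral {0..t} u"
    and N': "negligible {t. 0 \<le> t \<and> t < \<delta> \<and> u t \<notin> filippov (F (T + t)) (y t)}" (is "negligible ?N'")
    using y unfolding filippov_solution_def by auto
  define z where "z = (\<lambda>t. if t < T then x t else y (t - T))"
  define w where "w = (\<lambda>t. if t < T then v t else u (t - T))"
  have "filippov_solution F (ereal (T + \<delta>)) z"
    unfolding filippov_solution_def
  proof (intro conjI exI allI impI)
    show "0 < ereal (T + \<delta>)" using \<open>T > 0\<close> \<open>\<delta> > 0\<close> by simp
    have wv: "w absolutely_integrable_on {0..t}" "integral {0..t} w = integral {0..t} v" if "t \<le> T" for t
    proof -
      have "v integrable_on {0..t}"
        using vint that by (cases "0 \<le> t") (auto intro: integrable_on_subinterval)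
      then have "v absolutely_integrable_on {0..t}"
        by (rule absolutely_integrable_integrable_bound[where g = "\<lambda>_. K'", rotated]) (use vK in auto)
      then show "w absolutely_integrable_on {0..t}"
        by (rule absolutely_integrable_spike[of _ _ "{T}"]) (use that in \<open>auto simp: w_def\<close>)
      show "integral {0..t} w = integral {0..t} v"
        by (rule integral_spike[of "{T}"]) (use that in \<open>auto simp: w_def\<close>)
    qed
    fix t :: real assume t: "0 \<le> t" "ereal t < ereal (T + \<delta>)"
    have "w absolutely_integrable_on {0..t} \<and> z t = z 0 + integral {0..t} w"
    proof (cases "t < T")
      case True
      then show ?thesis
        using wv[of t] v1(2)[of t] t \<open>T > 0\<close> by (simp add: z_def)
    next
      case False
      have U: "u absolutely_integrable_on {0..t - T}"
        using u(1)[of "t - T"] t False by simp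
      have shift: "((\<lambda>s. g (s - T)) has_integral I) {T..t}" if "(g has_integral I) {0..t - T}"
        for g :: "real \<Rightarrow> 'c::euclidean_space" and I
        using has_integral_shift_real_ivl[OF that, of "- T"] by simp
      have "((\<lambda>s. u (s - T)) has_integral integral {0..t - T} u) {T..t}"
        "((\<lambda>s. norm (u (s - T))) has_integral integral {0..t - T} (\<lambda>s. norm (u s))) {T..t}"
        using U unfolding absolutely_integrable_on_def by (auto intro!: shift integrable_integral)
      then have wi: "(w has_integral integral {0..t - T} u) {T..t}" and
        "((\<lambda>s. norm (w s)) has_integral integral {0..t - T} (\<lambda>s. norm (u s))) {T..t}"
        by (auto intro: has_integral_eq[rotated] simp: w_def)
      then have wa: "w absolutely_integrable_on {T..t}"
        unfolding absolutely_integrable_on_def by blast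
      have a: "w absolutely_integrable_on {0..t}"
        using absolutely_integrable_on_combine[OF wv(1)[OF order_refl] wa] False \<open>T > 0\<close> by simp
      have "integral {0..T} w + integral {T..t} w = integral {0..t} w"
        using a False \<open>T > 0\<close> set_lebesgue_integral_eq_integral(1)
        by (intro Henstock_Kurzweil_Integration.integral_combine) auto
      then have "integral {0..t} w = integral {0..T} v + integral {0..t - T} u"
        using wv(2)[of T] integral_unique[OF wi] by simp
      then show ?thesis
        using a u(2)[of "t - T"] t False \<open>T > 0\<close> by (simp add: z_def x1_def)
    qed
    then show "w absolutely_integrable_on {0..t}" "z t = z 0 + integral {0..t} w"
      by auto
  next
    have "negligible (?N \<union> ((+) T) ` ?N')"
      using N N' by (intro negligible_Un negligible_translation)
    then show "negligible {t. 0 \<le> t \<and> ereal t < ereal (T + \<delta>) \<and> w t \<notin> filippov (F t) (z t)}"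
    proof (rule negligible_subset, safe)
      fix t assume t: "0 \<le> t" "ereal t < ereal (T + \<delta>)" "w t \<notin> filippov (F t) (z t)"
        and nin: "t \<notin> (+) T ` ?N'"
      show "t < T"
      proof (rule ccontr)
        assume "\<not> t < T"
        then have "t - T \<in> ?N'"
          using t by (auto simp: w_def z_def)
        moreover have "t = T + (t - T)" by simp
        ultimately show False using nin by blast
      qed
      then show False if "v0 t \<in> filippov (F t) (x t)"
        using that t by (auto simp: w_def v_def z_def)
    qed
  qed
  moreover have "ereal T < ereal (T + \<delta>)" using \<open>\<delta> > 0\<close> by simp
  moreover have "z t = x t" if "ereal t < ereal T" for t
    using that by (simp add: z_def)
  ultimately show ?thesis
    unfolding maximal_solution_def by blast
qed

section \<open>Local existence of solutions\<close>

lemma bounded_borel_integrable_Icc: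
  fixes g :: "real \<Rightarrow> 'a::euclidean_space"
  assumes "g \<in> borel_measurable borel" "bounded (g ` {a..b})"
  shows "g absolutely_integrable_on {a..b}"
proof -
  obtain B where B: "\<And>x. x \<in> {a..b} \<Longrightarrow> norm (g x) \<le> B"
    using assms(2) unfolding bounded_iff by blast
  have "g \<in> borel_measurable (lebesgue_on {a..b})"
    using assms(1) by (intro measurable_restrict_space1) (simp add: measurable_completion)
  then have "g integrable_on {a..b}"
    by (rule measurable_bounded_by_integrable_imp_integrable[where g = "\<lambda>_. B"]) (use B in auto)
  then show ?thesis
    by (rule absolutely_integrable_integrable_bound[rotated, where g = "\<lambda>_. B"]) (use B in auto)
qed

text \<open>
  Peano's theorem by Euler polygons and Arzela--Ascoli, for a field that need not be continuous at
  the initial point. The field has a component of at least \<open>\<eta>\<close> in direction \<open>e\<close>, so all polygons, and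
  their limit, lie at time \<open>t\<close> in the half space where \<open>e \<bullet> (x - x0) \<ge> \<eta> * t\<close>; continuity is needed
  only there. The choice \<open>e = 0\<close>, \<open>\<eta> = 0\<close> is the classical theorem.
\<close>
lemma local_solution_of_directed_field:
  fixes f :: "real \<Rightarrow> 'a::euclidean_space \<Rightarrow> 'a"
  assumes "\<tau> > 0" "K \<ge> 0" "K * \<tau> \<le> \<rho>"
    and bound: "\<And>t x. 0 \<le> t \<Longrightarrow> t \<le> \<tau> \<Longrightarrow> norm (x - x0) \<le> \<rho> \<Longrightarrow> norm (f t x) \<le> K"
    and drift: "\<And>t x. 0 \<le> t \<Longrightarrow> t \<le> \<tau> \<Longrightarrow> norm (x - x0) \<le> \<rho> \<Longrightarrow> \<eta> \<le> e \<bullet> f t x"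
    and cont: "\<And>t x. 0 < t \<Longrightarrow> t \<le> \<tau> \<Longrightarrow> norm (x - x0) \<le> \<rho> \<Longrightarrow> \<eta> * t \<le> e \<bullet> (x - x0) \<Longrightarrow>
        continuous (at (t, x) within {0..\<tau>} \<times> UNIV) (\<lambda>(t, x). f t x)"
  obtains x where "x 0 = x0"
    "\<And>t. 0 \<le> t \<Longrightarrow> t \<le> \<tau> \<Longrightarrow> (\<lambda>s. f s (x s)) absolutely_integrable_on {0..t}"
    "\<And>t. 0 \<le> t \<Longrightarrow> t \<le> \<tau> \<Longrightarrow> x t = x0 + integral {0..t} (\<lambda>s. f s (x s))"
    "\<And>t. 0 \<le> t \<Longrightarrow> t \<le> \<tau> \<Longrightarrow> norm (x t - x0) \<le> \<rho>"
    "\<And>t. 0 \<le> t \<Longrightarrow> t \<le> \<tau> \<Longrightarrow> \<eta> * t \<le> e \<bullet> (x t - x0)"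
proof -
  \<comment> \<open>Vertices \<open>a n\<close>, velocity \<open>g n\<close> and values \<open>X n\<close> of the Euler polygon with step \<open>h n\<close>; the
    time \<open>s\<close> lies in the step with number \<open>J n s\<close>.\<close>
  define h where "h = (\<lambda>n. 1 / real (Suc n))"
  define a where "a = (\<lambda>n. rec_nat x0 (\<lambda>j y. y + h n *\<^sub>R f (real j * h n) y))"
  have a0: "a n 0 = x0" and aS: "a n (Suc j) = a n j + h n *\<^sub>R f (real j * h n) (a n j)" for n j
    by (simp_all add: a_def)
  define J where "J = (\<lambda>n s. nat \<lfloor>s * real (Suc n)\<rfloor>)"
  define g where "g = (\<lambda>n s. f (real (J n s) * h n) (a n (J n s)))"
  let ?gr = "\<lambda>n s. real (J n s) * h n"
  define X where "X = (\<lambda>n t. x0 + integral {0..t} (g n))"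
  have h: "h n > 0" for n by (simp add: h_def)
  have J: "?gr n s \<le> s" "s < ?gr n s + h n" if "0 \<le> s" for n s
  proof -
    have "real (J n s) \<le> s * real (Suc n)" "s * real (Suc n) < real (J n s) + 1"
      using that by (auto simp: J_def)
    then show "?gr n s \<le> s" "s < ?gr n s + h n"
      by (simp_all add: h_def field_simps)
  qed
  have gm: "g n \<in> borel_measurable borel" for n
  proof -
    have "(\<lambda>s. \<lfloor>s * real (Suc n)\<rfloor>) \<in> measurable borel (count_space UNIV)"
      by measurable
    then show ?thesis
      unfolding g_def J_def
      by (rule measurable_compose[where g = "\<lambda>k. f (real (nat k) * h n) (a n (nat k))"]) simp
  qed
  have gint: "g n absolutely_integrable_on {c..d}" for n c d
  proof (rule bounded_borel_integrable_Icc[OF gm])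
    have "g n ` {c..d} \<subseteq> (\<lambda>j. f (real j * h n) (a n j)) ` {..J n d}"
    proof
      fix y assume "y \<in> g n ` {c..d}"
      then obtain s where "s \<le> d" "y = g n s" by auto
      moreover from this have "J n s \<le> J n d"
        unfolding J_def by (intro nat_mono floor_mono mult_right_mono) auto
      ultimately show "y \<in> (\<lambda>j. f (real j * h n) (a n j)) ` {..J n d}"
        by (auto simp: g_def)
    qed
    then show "bounded (g n ` {c..d})"
      by (meson finite_atMost finite_imageI finite_imp_bounded bounded_subset)
  qed
  have gint': "g n integrable_on {c..d}" for n c d
    using gint set_lebesgue_integral_eq_integral(1) by blast
  have Xdiff: "X n t - X n s = integral {s..t} (g n)" if "0 \<le> s" "s \<le> t" for n s t
    using Henstock_Kurzweil_Integration.integral_combine[of 0 s t "g n"] that gint'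
    by (simp add: X_def algebra_simps)
  have grid: "X n (real j * h n) = a n j" for n j
  proof (induction j)
    case 0
    then show ?case by (simp add: X_def a0)
  next
    case (Suc j)
    have le: "real j * h n \<le> real (Suc j) * h n"
      using h[of n] by (intro mult_right_mono) auto
    have Jc: "J n s = j" if "real j * h n \<le> s" "s < real (Suc j) * h n" for s
    proof -
      have "real j \<le> s * real (Suc n)" "s * real (Suc n) < real j + 1"
        using that by (simp_all add: h_def field_simps)
      then have "\<lfloor>s * real (Suc n)\<rfloor> = int j"
        by (simp add: floor_eq_iff)
      then show ?thesis by (simp add: J_def)
    qed
    have "X n (real (Suc j) * h n) - X n (real j * h n) = integral {real j * h n..real (Suc j) * h n} (g n)"
      using h[of n] le by (intro Xdiff) auto
    also have "\<dots> = integral {real j * h n..real (Suc j) * h n} (\<lambda>_. f (real j * h n) (a n j))"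
      by (rule integral_spike[of "{real (Suc j) * h n}"]) (auto simp: g_def Jc)
    also have "\<dots> = h n *\<^sub>R f (real j * h n) (a n j)"
      using le by (simp add: algebra_simps)
    finally show ?case
      using Suc by (simp add: aS algebra_simps)
  qed
  have abound: "norm (a n j - x0) \<le> K * (real j * h n) \<and> \<eta> * (real j * h n) \<le> e \<bullet> (a n j - x0)"
    if "real j * h n \<le> \<tau> + h n" for n j
    using that
  proof (induction j)
    case 0
    then show ?case by (simp add: a0)
  next
    case (Suc j)
    have j: "0 \<le> real j * h n" "real j * h n \<le> \<tau>"
      using Suc.prems h[of n] by (auto simp: algebra_simps)
    then have IH: "norm (a n j - x0) \<le> K * (real j * h n)" "\<eta> * (real j * h n) \<le> e \<bullet> (a n j - x0)"
      using Suc.IH h[of n] by auto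
    have "K * (real j * h n) \<le> \<rho>"
      using j assms(2,3) by (meson mult_left_mono order_trans)
    then have r: "norm (a n j - x0) \<le> \<rho>"
      using IH(1) by simp
    have "norm (a n (Suc j) - x0) \<le> norm (a n j - x0) + norm (h n *\<^sub>R f (real j * h n) (a n j))"
      unfolding aS by (metis add_diff_eq add.commute norm_triangle_ineq)
    also have "\<dots> \<le> K * (real j * h n) + h n * K"
      using IH(1) bound[OF j r] h[of n] by (intro add_mono) (auto intro: mult_left_mono)
    finally have 1: "norm (a n (Suc j) - x0) \<le> K * (real (Suc j) * h n)"
      by (simp add: algebra_simps)
    have "h n * \<eta> \<le> h n * (e \<bullet> f (real j * h n) (a n j))"
      using drift[OF j r] h[of n] by (intro mult_left_mono) auto
    then have "\<eta> * (real (Suc j) * h n) \<le> e \<bullet> (a n (Suc j) - x0)"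
      using IH(2) by (simp add: aS algebra_simps inner_diff_right inner_add_right)
    with 1 show ?case by simp
  qed
  have Jt: "0 \<le> ?gr n s" "?gr n s \<le> \<tau>" "norm (a n (J n s) - x0) \<le> \<rho>"
    if "0 \<le> s" "s \<le> \<tau>" for n s
  proof -
    show 1: "0 \<le> ?gr n s" "?gr n s \<le> \<tau>"
      using J[of s n] h[of n] that by auto
    then have "norm (a n (J n s) - x0) \<le> K * (?gr n s)"
      using abound[of "J n s" n] h[of n] by auto
    also have "\<dots> \<le> \<rho>"
      using 1 assms(2,3) by (meson mult_left_mono order_trans)
    finally show "norm (a n (J n s) - x0) \<le> \<rho>" .
  qed
  have gK: "norm (g n s) \<le> K" and gdrift: "\<eta> \<le> e \<bullet> g n s" if "0 \<le> s" "s \<le> \<tau>" for n s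
    using bound[OF Jt[OF that, of n]] drift[OF Jt[OF that, of n]] by (auto simp: g_def)
  have XK: "norm (X n t - X n s) \<le> K * \<bar>t - s\<bar>" if "s \<in> {0..\<tau>}" "t \<in> {0..\<tau>}" for n s t
  proof -
    have *: "norm (X n t - X n s) \<le> K * (t - s)" if "0 \<le> s" "s \<le> t" "t \<le> \<tau>" for s t
    proof -
      have "norm (integral (cbox s t) (g n)) \<le> K * measure lborel (cbox s t)"
        by (rule integrable_bound) (use assms(2) gK gint' that in auto)
      then show ?thesis
        using Xdiff[of s t n] that by simp
    qed
    show ?thesis
      using *[of s t] *[of t s] that by (cases "s \<le> t") (auto simp: norm_minus_commute)
  qed
  have X0: "X n 0 = x0" for n by (simp add: X_def)
  obtain x k where x: "continuous_on {0..\<tau>} x" and k: "strict_mono (k :: nat \<Rightarrow> nat)"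
    and lim: "\<And>\<epsilon>. 0 < \<epsilon> \<Longrightarrow> \<exists>N. \<forall>n t. n \<ge> N \<and> t \<in> {0..\<tau>} \<longrightarrow> norm (X (k n) t - x t) < \<epsilon>"
  proof (rule Arzela_Ascoli[of "{0..\<tau>}" X "norm x0 + K * \<tau>"])
    show "norm (X n t) \<le> norm x0 + K * \<tau>" if "t \<in> {0..\<tau>}" for n t
    proof -
      have "norm (X n t - x0) \<le> K * t"
        using XK[of 0 t n] that \<open>\<tau> > 0\<close> by (auto simp: X0)
      also have "\<dots> \<le> K * \<tau>"
        using that assms(2) by (intro mult_left_mono) auto
      finally show ?thesis
        using norm_triangle_sub[of "X n t" x0] by linarith
    qed
    show "\<exists>d>0. \<forall>n s. s \<in> {0..\<tau>} \<and> norm (t - s) < d \<longrightarrow> norm (X n t - X n s) < \<epsilon>"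
      if "t \<in> {0..\<tau>}" "0 < \<epsilon>" for t \<epsilon>
    proof (intro exI[of _ "\<epsilon> / (K + 1)"] conjI allI impI)
      show "0 < \<epsilon> / (K + 1)" using that assms(2) by auto
      fix n s assume s: "s \<in> {0..\<tau>} \<and> norm (t - s) < \<epsilon> / (K + 1)"
      have "norm (X n t - X n s) \<le> K * \<bar>t - s\<bar>"
        using XK s that by blast
      also have "\<dots> \<le> (K + 1) * \<bar>t - s\<bar>"
        by (intro mult_right_mono) auto
      also have "\<dots> < \<epsilon>"
        using s assms(2) by (simp add: field_simps)
      finally show "norm (X n t - X n s) < \<epsilon>" .
    qed
  qed auto
  have Xlim: "(\<lambda>n. X (k n) t) \<longlonglongrightarrow> x t" if "t \<in> {0..\<tau>}" for t
    using lim that by (fastforce simp: LIMSEQ_iff)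
  have xrho: "norm (x t - x0) \<le> \<rho>" and xdrift: "\<eta> * t \<le> e \<bullet> (x t - x0)" if t: "0 \<le> t" "t \<le> \<tau>" for t
  proof -
    have l: "(\<lambda>n. X (k n) t - x0) \<longlonglongrightarrow> x t - x0"
      using t by (intro tendsto_intros Xlim) auto
    have "norm (X n t - x0) \<le> \<rho>" for n
    proof -
      have "norm (X n t - x0) \<le> K * t"
        using XK[of 0 t n] t \<open>\<tau> > 0\<close> by (auto simp: X0)
      also have "\<dots> \<le> \<rho>"
        using t assms(2,3) by (meson mult_left_mono order_trans)
      finally show ?thesis .
    qed
    then show "norm (x t - x0) \<le> \<rho>"
      by (intro Lim_bounded[OF tendsto_norm[OF l]]) auto
    have "\<eta> * t \<le> e \<bullet> (X n t - x0)" for n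
    proof -
      have "integral {0..t} (\<lambda>_. \<eta>) \<le> integral {0..t} (\<lambda>s. e \<bullet> g n s)"
        using t gdrift
        by (intro integral_le integrable_linear[OF gint' bounded_linear_inner_right, unfolded o_def]) auto
      also have "\<dots> = e \<bullet> integral {0..t} (g n)"
        using integral_linear[OF gint'[of n 0 t] bounded_linear_inner_right[of e]] by (simp add: o_def)
      finally show ?thesis
        using t by (simp add: X_def mult.commute)
    qed
    then show "\<eta> * t \<le> e \<bullet> (x t - x0)"
      by (intro Lim_bounded2[OF tendsto_inner[OF tendsto_const l]]) auto
  qed
  have glim: "(\<lambda>n. g (k n) s) \<longlonglongrightarrow> f s (x s)" if s: "0 \<le> s" "s \<le> \<tau>" for s
    \<comment> \<open>At time \<open>0\<close>, where the field may be discontinuous, all polygons have the same velocity.\<close>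
  proof (cases "s = 0")
    case True
    then have "g n s = f s (x s)" for n
      using LIMSEQ_unique[OF Xlim[of 0], of x0] \<open>\<tau> > 0\<close> by (simp add: g_def J_def a0 X0)
    then show ?thesis by simp
  next
    case False
    have h0: "(\<lambda>n. h (k n)) \<longlonglongrightarrow> 0"
      using LIMSEQ_subseq_LIMSEQ[OF LIMSEQ_Suc[OF lim_1_over_n] k] by (simp add: h_def o_def)
    have t: "(\<lambda>n. ?gr (k n) s) \<longlonglongrightarrow> s"
    proof (rule tendsto_sandwich[OF _ _ _ tendsto_const])
      show "(\<lambda>n. s - h (k n)) \<longlonglongrightarrow> s"
        using tendsto_diff[OF tendsto_const[of s] h0] by simp
      show "\<forall>\<^sub>F n in sequentially. s - h (k n) \<le> ?gr (k n) s"
        using J(2)[OF s(1)] by (intro always_eventually) (auto simp: algebra_simps intro: less_imp_le)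
      show "\<forall>\<^sub>F n in sequentially. ?gr (k n) s \<le> s"
        using J(1)[OF s(1)] by (intro always_eventually) auto
    qed
    have d0: "(\<lambda>n. a (k n) (J (k n) s) - X (k n) s) \<longlonglongrightarrow> 0"
    proof (rule Lim_null_comparison)
      show "(\<lambda>n. K * h (k n)) \<longlonglongrightarrow> 0"
        using tendsto_mult[OF tendsto_const[of K] h0] by simp
      show "\<forall>\<^sub>F n in sequentially. norm (a (k n) (J (k n) s) - X (k n) s) \<le> K * h (k n)"
      proof (intro always_eventually allI)
        fix n
        have "norm (X (k n) (?gr (k n) s) - X (k n) s) \<le> K * \<bar>?gr (k n) s - s\<bar>"
          using XK[of s "?gr (k n) s" "k n"] Jt[OF s, of "k n"] s by auto
        also have "\<dots> \<le> K * h (k n)"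
          using J[OF s(1), of "k n"] assms(2) by (intro mult_left_mono) auto
        finally show "norm (a (k n) (J (k n) s) - X (k n) s) \<le> K * h (k n)"
          by (simp add: grid)
      qed
    qed
    have "(\<lambda>n. a (k n) (J (k n) s) - X (k n) s + X (k n) s) \<longlonglongrightarrow> 0 + x s"
      using s by (intro tendsto_add d0 Xlim) auto
    then have "(\<lambda>n. (?gr (k n) s, a (k n) (J (k n) s))) \<longlonglongrightarrow> (s, x s)"
      using t by (intro tendsto_Pair) auto
    moreover have "continuous (at (s, x s) within {0..\<tau>} \<times> UNIV) (\<lambda>(t, x). f t x)"
      using False s xrho xdrift by (intro cont) auto
    ultimately have "((\<lambda>(t, x). f t x) \<circ> (\<lambda>n. (?gr (k n) s, a (k n) (J (k n) s))))
        \<longlonglongrightarrow> (\<lambda>(t, x). f t x) (s, x s)"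
      using Jt[OF s] by (subst (asm) continuous_within_sequentially) (auto simp: J_def)
    then show ?thesis
      by (simp add: o_def g_def)
  qed
  have fint: "(\<lambda>s. f s (x s)) integrable_on {0..t}"
    and flim: "(\<lambda>n. integral {0..t} (g (k n))) \<longlonglongrightarrow> integral {0..t} (\<lambda>s. f s (x s))"
    if t: "0 \<le> t" "t \<le> \<tau>" for t
    by (rule dominated_convergence[where h = "\<lambda>_. K" and f = "\<lambda>n. g (k n)"]; use t gint' gK glim in auto)+
  show ?thesis
  proof
    show "x 0 = x0"
      using LIMSEQ_unique[OF Xlim[of 0], of x0] \<open>\<tau> > 0\<close> by (simp add: X0)
    show "(\<lambda>s. f s (x s)) absolutely_integrable_on {0..t}" if "0 \<le> t" "t \<le> \<tau>" for t
      by (rule absolutely_integrable_integrable_bound[where g = "\<lambda>_. K"])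
        (use that bound xrho fint in auto)
    show "x t = x0 + integral {0..t} (\<lambda>s. f s (x s))" if "0 \<le> t" "t \<le> \<tau>" for t
    proof (rule LIMSEQ_unique[OF Xlim])
      show "(\<lambda>n. X (k n) t) \<longlonglongrightarrow> x0 + integral {0..t} (\<lambda>s. f s (x s))"
        unfolding X_def by (intro tendsto_add tendsto_const flim that)
    qed (use that in auto)
  qed (use xrho xdrift in auto)
qed

text \<open>
  A decay estimate at the initial time of all solutions yields the pointwise estimate, because a
  solution starts at every point.
\<close>
lemma derivative_along_continuous_field:
  fixes F :: "'a::euclidean_space \<Rightarrow> 'a" and V :: "'a \<Rightarrow> real"
  assumes F: "continuous_on UNIV F" and V: "(V has_derivative (\<lambda>h. g \<bullet> h)) (at z)"
    and decay: "\<And>b x. filippov_solution (\<lambda>t. F) b x \<Longrightarrow> x 0 = z \<Longrightarrow>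
        \<exists>D. ((\<lambda>s. V (x s)) has_real_derivative D) (at 0 within {s. 0 \<le> s \<and> ereal s < b}) \<and> D \<le> B"
  shows "g \<bullet> F z \<le> B"
proof -
  obtain K where K: "0 \<le> K" "\<And>y. y \<in> cball z 1 \<Longrightarrow> norm (F y) \<le> K"
    using compact_continuous_norm_bound[OF compact_cball continuous_on_subset[OF F]] by blast
  define \<tau> where "\<tau> = 1 / (K + 1)"
  have \<tau>: "\<tau> > 0" "K * \<tau> \<le> 1" using K(1) by (auto simp: \<tau>_def field_simps)
  obtain x where x: "x 0 = z"
    "\<And>t. 0 \<le> t \<Longrightarrow> t \<le> \<tau> \<Longrightarrow> (\<lambda>s. F (x s)) absolutely_integrable_on {0..t}"
    "\<And>t. 0 \<le> t \<Longrightarrow> t \<le> \<tau> \<Longrightarrow> x t = z + integral {0..t} (\<lambda>s. F (x s))"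
  proof (rule local_solution_of_directed_field[OF \<tau>(1) K(1) \<tau>(2), of z "\<lambda>_. F" 0 0])
    show "norm (F x) \<le> K" if "norm (x - z) \<le> 1" for x
      using K(2)[of x] that by (simp add: dist_norm norm_minus_commute)
    show "continuous (at (t, x) within {0..\<tau>} \<times> UNIV) (\<lambda>(t, x). F x)" for t x
    proof -
      have "continuous_on UNIV (\<lambda>p :: real \<times> 'a. F (snd p))"
        by (intro continuous_on_compose2[OF F] continuous_intros) auto
      then have "continuous (at (t, x)) (\<lambda>p :: real \<times> 'a. F (snd p))"
        by (simp add: continuous_on_eq_continuous_at)
      then show ?thesis
        unfolding case_prod_beta by (rule continuous_at_imp_continuous_at_within)
    qed
  qed (use that in auto)
  have ci: "isCont F y" for y
    using F by (simp add: continuous_on_eq_continuous_at)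
  have sol: "filippov_solution (\<lambda>t. F) (ereal \<tau>) x"
    unfolding filippov_solution_def
  proof (intro conjI exI[of _ "\<lambda>s. F (x s)"])
    show "0 < ereal \<tau>" using \<tau> by simp
  qed (use x in \<open>auto simp: filippov_isCont[OF ci]\<close>)
  then obtain D where D: "((\<lambda>s. V (x s)) has_real_derivative D) (at 0 within {0..<\<tau>})" "D \<le> B"
    using decay[OF sol x(1)] by (auto simp: atLeastLessThan_def atLeast_def lessThan_def Collect_conj_eq)
  have xc: "continuous_on {0..\<tau>} x"
  proof -
    have "(\<lambda>s. F (x s)) integrable_on {0..\<tau>}"
      using x(2)[of \<tau>] \<tau> set_lebesgue_integral_eq_integral(1) by auto
    then have "continuous_on {0..\<tau>} (\<lambda>t. z + integral {0..t} (\<lambda>s. F (x s)))"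
      by (intro continuous_intros indefinite_integral_continuous_1)
    then show ?thesis
      by (rule continuous_on_eq) (simp add: x(3)[symmetric])
  qed
  have "continuous_on {0..\<tau>} (\<lambda>s. F (x s))"
    by (rule continuous_on_compose2[OF F xc]) auto
  then have "((\<lambda>t. integral {0..t} (\<lambda>s. F (x s))) has_vector_derivative F z) (at 0 within {0..\<tau>})"
    using integral_has_vector_derivative[of 0 \<tau> "\<lambda>s. F (x s)" 0] \<tau> x(1) by simp
  then have "((\<lambda>t. z + integral {0..t} (\<lambda>s. F (x s))) has_vector_derivative F z) (at 0 within {0..\<tau>})"
    by (auto intro!: derivative_eq_intros)
  then have "(x has_vector_derivative F z) (at 0 within {0..\<tau>})"
    by (rule has_vector_derivative_transform[rotated 2]) (use x(3) \<tau> in \<open>auto simp: x(3)[symmetric]\<close>)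
  then have xd: "(x has_vector_derivative F z) (at 0 within {0..<\<tau>})"
    by (rule has_vector_derivative_within_subset) auto
  have "((\<lambda>s. V (x s)) has_derivative (\<lambda>h. g \<bullet> (h *\<^sub>R F z))) (at 0 within {0..<\<tau>})"
    using has_derivative_compose[OF xd[unfolded has_vector_derivative_def], of V "\<lambda>h. g \<bullet> h"] V x(1) by simp
  then have "((\<lambda>s. V (x s)) has_vector_derivative (g \<bullet> F z)) (at 0 within {0..<\<tau>})"
    by (simp add: has_vector_derivative_def)
  moreover have "((\<lambda>s. V (x s)) has_vector_derivative D) (at 0 within {0..<\<tau>})"
    using D(1) by (simp add: has_real_derivative_iff_has_vector_derivative)
  moreover have "at 0 within {0..<\<tau>} \<noteq> bot"
  proof -
    have "{0..<\<tau>} - {0} = {0<..<\<tau>}" by auto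
    then show ?thesis
      using \<tau> by (simp add: at_within_eq_bot_iff)
  qed
  ultimately have "g \<bullet> F z = D"
    by (metis vector_derivative_unique_within)
  then show ?thesis using D(2) by simp
qed

section \<open>Dilations and homogeneous functions\<close>

lemma dilation_nth [simp]: "dilation w \<epsilon> z $ i = \<epsilon> powr w i * z $ i"
  by (simp add: dilation_def)

lemma dilation_eq_0_iff: "\<epsilon> > 0 \<Longrightarrow> dilation w \<epsilon> z = 0 \<longleftrightarrow> z = 0"
  by (auto simp: vec_eq_iff)

lemma bounded_linear_dilation: "bounded_linear (dilation w \<epsilon>)"
  unfolding linear_conv_bounded_linear[symmetric]
  by (rule linearI) (auto simp: vec_eq_iff algebra_simps)

text \<open>
  The norm along a dilation orbit runs from \<open>0\<close> at \<open>\<epsilon> = 0\<close>, where \<open>powr\<close> vanishes, to at least \<open>1\<close>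
  once a single coordinate has modulus \<open>1\<close>.
\<close>
lemma dilation_unit_norm:
  fixes z :: "real^'n::finite"
  assumes w: "\<And>i. w i > 0" and "z \<noteq> 0"
  obtains \<epsilon> where "\<epsilon> > 0" "norm (dilation w \<epsilon> z) = 1"
proof -
  obtain i where i: "z $ i \<noteq> 0"
    using \<open>z \<noteq> 0\<close> by (auto simp: vec_eq_iff)
  define b where "b = (1 / \<bar>z $ i\<bar>) powr (1 / w i)"
  have cont: "continuous_on {0..b} (\<lambda>\<epsilon>. norm (dilation w \<epsilon> z))"
    unfolding dilation_def
    using w by (intro continuous_intros continuous_on_vec_lambda continuous_on_powr') auto
  have "\<bar>dilation w b z $ i\<bar> = 1"
    using i w[of i] by (simp add: b_def powr_powr abs_mult)
  then have "1 \<le> norm (dilation w b z)"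
    using Finite_Cartesian_Product.norm_nth_le[of "dilation w b z" i] by simp
  moreover have "dilation w 0 z = 0"
    by (simp add: vec_eq_iff)
  moreover have "0 \<le> b" by (simp add: b_def)
  ultimately obtain \<epsilon> where "0 \<le> \<epsilon>" "norm (dilation w \<epsilon> z) = 1"
    using IVT'[OF _ _ _ cont, of 1] by auto
  moreover from this have "\<epsilon> \<noteq> 0"
    using \<open>dilation w 0 z = 0\<close> by auto
  ultimately show ?thesis
    using that[of \<epsilon>] by simp
qed

text \<open>
  The quotient of \<open>g\<close> by \<open>V powr (q / k)\<close> is invariant under dilations, so its supremum is its
  maximum over the unit sphere. That the maximum is attained at a point \<open>z0\<close> matters when \<open>g\<close> is
  negative: then the constant is negative as well.
\<close>
lemma homogeneous_le_powr:
  fixes g V :: "real^'n::finite \<Rightarrow> real"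
  assumes w: "\<And>i. w i > 0"
    and g: "continuous_on (- {0}) g" "homogeneous_on (- {0}) w q g"
    and V: "continuous_on (- {0}) V" "homogeneous_on (- {0}) w k V" "\<And>z. z \<noteq> 0 \<Longrightarrow> V z > 0"
    and "k \<noteq> 0"
  obtains z0 where "z0 \<noteq> 0" "\<And>z. z \<noteq> 0 \<Longrightarrow> g z \<le> g z0 / V z0 powr (q / k) * V z powr (q / k)"
proof -
  define h where "h = (\<lambda>z. g z / V z powr (q / k))"
  have "V z \<noteq> 0" if "norm z = 1" for z
    using V(3)[of z] that by force
  then have "continuous_on (sphere 0 1) h"
    unfolding h_def
    by (intro continuous_intros continuous_on_powr continuous_on_subset[OF g(1)] continuous_on_subset[OF V(1)])
      auto
  moreover have "sphere (0 :: real^'n) 1 \<noteq> {}"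
    by simp
  ultimately obtain z0 where z0: "z0 \<in> sphere 0 1" "\<And>y. y \<in> sphere 0 1 \<Longrightarrow> h y \<le> h z0"
    using continuous_attains_sup[OF compact_sphere, of 0 1 h] by blast
  show ?thesis
  proof
    show "z0 \<noteq> 0" using z0 by auto
    fix z :: "real^'n" assume z: "z \<noteq> 0"
    obtain \<epsilon> where e: "\<epsilon> > 0" "norm (dilation w \<epsilon> z) = 1"
      using dilation_unit_norm[of w z] w z by blast
    have "V (dilation w \<epsilon> z) powr (q / k) = \<epsilon> powr q * V z powr (q / k)"
      using V(2,3) e z \<open>k \<noteq> 0\<close> by (simp add: homogeneous_on_def powr_mult powr_powr less_imp_le)
    then have "h (dilation w \<epsilon> z) = h z"
      using g(2) e z by (simp add: homogeneous_on_def h_def)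
    moreover have "h (dilation w \<epsilon> z) \<le> h z0"
      using e by (intro z0(2)) simp
    ultimately have "h z \<le> h z0" by simp
    moreover have "V z powr (q / k) > 0" using V(3)[OF z] by simp
    ultimately show "g z \<le> g z0 / V z0 powr (q / k) * V z powr (q / k)"
      by (simp add: h_def divide_le_eq)
  qed
qed

lemma homogeneous_abs_le_powr:
  fixes g V :: "real^'n::finite \<Rightarrow> real"
  assumes w: "\<And>i. w i > 0"
    and g: "continuous_on (- {0}) g" "homogeneous_on (- {0}) w q g"
    and V: "continuous_on (- {0}) V" "homogeneous_on (- {0}) w k V" "\<And>z. z \<noteq> 0 \<Longrightarrow> V z > 0"
    and "k \<noteq> 0"
  obtains C where "C \<ge> 0" "\<And>z. z \<noteq> 0 \<Longrightarrow> \<bar>g z\<bar> \<le> C * V z powr (q / k)"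
proof -
  have "continuous_on (- {0}) (\<lambda>z. \<bar>g z\<bar>)" "homogeneous_on (- {0}) w q (\<lambda>z. \<bar>g z\<bar>)"
    using g by (auto intro: continuous_intros simp: homogeneous_on_def abs_mult)
  then obtain z0 where "z0 \<noteq> 0" "\<And>z. z \<noteq> 0 \<Longrightarrow> \<bar>g z\<bar> \<le> \<bar>g z0\<bar> / V z0 powr (q / k) * V z powr (q / k)"
    using homogeneous_le_powr[OF w _ _ V \<open>k \<noteq> 0\<close>] by blast
  then show ?thesis
    by (intro that[of "\<bar>g z0\<bar> / V z0 powr (q / k)"]) auto
qed

lemma gradient_homogeneous:
  assumes hom: "homogeneous_on UNIV w k V" and "\<epsilon> > 0"
    and der: "(V has_derivative (\<lambda>h. g \<bullet> h)) (at z)"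
      "(V has_derivative (\<lambda>h. g' \<bullet> h)) (at (dilation w \<epsilon> z))"
  shows "g' \<bullet> dilation w \<epsilon> h = \<epsilon> powr k * (g \<bullet> h)"
proof -
  have "((\<lambda>z. V (dilation w \<epsilon> z)) has_derivative (\<lambda>h. g' \<bullet> dilation w \<epsilon> h)) (at z)"
    by (rule has_derivative_compose[OF bounded_linear_imp_has_derivative[OF bounded_linear_dilation] der(2)])
  moreover have "(\<lambda>z. V (dilation w \<epsilon> z)) = (\<lambda>z. \<epsilon> powr k * V z)"
    using hom \<open>\<epsilon> > 0\<close> by (auto simp: homogeneous_on_def)
  moreover have "((\<lambda>z. \<epsilon> powr k * V z) has_derivative (\<lambda>h. \<epsilon> powr k * (g \<bullet> h))) (at z)"
    by (intro has_derivative_mult_right der)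
  ultimately have "(\<lambda>h. g' \<bullet> dilation w \<epsilon> h) = (\<lambda>h. \<epsilon> powr k * (g \<bullet> h))"
    by (metis has_derivative_unique)
  then show ?thesis by metis
qed

text \<open>
  Each coordinate is homogeneous of its own weight, so it is bounded by a positive power of \<open>V\<close>.
  Hence the norm is bounded by a continuous increasing function of \<open>V\<close> that vanishes at \<open>0\<close>.
\<close>
lemma sublevel_sets_of_homogeneous:
  fixes V :: "real^'n::finite \<Rightarrow> real"
  assumes w: "\<And>i. w i > 0" and "k > 0"
    and V: "continuous_on (- {0}) V" "homogeneous_on (- {0}) w k V" "\<And>z. z \<noteq> 0 \<Longrightarrow> V z > 0" "V 0 = 0"
  shows "\<exists>B. \<forall>z. V z \<le> R \<longrightarrow> norm z \<le> B"
    and "r > 0 \<Longrightarrow> \<exists>\<eta>>0. \<forall>z. V z < \<eta> \<longrightarrow> norm z < r"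
proof -
  have "\<exists>C\<ge>0. \<forall>z. z \<noteq> 0 \<longrightarrow> \<bar>z $ i\<bar> \<le> C * V z powr (w i / k)" for i
  proof -
    have "continuous_on (- {0}) (\<lambda>z :: real^'n. z $ i)" "homogeneous_on (- {0}) w (w i) (\<lambda>z. z $ i)"
      by (auto intro: continuous_intros simp: homogeneous_on_def)
    from homogeneous_abs_le_powr[OF w this V(1-3)] \<open>k > 0\<close> show ?thesis by (metis less_irrefl)
  qed
  then obtain C where C: "\<And>i. C i \<ge> 0" "\<And>i z. z \<noteq> 0 \<Longrightarrow> \<bar>z $ i\<bar> \<le> C i * V z powr (w i / k)"
    by metis
  have C_norm: "norm z \<le> (\<Sum>i\<in>UNIV. C i * V z powr (w i / k))" for z
  proof (cases "z = 0")
    case False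
    have "norm z \<le> (\<Sum>i\<in>UNIV. \<bar>z $ i\<bar>)" by (rule norm_le_l1_cart)
    also have "\<dots> \<le> (\<Sum>i\<in>UNIV. C i * V z powr (w i / k))"
      by (intro sum_mono C False)
    finally show ?thesis .
  qed (simp add: V(4))
  define \<Psi> where "\<Psi> = (\<lambda>v. \<Sum>i\<in>UNIV. C i * v powr (w i / k))"
  have nn: "V z \<ge> 0" for z using V(3)[of z] V(4) by (cases "z = 0") auto
  have mono: "\<Psi> u \<le> \<Psi> v" if "0 \<le> u" "u \<le> v" for u v
    unfolding \<Psi>_def using that C(1) w \<open>k > 0\<close>
    by (intro sum_mono mult_left_mono powr_mono2) (auto intro: less_imp_le)
  have bound: "norm z \<le> \<Psi> (V z)" for z using C_norm by (simp add: \<Psi>_def)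
  show "\<exists>B. \<forall>z. V z \<le> R \<longrightarrow> norm z \<le> B"
    using bound mono nn by (meson order_trans)
  have "continuous_on {0..} \<Psi>"
    unfolding \<Psi>_def using w \<open>k > 0\<close>
    by (intro continuous_intros continuous_on_powr') auto
  then have "continuous (at 0 within {0..}) \<Psi>"
    by (simp add: continuous_on_eq_continuous_within)
  moreover have "\<Psi> 0 = 0" by (simp add: \<Psi>_def)
  ultimately show "\<exists>\<eta>>0. \<forall>z. V z < \<eta> \<longrightarrow> norm z < r" if "r > 0"
  proof -
    obtain \<eta> where \<eta>: "\<eta> > 0" "\<And>v. v \<in> {0..} \<Longrightarrow> dist v 0 < \<eta> \<Longrightarrow> dist (\<Psi> v) (\<Psi> 0) < r"
      using \<open>continuous (at 0 within {0..}) \<Psi>\<close> \<open>r > 0\<close> unfolding continuous_within_eps_delta by blast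
    have "norm z < r" if "V z < \<eta>" for z
      using \<eta>(2)[of "V z"] that nn[of z] bound[of z] \<open>\<Psi> 0 = 0\<close> by (simp add: dist_real_def)
    then show ?thesis using \<eta>(1) by blast
  qed
qed

section \<open>The chain of integrators\<close>

lemma le_last_idx [simp]: "j \<le> last_idx"
  unfolding last_idx_def by (rule Max_ge) auto

lemma card_less_last_idx: "card {j :: 'n::{finite,linorder}. j < last_idx} = CARD('n) - 1"
proof -
  have "{j :: 'n. j < last_idx} = UNIV - {last_idx}"
    using le_last_idx by (auto simp: less_le)
  then show ?thesis by (simp add: card_Diff_singleton)
qed

lemma card_less_le: "card {j. j < (i :: 'n::{finite,linorder})} \<le> CARD('n) - 1"
  unfolding card_less_last_idx[symmetric]
  by (rule card_mono) (auto intro: less_le_trans)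

lemma card_ge_last_idx: "card {j. (last_idx :: 'n::{finite,linorder}) \<le> j} = 1"
proof -
  have "{j. (last_idx :: 'n) \<le> j} = {last_idx}"
    using le_last_idx by (auto intro: antisym)
  then show ?thesis by simp
qed

lemma card_ge_Min_greater:
  assumes "(i :: 'n::{finite,linorder}) \<noteq> last_idx"
  shows "card {j. i \<le> j} = Suc (card {j. Min {j. i < j} \<le> j})"
proof -
  have "last_idx \<in> {j. i < j}"
    using assms le_last_idx[of i] by (simp add: less_le)
  then have ne: "{j. i < j} \<noteq> {}" by blast
  have "i < Min {j. i < j}"
    using ne by (subst Min_gr_iff) auto
  moreover have "Min {j. i < j} \<le> j" if "i < j" for j
    using that by (intro Min_le) auto
  ultimately have "{j. i \<le> j} = insert i {j. Min {j. i < j} \<le> j}"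
    by (auto simp: le_less intro: less_le_trans)
  moreover have "i \<notin> {j. Min {j. i < j} \<le> j}"
    using \<open>i < Min {j. i < j}\<close> by auto
  ultimately show ?thesis by simp
qed

lemma bounded_linear_scaling: "bounded_linear (scaling lam)"
  unfolding linear_conv_bounded_linear[symmetric] scaling_def
  by (rule linearI) (auto simp: vec_eq_iff algebra_simps)

lemma bounded_linear_jordan_shift: "bounded_linear jordan_shift"
  unfolding linear_conv_bounded_linear[symmetric] jordan_shift_def
  by (rule linearI) (auto simp: vec_eq_iff)

lemma scaling_nth_last [simp]: "scaling lam z $ last_idx = lam * z $ last_idx"
  by (simp add: scaling_def card_ge_last_idx)

text \<open>
  The scaling turns the chain into itself, run \<open>lam\<close> times faster, with the same input. The exponents
  of \<open>lam\<close> drop by one from each index to its successor.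
\<close>
lemma scaling_integrator_chain:
  "scaling lam (integrator_chain z v) = lam *\<^sub>R integrator_chain (scaling lam z) v"
proof -
  have "scaling lam (integrator_chain z v) $ i = (lam *\<^sub>R integrator_chain (scaling lam z) v) $ i" for i
    by (cases "i = last_idx")
      (auto simp: scaling_def integrator_chain_def jordan_shift_def card_ge_last_idx card_ge_Min_greater axis_def)
  then show ?thesis by (simp add: vec_eq_iff)
qed

lemma integrator_chain_nth_last: "integrator_chain z v $ last_idx = v"
  by (simp add: integrator_chain_def jordan_shift_def)

lemma integrator_chain_0: "integrator_chain 0 0 = 0"
  by (simp add: integrator_chain_def jordan_shift_def vec_eq_iff)

lemma integrator_chain_add: "integrator_chain z (a + b) = integrator_chain z a + b *\<^sub>R axis last_idx 1"
  by (simp add: integrator_chain_def algebra_simps)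

lemma continuous_on_integrator_chain [continuous_intros]:
  assumes "continuous_on S f" "continuous_on S g"
  shows "continuous_on S (\<lambda>x. integrator_chain (f x) (g x))"
  unfolding integrator_chain_def
  by (intro continuous_intros assms bounded_linear.continuous_on[OF bounded_linear_jordan_shift])

lemma partial_last_eq_gradient:
  assumes "(V has_derivative (\<lambda>h. g \<bullet> h)) (at z)"
  shows "partial_last V z = g \<bullet> axis last_idx 1"
proof -
  have "((\<lambda>s. V (z + s *\<^sub>R axis last_idx 1)) has_derivative (\<lambda>h. g \<bullet> (h *\<^sub>R axis last_idx 1))) (at 0)"
  proof (rule has_derivative_compose[of "\<lambda>s. z + s *\<^sub>R axis last_idx 1"])
    show "((\<lambda>s. z + s *\<^sub>R axis last_idx 1) has_derivative (\<lambda>h. h *\<^sub>R axis last_idx 1)) (at 0)"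
      by (auto intro!: derivative_eq_intros)
    show "(V has_derivative (\<lambda>h. g \<bullet> h)) (at (z + 0 *\<^sub>R axis last_idx 1))"
      using assms by simp
  qed
  then have "((\<lambda>s. V (z + s *\<^sub>R axis last_idx 1)) has_real_derivative (g \<bullet> axis last_idx 1)) (at 0)"
    by (simp add: has_field_derivative_def mult.commute[of _ "g \<bullet> axis last_idx 1"])
  then show ?thesis
    unfolding partial_last_def by (rule DERIV_imp_deriv)
qed

text \<open>
  Along the last axis the dilation acts by the factor \<open>\<epsilon> powr k\<close>, the degree of \<open>V\<close>, so \<open>V\<close> is linear
  on each half of the axis.
\<close>
lemma homogeneous_along_eigenvector:
  assumes hom: "homogeneous_on UNIV w k V" and "k \<noteq> 0" "s > 0"
    and e: "\<And>\<epsilon>. \<epsilon> > 0 \<Longrightarrow> dilation w \<epsilon> e = \<epsilon> powr k *\<^sub>R e"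
  shows "V (s *\<^sub>R e) = s * V e"
proof -
  have "V (dilation w (s powr (1 / k)) e) = (s powr (1 / k)) powr k * V e"
    using hom \<open>s > 0\<close> by (simp add: homogeneous_on_def)
  then show ?thesis
    using e[of "s powr (1 / k)"] \<open>s > 0\<close> \<open>k \<noteq> 0\<close> by (simp add: powr_powr)
qed

lemma dilation_axis: "dilation w \<epsilon> (axis i a) = \<epsilon> powr w i *\<^sub>R axis i a"
  by (auto simp: vec_eq_iff axis_def)

text \<open>
  The last partial derivative has opposite signs on the two halves of the axis when \<open>V\<close> is
  positive. This is why the Filippov set at the origin contains all small velocities of the integral
  state.
\<close>
lemma partial_last_axis:
  assumes hom: "homogeneous_on UNIV w k V" and "k \<noteq> 0" "w last_idx = k" "s > 0"
  shows "partial_last V (s *\<^sub>R axis last_idx 1) = V (axis last_idx 1)"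
    and "partial_last V (- s *\<^sub>R axis last_idx 1) = - V (axis last_idx (- 1))"
proof -
  let ?e = "axis last_idx 1 :: real^'a::{finite,linorder}"
  let ?e' = "axis last_idx (- 1) :: real^'a::{finite,linorder}"
  have V: "V (r *\<^sub>R ?e) = r * V ?e" "V (r *\<^sub>R ?e') = r * V ?e'" if "r > 0" for r
    by (rule homogeneous_along_eigenvector[OF hom \<open>k \<noteq> 0\<close> that]; simp add: dilation_axis assms(3))+
  have e': "?e' = - ?e" by (simp add: vec_eq_iff axis_def)
  have "((\<lambda>t. (s + t) * V ?e) has_real_derivative V ?e) (at 0)"
    by (auto intro!: derivative_eq_intros)
  then have "((\<lambda>t. V (s *\<^sub>R ?e + t *\<^sub>R ?e)) has_real_derivative V ?e) (at 0)"
    by (rule has_field_derivative_transform_within_open[of _ _ _ "{- s<..}"])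
      (use \<open>s > 0\<close> in \<open>auto simp: V(1) simp flip: scaleR_add_left\<close>)
  then show "partial_last V (s *\<^sub>R ?e) = V ?e"
    unfolding partial_last_def by (rule DERIV_imp_deriv)
  have "((\<lambda>t. (s - t) * V ?e') has_real_derivative - V ?e') (at 0)"
    by (auto intro!: derivative_eq_intros)
  then have "((\<lambda>t. V (- s *\<^sub>R ?e + t *\<^sub>R ?e)) has_real_derivative - V ?e') (at 0)"
  proof (rule has_field_derivative_transform_within_open[of _ _ _ "{..<s}"])
    fix t assume "t \<in> {..<s}"
    moreover have "- s *\<^sub>R ?e + t *\<^sub>R ?e = (s - t) *\<^sub>R ?e'"
      by (simp add: e' algebra_simps)
    ultimately show "(s - t) * V ?e' = V (- s *\<^sub>R ?e + t *\<^sub>R ?e)"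
      using V(2)[of "s - t"] by simp
  qed (use \<open>s > 0\<close> in auto)
  then show "partial_last V (- s *\<^sub>R ?e) = - V ?e'"
    unfolding partial_last_def by (rule DERIV_imp_deriv)
qed

section \<open>A strict Lyapunov function for the closed loop\<close>

text \<open>
  The derivative of \<open>W powr (3/2) - eps * \<xi> * y\<close> along the closed loop, in terms of scalars: \<open>v\<close> and
  \<open>r\<close> are the square roots of \<open>V\<close> and of \<open>W\<close>, \<open>g\<close> the derivative of \<open>V\<close> along the nominal system,
  \<open>q\<close> its last partial derivative, \<open>y\<close> the last coordinate, \<open>u\<close> the value of the nominal feedback, and
  \<open>h\<close> the derivative of the perturbation. The first part gives \<open>- 3/2 * lam * c * r * v\<close>, one third
  of which pays for the terms of order \<open>r * v\<close> that the cross term produces. The remainder and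
  \<open>- eps * lam * \<xi>\<^sup>2\<close> together dominate \<open>lam * k * r\<^sup>2\<close>, half of which pays for the perturbation.
\<close>
lemma super_twisting_dissipation:
  fixes v r \<xi> :: real
  assumes "kP \<ge> 1" "kI > 0" "Cu \<ge> 0" "Cy \<ge> 0" "Cd \<ge> 0" "M \<ge> 0"
    and "eps > 0" "lam > 0" "k \<le> c" "k \<le> 2 * kI * eps"
    and cross: "eps * (kP * sqrt (2 * kI) * Cu + kI * Cd * Cy) \<le> c / 2"
    and lam: "M * (3 / 2 * sqrt (2 * kI) / kI + eps * Cy) \<le> lam * k / 2"
    and "v \<ge> 0" "r \<ge> 0" and r: "r\<^sup>2 = v\<^sup>2 + \<xi>\<^sup>2 / (2 * kI)"
    and u: "\<bar>u\<bar> \<le> Cu * v" and y: "\<bar>y\<bar> \<le> Cy * v\<^sup>2" and q: "\<bar>q\<bar> \<le> Cd"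
    and g: "g \<le> - c * v" and qu: "q * u \<le> 0" and h: "\<bar>h\<bar> \<le> M"
  shows "3 / 2 * r * (lam * (g + (kP - 1) * (q * u) + \<xi> * q) + \<xi> / kI * (h - lam * kI * q))
      - eps * ((h - lam * kI * q) * y + \<xi> * (lam * (kP * u + \<xi>))) \<le> - (lam * k / 2) * r\<^sup>2"
proof -
  define a where "a = sqrt (2 * kI)"
  have a: "a > 0" "a\<^sup>2 = 2 * kI" using \<open>kI > 0\<close> by (auto simp: a_def)
  have "\<xi>\<^sup>2 \<le> (a * r)\<^sup>2"
    using r a \<open>kI > 0\<close> by (simp add: power_mult_distrib field_simps)
  then have \<xi>: "\<bar>\<xi>\<bar> \<le> a * r"
    using a \<open>r \<ge> 0\<close> by (simp add: abs_le_square_iff[symmetric])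
  have "v\<^sup>2 \<le> r\<^sup>2" using r \<open>kI > 0\<close> by simp
  then have vr: "v \<le> r" using \<open>r \<ge> 0\<close> by (rule power2_le_imp_le)
  have vv: "v\<^sup>2 \<le> r * v" using vr \<open>v \<ge> 0\<close> by (simp add: power2_eq_square mult_right_mono)
  have rv: "0 \<le> r * v" using \<open>v \<ge> 0\<close> \<open>r \<ge> 0\<close> by simp
  have 1: "3 / 2 * r * (lam * (g + (kP - 1) * (q * u) + \<xi> * q) + \<xi> / kI * (h - lam * kI * q))
      \<le> - (3 / 2) * (lam * c * (r * v)) + 3 / 2 * (a / kI) * M * r\<^sup>2"
  proof -
    have "\<xi> * h \<le> a * r * M"
      using abs_ge_self[of "\<xi> * h"] mult_mono[OF \<xi> h] a \<open>r \<ge> 0\<close> by (simp add: abs_mult)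
    then have 2: "\<xi> / kI * h \<le> a * r * M / kI"
      using \<open>kI > 0\<close> by (simp add: divide_right_mono)
    have "(kP - 1) * (q * u) \<le> 0"
      using \<open>kP \<ge> 1\<close> qu by (simp add: mult_nonneg_nonpos)
    then have "lam * (g + (kP - 1) * (q * u)) \<le> lam * (- c * v)"
      using g \<open>lam > 0\<close> by (intro mult_left_mono) auto
    then have "lam * (g + (kP - 1) * (q * u)) + \<xi> / kI * h \<le> - (lam * c * v) + a * r * M / kI"
      using 2 by simp
    then have "3 / 2 * r * (lam * (g + (kP - 1) * (q * u)) + \<xi> / kI * h)
        \<le> 3 / 2 * r * (- (lam * c * v) + a * r * M / kI)"
      using \<open>r \<ge> 0\<close> by (intro mult_left_mono) auto
    also have "3 / 2 * r * (lam * (g + (kP - 1) * (q * u)) + \<xi> / kI * h) =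
        3 / 2 * r * (lam * (g + (kP - 1) * (q * u) + \<xi> * q) + \<xi> / kI * (h - lam * kI * q))"
      using \<open>kI > 0\<close> by (simp add: field_simps)
    finally show ?thesis
      by (simp add: algebra_simps power2_eq_square)
  qed
  have 2: "- ((h - lam * kI * q) * y) \<le> M * Cy * r\<^sup>2 + lam * kI * Cd * Cy * (r * v)"
  proof -
    have "\<bar>h - lam * kI * q\<bar> \<le> \<bar>h\<bar> + \<bar>lam * kI * q\<bar>" by simp
    also have "\<dots> \<le> M + lam * kI * Cd"
      using h q \<open>lam > 0\<close> \<open>kI > 0\<close> by (intro add_mono) (auto simp: abs_mult)
    finally have "\<bar>(h - lam * kI * q) * y\<bar> \<le> (M + lam * kI * Cd) * (Cy * v\<^sup>2)"
      unfolding abs_mult using y assms by (intro mult_mono) auto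
    also have "\<dots> = M * Cy * v\<^sup>2 + lam * kI * Cd * Cy * v\<^sup>2"
      by (simp add: algebra_simps)
    also have "\<dots> \<le> M * Cy * r\<^sup>2 + lam * kI * Cd * Cy * (r * v)"
      using vv \<open>v\<^sup>2 \<le> r\<^sup>2\<close> assms by (intro add_mono mult_left_mono) auto
    finally show ?thesis by linarith
  qed
  have 3: "- (\<xi> * (lam * (kP * u + \<xi>))) \<le> lam * (kP * a * Cu) * (r * v) - lam * \<xi>\<^sup>2"
  proof -
    have "\<bar>\<xi> * u\<bar> \<le> (a * r) * (Cu * v)"
      unfolding abs_mult using u \<xi> a \<open>r \<ge> 0\<close> by (intro mult_mono) auto
    then have "- (\<xi> * u) \<le> (a * r) * (Cu * v)" by linarith
    then have "lam * kP * - (\<xi> * u) \<le> lam * kP * ((a * r) * (Cu * v))"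
      using \<open>lam > 0\<close> \<open>kP \<ge> 1\<close> by (intro mult_left_mono) auto
    then show ?thesis
      by (simp add: algebra_simps power2_eq_square)
  qed
  have "eps * (- ((h - lam * kI * q) * y) - \<xi> * (lam * (kP * u + \<xi>)))
      \<le> eps * (M * Cy * r\<^sup>2 + lam * kI * Cd * Cy * (r * v) + (lam * (kP * a * Cu) * (r * v) - lam * \<xi>\<^sup>2))"
    using 2 3 \<open>eps > 0\<close> by (intro mult_left_mono) auto
  also have "\<dots> = eps * M * Cy * r\<^sup>2 + lam * (eps * (kP * a * Cu + kI * Cd * Cy)) * (r * v) - eps * lam * \<xi>\<^sup>2"
    by (simp add: algebra_simps)
  also have "\<dots> \<le> eps * M * Cy * r\<^sup>2 + lam * (c / 2) * (r * v) - eps * lam * \<xi>\<^sup>2"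
    using cross \<open>lam > 0\<close> rv unfolding a_def
    by (intro diff_right_mono add_left_mono mult_right_mono mult_left_mono) auto
  finally have 4: "- (eps * ((h - lam * kI * q) * y + \<xi> * (lam * (kP * u + \<xi>))))
      \<le> eps * M * Cy * r\<^sup>2 + 1 / 2 * (lam * c * (r * v)) - eps * lam * \<xi>\<^sup>2"
    by (simp add: algebra_simps)
  have 5: "M * (3 / 2 * a / kI + eps * Cy) * r\<^sup>2 \<le> lam * k / 2 * r\<^sup>2"
    using lam unfolding a_def by (intro mult_right_mono) auto
  have c0: "c \<ge> 0"
  proof -
    have "0 \<le> eps * (kP * sqrt (2 * kI) * Cu + kI * Cd * Cy)"
      using assms by (intro mult_nonneg_nonneg add_nonneg_nonneg) auto
    then show ?thesis using cross by linarith
  qed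
  have "k * r\<^sup>2 = k * v\<^sup>2 + k * (\<xi>\<^sup>2 / (2 * kI))"
    using r by (simp add: algebra_simps)
  also have "\<dots> \<le> c * v\<^sup>2 + (2 * kI * eps) * (\<xi>\<^sup>2 / (2 * kI))"
    using assms by (intro add_mono mult_right_mono) auto
  also have "\<dots> \<le> c * (r * v) + eps * \<xi>\<^sup>2"
    using vv c0 \<open>kI > 0\<close> by (simp add: mult_left_mono)
  finally have "lam * (k * r\<^sup>2) \<le> lam * (c * (r * v) + eps * \<xi>\<^sup>2)"
    using \<open>lam > 0\<close> by (intro mult_left_mono) auto
  then have 6: "- (lam * c * (r * v)) - eps * lam * \<xi>\<^sup>2 \<le> - (lam * k * r\<^sup>2)"
    by (simp add: algebra_simps)
  have 7: "3 / 2 * (a / kI) * M * r\<^sup>2 + eps * M * Cy * r\<^sup>2 \<le> 1 / 2 * (lam * k * r\<^sup>2)"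
    using 5 by (simp add: algebra_simps)
  have 8: "- (lam * k / 2) * r\<^sup>2 = - (1 / 2 * (lam * k * r\<^sup>2))"
    by simp
  show ?thesis
    unfolding 8 using 1 4 6 7 by linarith
qed

text \<open>
  What the closed-loop analysis uses of the nominal feedback and its Lyapunov function. The powers
  of \<open>V\<close> reflect the degrees: \<open>V\<close> has twice the degree of \<open>u0\<close> and the degree of the last coordinate,
  and the last partial derivative has degree zero. The constants \<open>mp\<close> and \<open>- mn\<close> are its values on the two
  halves of the last axis.
\<close>
locale super_twisting_data =
  fixes u0 V :: "real^'n::{finite,linorder} \<Rightarrow> real" and G :: "real^'n::_ \<Rightarrow> real^'n::_"
    and c Cu Cy Cd mp mn :: real
  assumes u0_cont: "continuous_on UNIV u0" and V_cont: "continuous_on UNIV V"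
    and V_0: "V 0 = 0" and V_pos: "z \<noteq> 0 \<Longrightarrow> V z > 0"
    and G_cont: "continuous_on (- {0}) G"
    and V_der: "z \<noteq> 0 \<Longrightarrow> (V has_derivative (\<lambda>h. G z \<bullet> h)) (at z)"
    and u0_le: "\<bar>u0 z\<bar> \<le> Cu * sqrt (V z)"
    and last_le: "\<bar>z $ last_idx\<bar> \<le> Cy * V z"
    and partial_le: "\<bar>partial_last V z\<bar> \<le> Cd"
    and decay: "z \<noteq> 0 \<Longrightarrow> G z \<bullet> integrator_chain z (u0 z) \<le> - c * sqrt (V z)"
    and nonpos: "partial_last V z * u0 z \<le> 0"
    and partial_axis: "s > 0 \<Longrightarrow> partial_last V (s *\<^sub>R axis last_idx 1) = mp"
      "s > 0 \<Longrightarrow> partial_last V (- s *\<^sub>R axis last_idx 1) = - mn"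
    and const_signs: "c > 0" "Cu \<ge> 0" "Cy \<ge> 0" "Cd \<ge> 0" "mp > 0" "mn > 0"
    and V_small: "r > 0 \<Longrightarrow> \<exists>\<eta>>0. \<forall>z. V z < \<eta> \<longrightarrow> norm z < r"
    and V_bounded: "\<exists>B. \<forall>z. V z \<le> R \<longrightarrow> norm z \<le> B"
begin

lemma V_nonneg [simp]: "V z \<ge> 0"
  using V_0 V_pos[of z] by (cases "z = 0") auto

lemma V_eq_0_iff [simp]: "V z = 0 \<longleftrightarrow> z = 0"
  using V_0 V_pos[of z] by (cases "z = 0") auto

lemma u0_0: "u0 0 = 0"
  using u0_le[of 0] by (simp add: V_0)

lemma partial_eq: "z \<noteq> 0 \<Longrightarrow> partial_last V z = G z \<bullet> axis last_idx 1"
  by (rule partial_last_eq_gradient) (rule V_der)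

lemma partial_cont: "continuous_on (- {0}) (partial_last V)"
proof -
  have "continuous_on (- {0}) (\<lambda>z. G z \<bullet> axis last_idx 1)"
    by (intro continuous_intros G_cont)
  then show ?thesis
    by (rule continuous_on_eq) (simp add: partial_eq)
qed

lemma isCont_partial: "z \<noteq> 0 \<Longrightarrow> isCont (partial_last V) z"
  using partial_cont by (simp add: continuous_on_eq_continuous_at open_Compl)

lemma partial_measurable: "partial_last V \<in> borel_measurable borel"
proof -
  have "(\<lambda>z. indicator (- {0}) z *\<^sub>R partial_last V z) \<in> borel_measurable borel"
    by (rule borel_measurable_continuous_on_indicator[OF _ partial_cont]) auto
  moreover have "(\<lambda>z :: real^'n::_. indicator {0} z *\<^sub>R partial_last V 0) \<in> borel_measurable borel"
    by measurable
  ultimately have "(\<lambda>z. indicator (- {0}) z *\<^sub>R partial_last V z + indicator {0} z *\<^sub>R partial_last V 0)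
      \<in> borel_measurable borel"
    by (rule borel_measurable_add)
  also have "(\<lambda>z. indicator (- {0}) z *\<^sub>R partial_last V z + indicator {0} z *\<^sub>R partial_last V 0) = partial_last V"
    by (auto simp: fun_eq_iff indicator_def)
  finally show ?thesis .
qed

text \<open>
  The integrand is bounded and Borel measurable, whatever its value at the origin is, and an
  indefinite integral is continuous.
\<close>
lemma super_twisting_continuous:
  assumes y: "continuous_on {0..} y"
  shows "continuous_on {0..} (super_twisting kP kI u0 V y)"
proof -
  have int: "(\<lambda>s. partial_last V (y s)) integrable_on {0..T}" for T
  proof (rule measurable_bounded_by_integrable_imp_integrable[where g = "\<lambda>_. Cd"])
    have "continuous_on {0..T} y" using y by (rule continuous_on_subset) auto
    then have "y \<in> borel_measurable (lebesgue_on {0..T})"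
      by (rule continuous_imp_measurable_on_sets_lebesgue) auto
    then show "(\<lambda>s. partial_last V (y s)) \<in> borel_measurable (lebesgue_on {0..T})"
      by (rule measurable_compose[OF _ partial_measurable])
  qed (use partial_le in auto)
  have "continuous_on {0..} (\<lambda>\<tau>. integral {0..\<tau>} (\<lambda>s. partial_last V (y s)))"
    unfolding continuous_on_eq_continuous_within
  proof
    fix t :: real assume t: "t \<in> {0..}"
    have "continuous_on {0..t + 1} (\<lambda>\<tau>. integral {0..\<tau>} (\<lambda>s. partial_last V (y s)))"
      by (intro indefinite_integral_continuous_1 int)
    then have "continuous (at t within {0..t + 1}) (\<lambda>\<tau>. integral {0..\<tau>} (\<lambda>s. partial_last V (y s)))"
      using t by (auto simp: continuous_on_eq_continuous_within)
    moreover have "at t within {0..t + 1} = at t within {0..}"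
      by (rule at_within_nhd[of _ "{..<t + 1}"]) (use t in auto)
    ultimately show "continuous (at t within {0..}) (\<lambda>\<tau>. integral {0..\<tau>} (\<lambda>s. partial_last V (y s)))"
      by simp
  qed
  moreover have "continuous_on {0..} (\<lambda>\<tau>. u0 (y \<tau>))"
    by (rule continuous_on_compose2[OF u0_cont y]) auto
  ultimately show ?thesis
    unfolding super_twisting_def by (intro continuous_intros)
qed

end

text \<open>
  The weight \<open>eps\<close> of the cross term is chosen first, depending on the gains, and \<open>lam\<close> afterwards,
  depending on \<open>eps\<close> and \<open>M\<close>. The last two conditions on \<open>lam\<close> allow the integral term to compensate a
  perturbation with derivative up to \<open>M\<close> while the chain rests at the origin.
\<close>
locale super_twisting_loop = super_twisting_data u0 V G c Cu Cy Cd mp mn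
  for u0 V :: "real^'n::{finite,linorder} \<Rightarrow> real" and G c Cu Cy Cd mp mn +
  fixes kP kI M eps lam k \<gamma> :: real
  assumes gains: "kP \<ge> 1" "kI > 0" "M \<ge> 0" "eps > 0" "lam > 0" "\<gamma> > 0"
    and k: "k > 0" "k \<le> c" "k \<le> 2 * kI * eps"
    and cross_small: "eps * (kP * sqrt (2 * kI) * Cu + kI * Cd * Cy) \<le> c / 2"
      "eps * (sqrt (2 * kI) * Cy) \<le> 1 / 2"
    and lam_large: "M * (3 / 2 * sqrt (2 * kI) / kI + eps * Cy) \<le> lam * k / 2"
      "M \<le> lam * kI * mp" "M \<le> lam * kI * mn"
begin

definition energy :: "(real^'n::_) \<times> real \<Rightarrow> real" where
  "energy x = V (fst x) + (snd x)\<^sup>2 / (2 * kI)"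

definition lyap :: "(real^'n::_) \<times> real \<Rightarrow> real" where
  "lyap x = energy x powr (3 / 2) - eps * (snd x * fst x $ last_idx)"

definition lyap_root :: "(real^'n::_) \<times> real \<Rightarrow> real" where
  "lyap_root x = lyap x powr (1 / 3)"

definition lyap_root_grad :: "(real^'n::_) \<times> real \<Rightarrow> (real^'n::_) \<times> real" where
  "lyap_root_grad x = (1 / 3 * lyap x powr (- 2 / 3)) *\<^sub>R
     ((3 / 2 * sqrt (energy x)) *\<^sub>R (G (fst x), snd x / kI)
       - eps *\<^sub>R (snd x *\<^sub>R axis last_idx 1, fst x $ last_idx))"

lemma energy_nonneg: "energy x \<ge> 0"
  using gains by (simp add: energy_def)

lemma energy_pos: "x \<noteq> 0 \<Longrightarrow> energy x > 0"
proof -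
  assume "x \<noteq> 0"
  then consider "fst x \<noteq> 0" | "snd x \<noteq> 0"
    by (metis prod.collapse zero_prod_def)
  then show ?thesis
    using V_pos[of "fst x"] gains
    by cases (auto simp: energy_def intro: add_pos_nonneg add_nonneg_pos)
qed

lemma energy_cont: "continuous_on S energy"
  unfolding energy_def using gains
  by (intro continuous_intros continuous_on_compose2[OF V_cont]) auto

text \<open>
  In terms of \<open>r = sqrt (energy x)\<close> the cross term is of order \<open>r * r\<^sup>2\<close>, and the second condition
  on \<open>eps\<close> makes it at most half of the leading term \<open>r ^ 3\<close>.
\<close>
lemma lyap_bounds: "1 / 2 * sqrt (energy x) ^ 3 \<le> lyap x" "lyap x \<le> 3 / 2 * sqrt (energy x) ^ 3"
proof -
  define r where "r = sqrt (energy x)"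
  have r: "r \<ge> 0" "r\<^sup>2 = energy x" using energy_nonneg[of x] by (auto simp: r_def)
  have "energy x powr (3 / 2) = (energy x powr (1 / 2)) powr 3"
    by (simp add: powr_powr)
  also have "\<dots> = r ^ 3"
    using r(1) energy_nonneg[of x] by (simp add: powr_half_sqrt r_def)
  finally have 1: "energy x powr (3 / 2) = r ^ 3" .
  have "(snd x)\<^sup>2 \<le> 2 * kI * r\<^sup>2"
    using gains r(2) by (simp add: energy_def field_simps)
  then have "\<bar>snd x\<bar> \<le> sqrt (2 * kI * r\<^sup>2)"
    by (metis real_sqrt_abs real_sqrt_le_mono)
  then have \<xi>: "\<bar>snd x\<bar> \<le> sqrt (2 * kI) * r"
    using r(1) by (simp add: real_sqrt_mult)
  have "\<bar>fst x $ last_idx\<bar> \<le> Cy * V (fst x)" by (rule last_le)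
  also have "\<dots> \<le> Cy * r\<^sup>2"
    using r(2) gains const_signs by (intro mult_left_mono) (auto simp: energy_def)
  finally have "\<bar>snd x * fst x $ last_idx\<bar> \<le> (sqrt (2 * kI) * r) * (Cy * r\<^sup>2)"
    unfolding abs_mult using \<xi> gains r by (intro mult_mono) auto
  then have "eps * \<bar>snd x * fst x $ last_idx\<bar> \<le> eps * ((sqrt (2 * kI) * r) * (Cy * r\<^sup>2))"
    using gains by (intro mult_left_mono) auto
  also have "\<dots> = eps * (sqrt (2 * kI) * Cy) * r ^ 3"
    by (simp add: power3_eq_cube power2_eq_square)
  also have "\<dots> \<le> 1 / 2 * r ^ 3"
    using cross_small(2) r(1) by (intro mult_right_mono) auto
  finally have "\<bar>eps * (snd x * fst x $ last_idx)\<bar> \<le> 1 / 2 * r ^ 3"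
    using gains by (simp add: abs_mult)
  then show "1 / 2 * sqrt (energy x) ^ 3 \<le> lyap x" "lyap x \<le> 3 / 2 * sqrt (energy x) ^ 3"
    unfolding lyap_def 1 r_def[symmetric] by linarith+
qed

lemma lyap_nonneg: "lyap x \<ge> 0"
proof -
  have "0 \<le> 1 / 2 * sqrt (energy x) ^ 3" using energy_nonneg[of x] by simp
  then show ?thesis using lyap_bounds(1)[of x] by linarith
qed

lemma lyap_pos: "x \<noteq> 0 \<Longrightarrow> lyap x > 0"
proof -
  assume "x \<noteq> 0"
  then have "0 < 1 / 2 * sqrt (energy x) ^ 3" using energy_pos[of x] by simp
  then show ?thesis using lyap_bounds(1)[of x] by linarith
qed

lemma lyap_root_cube: "lyap_root x ^ 3 = lyap x"
proof -
  have "lyap_root x ^ 3 = lyap_root x powr 3"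
    by (simp add: lyap_root_def)
  also have "\<dots> = lyap x"
    using lyap_nonneg[of x] by (simp add: lyap_root_def powr_powr)
  finally show ?thesis .
qed

lemma lyap_root_nonneg [simp]: "lyap_root x \<ge> 0"
  by (simp add: lyap_root_def)

lemma lyap_root_eq_0_iff: "lyap_root x = 0 \<longleftrightarrow> x = 0"
proof
  show "x = 0" if "lyap_root x = 0"
    using that lyap_pos[of x] by (auto simp: lyap_root_def)
  show "lyap_root x = 0" if "x = 0"
    using that by (simp add: lyap_root_def lyap_def energy_def V_0)
qed

lemma lyap_root_pos_iff: "lyap_root x > 0 \<longleftrightarrow> x \<noteq> 0"
  using lyap_root_eq_0_iff[of x] lyap_root_nonneg[of x] by (metis less_le)

lemma sqrt_energy_le: "sqrt (energy x) \<le> 2 * lyap_root x"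
proof -
  have "0 \<le> lyap_root x ^ 3" by simp
  then have "sqrt (energy x) ^ 3 \<le> (2 * lyap_root x) ^ 3"
    using lyap_bounds(1)[of x] by (simp add: lyap_root_cube power_mult_distrib)
  then show ?thesis
    by (subst (asm) power_mono_iff) (use energy_nonneg[of x] in auto)
qed

lemma lyap_root_le: "lyap_root x \<le> 5 / 4 * sqrt (energy x)"
proof -
  \<comment> \<open>The cube of \<open>5 / 4\<close> is at least \<open>3 / 2\<close>, and its square is at most \<open>2\<close>, as \<open>lyap_root_rate\<close> needs.\<close>
  have "0 \<le> sqrt (energy x) ^ 3" using energy_nonneg[of x] by simp
  moreover have "(5 / 4 * sqrt (energy x)) ^ 3 = 125 / 64 * sqrt (energy x) ^ 3"
    by (simp only: power_mult_distrib) (simp add: power_divide)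
  ultimately have "lyap_root x ^ 3 \<le> (5 / 4 * sqrt (energy x)) ^ 3"
    using lyap_bounds(2)[of x] unfolding lyap_root_cube by linarith
  then show ?thesis
    by (subst (asm) power_mono_iff) (use energy_nonneg[of x] in auto)
qed

lemma lyap_cont: "continuous_on S lyap"
  unfolding lyap_def
  by (intro continuous_intros continuous_on_powr' energy_cont) (use energy_nonneg in auto)

lemma lyap_root_cont: "continuous_on S lyap_root"
  unfolding lyap_root_def
  by (intro continuous_on_powr' lyap_cont continuous_intros) (use lyap_nonneg in auto)

lemma lyap_root_derivative:
  assumes "fst x \<noteq> 0"
  shows "(lyap_root has_derivative (\<lambda>h. lyap_root_grad x \<bullet> h)) (at x)"
proof -
  have x: "x \<noteq> 0" using assms by auto
  have V: "((\<lambda>x. V (fst x)) has_derivative (\<lambda>h. G (fst x) \<bullet> fst h)) (at x)"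
    by (rule has_derivative_compose[OF has_derivative_fst[OF has_derivative_ident] V_der[OF assms]])
  have E: "(energy has_derivative (\<lambda>h. G (fst x) \<bullet> fst h + snd x / kI * snd h)) (at x)"
    unfolding energy_def using gains
    by (auto intro!: derivative_eq_intros V simp: field_simps)
  have "((\<lambda>y. energy y powr (3 / 2)) has_derivative
      (\<lambda>h. (G (fst x) \<bullet> fst h + snd x / kI * snd h) * (3 / 2 * energy x powr (3 / 2 - 1)))) (at x)"
    by (rule DERIV_compose_FDERIV[OF has_real_derivative_powr[OF energy_pos[OF x]] E])
  then have P: "((\<lambda>y. energy y powr (3 / 2)) has_derivative
      (\<lambda>h. (G (fst x) \<bullet> fst h + snd x / kI * snd h) * (3 / 2 * sqrt (energy x)))) (at x)"
    using energy_nonneg[of x] by (simp add: powr_half_sqrt)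
  have Q: "((\<lambda>y. snd y * fst y $ last_idx) has_derivative
      (\<lambda>h. snd x * fst h $ last_idx + snd h * fst x $ last_idx)) (at x)"
    by (rule has_derivative_mult[of snd snd _ _ "\<lambda>y. fst y $ last_idx" "\<lambda>y. fst y $ last_idx"])
      (auto intro!: bounded_linear_imp_has_derivative bounded_linear_snd
        bounded_linear_compose[OF bounded_linear_vec_nth bounded_linear_fst])
  have L: "(lyap has_derivative (\<lambda>h. (G (fst x) \<bullet> fst h + snd x / kI * snd h) * (3 / 2 * sqrt (energy x))
      - eps * (snd x * fst h $ last_idx + snd h * fst x $ last_idx))) (at x)"
    unfolding lyap_def by (intro has_derivative_diff P has_derivative_mult_right Q)
  have "(lyap_root has_derivative (\<lambda>h. ((G (fst x) \<bullet> fst h + snd x / kI * snd h) * (3 / 2 * sqrt (energy x))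
      - eps * (snd x * fst h $ last_idx + snd h * fst x $ last_idx)) * (1 / 3 * lyap x powr (1 / 3 - 1)))) (at x)"
    unfolding lyap_root_def
    by (rule DERIV_compose_FDERIV[OF has_real_derivative_powr[OF lyap_pos[OF x]] L])
  moreover have "((G (fst x) \<bullet> fst h + snd x / kI * snd h) * (3 / 2 * sqrt (energy x))
      - eps * (snd x * fst h $ last_idx + snd h * fst x $ last_idx)) * (1 / 3 * lyap x powr (1 / 3 - 1))
      = lyap_root_grad x \<bullet> h" for h
    by (cases h) (simp add: lyap_root_grad_def inner_diff_left inner_axis' algebra_simps
      add_divide_distrib diff_divide_distrib)
  ultimately show ?thesis by simp
qed

lemma lyap_root_grad_cont: "continuous_on {x. fst x \<noteq> 0} lyap_root_grad"
proof -
  have "continuous_on {x :: (real^'n::_) \<times> real. fst x \<noteq> 0} (\<lambda>x. G (fst x))"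
    by (rule continuous_on_compose2[OF G_cont]) (auto intro: continuous_intros)
  moreover have "lyap x \<noteq> 0" if "fst x \<noteq> 0" for x
    using lyap_pos[of x] that by (metis fst_zero less_irrefl)
  ultimately show ?thesis
    unfolding lyap_root_grad_def using gains
    by (intro continuous_intros continuous_on_powr lyap_cont energy_cont) auto
qed

text \<open>
  The dissipation \<open>- lam * k / 2 * r\<^sup>2\<close> of \<open>lyap\<close> is multiplied by the derivative
  \<open>1 / (3 * (lyap_root x)\<^sup>2)\<close> of the cube root, and \<open>(lyap_root x)\<^sup>2 \<le> 2 * r\<^sup>2\<close>. The vector on the right
  of the inner product is the velocity of \<open>(y, \<xi>)\<close> where \<open>y \<noteq> 0\<close>.
\<close>
lemma lyap_root_rate:
  assumes "y \<noteq> 0" "\<bar>h\<bar> \<le> M"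
  shows "lyap_root_grad (y, \<xi>) \<bullet> (lam *\<^sub>R integrator_chain y (kP * u0 y + \<xi>), h - lam * kI * partial_last V y)
    \<le> - (lam * k / 12)"
proof -
  define r where "r = sqrt (energy (y, \<xi>))"
  define q where "q = partial_last V y"
  define g where "g = G y \<bullet> integrator_chain y (u0 y)"
  have ne: "(y, \<xi>) \<noteq> 0" using assms by (simp add: zero_prod_def)
  have r2: "r\<^sup>2 = V y + \<xi>\<^sup>2 / (2 * kI)"
    using energy_nonneg[of "(y, \<xi>)"] by (simp add: r_def energy_def)
  define D where "D = 3 / 2 * r * (lam * (g + (kP - 1) * (q * u0 y) + \<xi> * q) + \<xi> / kI * (h - lam * kI * q))
      - eps * ((h - lam * kI * q) * y $ last_idx + \<xi> * (lam * (kP * u0 y + \<xi>)))"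
  have "D \<le> - (lam * k / 2) * r\<^sup>2"
    unfolding D_def
  proof (rule super_twisting_dissipation[where v = "sqrt (V y)" and Cu = Cu and Cy = Cy and Cd = Cd and M = M and c = c])
    show "g \<le> - c * sqrt (V y)" using decay[OF assms(1)] by (simp add: g_def)
    show "r\<^sup>2 = (sqrt (V y))\<^sup>2 + \<xi>\<^sup>2 / (2 * kI)" using r2 by simp
    show "\<bar>y $ last_idx\<bar> \<le> Cy * (sqrt (V y))\<^sup>2" using last_le[of y] by simp
    show "0 \<le> r" using energy_nonneg by (simp add: r_def)
  qed (use gains k cross_small lam_large const_signs u0_le partial_le nonpos assms in \<open>auto simp: q_def\<close>)
  moreover have "integrator_chain y (kP * u0 y + \<xi>) =
      integrator_chain y (u0 y) + ((kP - 1) * u0 y + \<xi>) *\<^sub>R axis last_idx 1"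
    unfolding integrator_chain_add[symmetric] by (simp add: algebra_simps)
  then have G: "G y \<bullet> integrator_chain y (kP * u0 y + \<xi>) = g + ((kP - 1) * u0 y + \<xi>) * q"
    by (simp add: inner_add_right g_def q_def partial_eq[OF assms(1)])
  have "lyap_root_grad (y, \<xi>) \<bullet> (lam *\<^sub>R integrator_chain y (kP * u0 y + \<xi>), h - lam * kI * q)
      = 1 / 3 * lyap (y, \<xi>) powr (- 2 / 3) * D"
  proof -
    have 1: "((kP - 1) * u0 y + \<xi>) * q = (kP - 1) * (q * u0 y) + \<xi> * q"
      by (simp add: algebra_simps)
    have "lyap_root_grad (y, \<xi>) \<bullet> (lam *\<^sub>R x, e) = 1 / 3 * lyap (y, \<xi>) powr (- 2 / 3) *
        (3 / 2 * r * (lam * (G y \<bullet> x) + \<xi> / kI * e) - eps * (e * y $ last_idx + \<xi> * (lam * x $ last_idx)))"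
      for x e
      by (simp add: lyap_root_grad_def inner_diff_left inner_axis' r_def[symmetric] algebra_simps
          add_divide_distrib diff_divide_distrib)
    then show ?thesis
      unfolding D_def by (simp only: G 1 integrator_chain_nth_last add.assoc)
  qed
  moreover have "1 / 2 \<le> r\<^sup>2 * lyap (y, \<xi>) powr (- 2 / 3)"
  proof -
    have root: "lyap_root (y, \<xi>) > 0" using ne by (simp add: lyap_root_pos_iff)
    have "lyap_root (y, \<xi>) powr 2 = lyap (y, \<xi>) powr (2 / 3)"
      by (simp add: lyap_root_def powr_powr)
    then have eq: "lyap (y, \<xi>) powr (- 2 / 3) = 1 / (lyap_root (y, \<xi>))\<^sup>2"
      using root by (simp add: powr_minus_divide)
    have "lyap_root (y, \<xi>) \<le> 5 / 4 * r"
      using lyap_root_le[of "(y, \<xi>)"] by (simp add: r_def)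
    then have "(lyap_root (y, \<xi>))\<^sup>2 \<le> (5 / 4 * r)\<^sup>2"
      using root by (intro power_mono) auto
    also have "\<dots> \<le> 2 * r\<^sup>2" by (simp add: power_mult_distrib power_divide)
    finally show ?thesis
      unfolding eq using root by (simp add: field_simps)
  qed
  moreover have "1 / 3 * lyap (y, \<xi>) powr (- 2 / 3) * D \<le> 1 / 3 * lyap (y, \<xi>) powr (- 2 / 3) * (- (lam * k / 2) * r\<^sup>2)"
    using \<open>D \<le> _\<close> by (rule mult_left_mono) simp
  ultimately have "lyap_root_grad (y, \<xi>) \<bullet> (lam *\<^sub>R integrator_chain y (kP * u0 y + \<xi>), h - lam * kI * q)
      \<le> 1 / 3 * lyap (y, \<xi>) powr (- 2 / 3) * (- (lam * k / 2) * r\<^sup>2)"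
    by metis
  also have "\<dots> = - (lam * k / 6) * (r\<^sup>2 * lyap (y, \<xi>) powr (- 2 / 3))"
    by simp
  also have "\<dots> \<le> - (lam * k / 6) * (1 / 2)"
    using \<open>1 / 2 \<le> r\<^sup>2 * _\<close> gains k by (intro mult_left_mono_neg) auto
  finally show ?thesis by (simp add: q_def)
qed

abbreviation closed_loop :: "(real \<Rightarrow> real) \<Rightarrow> real \<Rightarrow> (real^'n::_) \<times> real \<Rightarrow> (real^'n::_) \<times> real" where
  "closed_loop \<equiv> st_closed_loop \<gamma> kP kI lam u0 V"

lemma closed_loop_eq:
  "closed_loop \<phi> t x =
    (integrator_chain (fst x) (kP * u0 (scaling lam (fst x)) + (\<phi> t - kI * snd x)),
     lam * partial_last V (scaling lam (fst x)))"
  using gains by (simp add: st_closed_loop_def st_control_def case_prod_beta algebra_simps)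

lemma u0_scaling_cont [continuous_intros]:
  assumes "continuous_on S f"
  shows "continuous_on S (\<lambda>x. u0 (scaling lam (f x)))"
  by (rule continuous_on_compose2[OF u0_cont bounded_linear.continuous_on[OF bounded_linear_scaling assms]]) auto

text \<open>
  Only the velocity of the integral state is discontinuous, and only at \<open>z = 0\<close>; there it is merely
  bounded.
\<close>
lemma filippov_closed_loop:
  assumes "v \<in> filippov (closed_loop \<phi> t) x"
  shows "fst v = integrator_chain (fst x) (kP * u0 (scaling lam (fst x)) + (\<phi> t - kI * snd x))"
    and "\<bar>snd v\<bar> \<le> lam * Cd"
    and "fst x \<noteq> 0 \<Longrightarrow> snd v = lam * partial_last V (scaling lam (fst x))"
proof -
  have "continuous_on UNIV (\<lambda>x :: (real^'n::_) \<times> real.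
      integrator_chain (fst x) (kP * u0 (scaling lam (fst x)) + (\<phi> t - kI * snd x)))"
    by (intro continuous_intros)
  then have "isCont (\<lambda>x. fst (closed_loop \<phi> t x)) x"
    unfolding closed_loop_eq fst_conv using continuous_on_eq_continuous_at[OF open_UNIV] by blast
  from filippov_isCont[OF this] filippov_bounded_linear[OF bounded_linear_fst assms]
  show "fst v = integrator_chain (fst x) (kP * u0 (scaling lam (fst x)) + (\<phi> t - kI * snd x))"
    by (simp add: closed_loop_eq)
  have "filippov (\<lambda>x. snd (closed_loop \<phi> t x)) x \<subseteq> {- (lam * Cd)..lam * Cd}"
  proof (rule filippov_subset_closed_convex)
    fix y :: "(real^'n::_) \<times> real"
    have "\<bar>lam * partial_last V (scaling lam (fst y))\<bar> \<le> lam * Cd"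
      using partial_le gains by (simp add: abs_mult)
    then show "snd (closed_loop \<phi> t y) \<in> {- (lam * Cd)..lam * Cd}"
      by (auto simp: closed_loop_eq)
  qed auto
  then have "snd v \<in> {- (lam * Cd)..lam * Cd}"
    using filippov_bounded_linear[OF bounded_linear_snd assms] by (rule subsetD)
  then show "\<bar>snd v\<bar> \<le> lam * Cd" by auto
  show "snd v = lam * partial_last V (scaling lam (fst x))" if "fst x \<noteq> 0"
  proof -
    have "isCont (closed_loop \<phi> t) (fst x, snd x)"
      using that gains by (intro isCont_closed_loop u0_cont isCont_partial) auto
    then show ?thesis
      using filippov_isCont assms by (fastforce simp: closed_loop_eq)
  qed
qed

end

section \<open>Decay along perturbed trajectories\<close>

locale super_twisting_trajectory = super_twisting_loop u0 V G c Cu Cy Cd mp mn kP kI M eps lam k \<gamma>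
  for u0 V :: "real^'n::{finite,linorder} \<Rightarrow> real" and G c Cu Cy Cd mp mn kP kI M eps lam k \<gamma> +
  fixes \<phi> :: "real \<Rightarrow> real" and b :: ereal and z :: "real \<Rightarrow> real^'n::_" and w :: "real \<Rightarrow> real"
  assumes adm: "admissible_perturbation M \<phi>"
    and sol: "filippov_solution (st_closed_loop \<gamma> kP kI lam u0 V \<phi>) b (\<lambda>t. (z t, w t))"
begin

text \<open>
  In these coordinates the rest point of the closed loop is the origin: the integral state
  compensates the perturbation exactly when the second component vanishes.
\<close>
definition state :: "real \<Rightarrow> (real^'n::_) \<times> real" where
  "state t = (scaling lam (z t), \<phi> t - kI * w t)"

lemma fst_state: "fst (state t) = 0 \<longleftrightarrow> z t = 0"
  using gains by (simp add: state_def scaling_eq_0)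

lemma perturbation_cont: "continuous_on {0..} \<phi>"
  using adm lipschitz_on_continuous_on by (auto simp: admissible_perturbation_def)

lemma z_cont: "continuous_on {t. 0 \<le> t \<and> ereal t < b} z"
  and w_cont: "continuous_on {t. 0 \<le> t \<and> ereal t < b} w"
  using continuous_on_fst[OF filippov_solution_continuous[OF sol]]
    continuous_on_snd[OF filippov_solution_continuous[OF sol]] by simp_all

lemma less_end: "s \<le> t \<Longrightarrow> ereal t < b \<Longrightarrow> ereal s < b"
  by (auto intro: le_less_trans[of "ereal s" "ereal t"])

lemma Icc_subset_domain: "ereal T < b \<Longrightarrow> {0..T} \<subseteq> {t. 0 \<le> t \<and> ereal t < b}"
  using less_end by auto

lemma state_cont: "ereal T < b \<Longrightarrow> continuous_on {0..T} state"
  unfolding state_def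
  by (intro continuous_intros bounded_linear.continuous_on[OF bounded_linear_scaling]
      continuous_on_subset[OF z_cont Icc_subset_domain] continuous_on_subset[OF w_cont Icc_subset_domain]
      continuous_on_subset[OF perturbation_cont]) auto

definition input :: "real \<Rightarrow> real" where
  "input t = kP * u0 (fst (state t)) + snd (state t)"

definition state_velocity :: "real \<Rightarrow> real \<Rightarrow> (real^'n::_) \<times> real" where
  "state_velocity h t =
    (lam *\<^sub>R integrator_chain (fst (state t)) (input t), h - lam * kI * partial_last V (fst (state t)))"

lemma input_cont: "ereal T < b \<Longrightarrow> continuous_on {0..T} input"
  unfolding input_def
  by (intro continuous_intros continuous_on_compose2[OF u0_cont] state_cont) auto

lemma input_eq: "input t = kP * u0 (scaling lam (z t)) + (\<phi> t - kI * w t)"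
  by (simp add: input_def state_def)

text \<open>
  The input is continuous in time even across zeros of \<open>z\<close>, so the last coordinate is continuously
  differentiable throughout.
\<close>
lemma last_component_increment:
  assumes "0 \<le> s" "s \<le> t" "ereal t < b"
  shows "z t $ last_idx - z s $ last_idx = integral {s..t} input"
proof -
  have "0 \<le> t" using assms by simp
  obtain v N where v: "v absolutely_integrable_on {0..t}"
    "\<And>s u. 0 \<le> s \<Longrightarrow> s \<le> u \<Longrightarrow> u \<le> t \<Longrightarrow> (z u, w u) - (z s, w s) = integral {s..u} v"
    "negligible N"
    "\<And>u. 0 \<le> u \<Longrightarrow> u \<le> t \<Longrightarrow> u \<notin> N \<Longrightarrow> v u \<in> filippov (closed_loop \<phi> u) (z u, w u)"
    by (rule filippov_solution_velocity[OF sol \<open>0 \<le> t\<close> assms(3)]) blast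
  have vi: "v integrable_on {s..t}"
    using v(1) assms set_lebesgue_integral_eq_integral(1) integrable_on_subinterval[of v "{0..t}" s t] by auto
  have bl: "bounded_linear (\<lambda>p :: (real^'n::_) \<times> real. fst p $ last_idx)"
    by (rule bounded_linear_compose[OF bounded_linear_vec_nth bounded_linear_fst])
  have "z t $ last_idx - z s $ last_idx = fst (integral {s..t} v) $ last_idx"
    using v(2)[OF assms(1,2) order_refl] by (metis fst_conv fst_diff vector_minus_component)
  also have "\<dots> = integral {s..t} (\<lambda>u. fst (v u) $ last_idx)"
    using integral_linear[OF vi bl] by (simp add: o_def)
  also have "\<dots> = integral {s..t} input"
  proof (rule integral_spike[OF v(3)])
    fix u assume "u \<in> {s..t} - N"
    then show "input u = fst (v u) $ last_idx"
      using filippov_closed_loop(1)[OF v(4)[of u]] assms(1)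
      by (simp add: input_eq integrator_chain_nth_last)
  qed
  finally show ?thesis .
qed

lemma state_derivative:
  assumes "0 \<le> T" "ereal T < b"
  obtains K N where "K-lipschitz_on {0..T} state" "negligible N"
    "\<And>t. 0 < t \<Longrightarrow> t < T \<Longrightarrow> t \<notin> N \<Longrightarrow> z t \<noteq> 0 \<Longrightarrow>
      \<exists>h. \<bar>h\<bar> \<le> M \<and> (state has_vector_derivative state_velocity h t) (at t)"
proof -
  obtain v N where v: "v absolutely_integrable_on {0..T}"
    "\<And>s t. 0 \<le> s \<Longrightarrow> s \<le> t \<Longrightarrow> t \<le> T \<Longrightarrow> (z t, w t) - (z s, w s) = integral {s..t} v"
    "negligible N"
    "\<And>t. 0 \<le> t \<Longrightarrow> t \<le> T \<Longrightarrow> t \<notin> N \<Longrightarrow> v t \<in> filippov (closed_loop \<phi> t) (z t, w t)"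
    "\<And>t. 0 < t \<Longrightarrow> t < T \<Longrightarrow> t \<notin> N \<Longrightarrow> ((\<lambda>t. (z t, w t)) has_vector_derivative v t) (at t)"
    by (rule filippov_solution_velocity[OF sol assms]) blast
  obtain h N' where h: "\<And>t. \<bar>h t\<bar> \<le> M" "negligible N'"
    "\<And>t. t > 0 \<Longrightarrow> t \<notin> N' \<Longrightarrow> (\<phi> has_real_derivative h t) (at t)"
    using admissible_perturbation_integral[OF adm gains(3)] by metis
  have cz: "continuous_on {0..T} z"
    by (rule continuous_on_subset[OF z_cont Icc_subset_domain[OF assms(2)]])
  have "continuous_on {0..T} (\<lambda>t. integrator_chain (z t) (input t))"
    by (intro continuous_intros input_cont cz assms)
  then obtain K1 where "K1 \<ge> 0" and K1: "\<And>t. t \<in> {0..T} \<Longrightarrow> norm (integrator_chain (z t) (input t)) \<le> K1"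
    using compact_continuous_norm_bound[of "{0..T}"] compact_Icc by blast
  have vK: "norm (v t) \<le> K1 + lam * Cd" if "0 \<le> t" "t \<le> T" "t \<notin> N" for t
  proof -
    have "norm (v t) \<le> norm (fst (v t)) + norm (snd (v t))"
      by (metis norm_Pair_le prod.collapse)
    also have "\<dots> \<le> K1 + lam * Cd"
      using filippov_closed_loop(1,2)[OF v(4)[OF that]] K1 that
      by (intro add_mono) (auto simp: input_eq)
    finally show ?thesis .
  qed
  define K where "K = K1 + lam * Cd"
  have K0: "K \<ge> 0" using \<open>K1 \<ge> 0\<close> gains const_signs by (simp add: K_def)
  have xlip: "norm ((z t, w t) - (z s, w s)) \<le> K * (t - s)" if "0 \<le> s" "s \<le> t" "t \<le> T" for s t
  proof -
    have "v integrable_on {s..t}"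
      using v(1) that set_lebesgue_integral_eq_integral(1) integrable_on_subinterval[of v "{0..T}" s t] by auto
    then have "norm (integral {s..t} v) \<le> K * (t - s)"
      by (rule norm_integral_le_AE[OF _ v(3)]) (use that K0 vK in \<open>auto simp: K_def\<close>)
    then show ?thesis using v(2)[OF that] by simp
  qed
  obtain L where L: "L-lipschitz_on {0..} \<phi>"
    using adm by (auto simp: admissible_perturbation_def)
  obtain B where B: "B > 0" "\<And>x :: real^'n::_. norm (scaling lam x) \<le> norm x * B"
    using bounded_linear.pos_bounded[OF bounded_linear_scaling] by blast
  have slip: "dist (state t) (state s) \<le> (K * B + (L + kI * K)) * dist t s"
    if "0 \<le> s" "s \<le> t" "t \<le> T" for s t
  proof -
    have "norm (z t - z s) \<le> K * (t - s)" "\<bar>w t - w s\<bar> \<le> K * (t - s)"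
      using xlip[OF that] norm_fst_le[of "z t - z s" "w t - w s"] norm_snd_le[of "w t - w s" "z t - z s"]
      by auto
    then have "norm (z t - z s) * B \<le> K * (t - s) * B" and 2: "kI * \<bar>w t - w s\<bar> \<le> kI * (K * (t - s))"
      using B(1) gains by simp_all
    then have 1: "norm (scaling lam (z t - z s)) \<le> K * B * (t - s)"
      using B(2)[of "z t - z s"] by (simp add: mult.commute mult.left_commute)
    have 3: "\<bar>\<phi> t - \<phi> s\<bar> \<le> L * (t - s)"
      using lipschitz_onD[OF L, of t s] that by (simp add: dist_real_def)
    have "state t - state s = (scaling lam (z t - z s), (\<phi> t - \<phi> s) - kI * (w t - w s))"
      by (simp add: state_def linear_diff[OF bounded_linear.linear[OF bounded_linear_scaling]] algebra_simps)
    then have "norm (state t - state s) \<le> norm (scaling lam (z t - z s)) + \<bar>(\<phi> t - \<phi> s) - kI * (w t - w s)\<bar>"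
      by (metis norm_Pair_le real_norm_def)
    also have "\<bar>(\<phi> t - \<phi> s) - kI * (w t - w s)\<bar> \<le> \<bar>\<phi> t - \<phi> s\<bar> + kI * \<bar>w t - w s\<bar>"
      using abs_triangle_ineq4[of "\<phi> t - \<phi> s" "kI * (w t - w s)"] gains by (simp add: abs_mult)
    finally have "norm (state t - state s) \<le> K * B * (t - s) + (L * (t - s) + kI * (K * (t - s)))"
      using 1 2 3 by linarith
    then show ?thesis
      using that by (simp add: dist_norm algebra_simps)
  qed
  show ?thesis
  proof
    show "(K * B + (L + kI * K))-lipschitz_on {0..T} state"
    proof (rule lipschitz_onI)
      show "dist (state t) (state s) \<le> (K * B + (L + kI * K)) * dist t s"
        if "t \<in> {0..T}" "s \<in> {0..T}" for t s
        using slip[of s t] slip[of t s] that by (cases "s \<le> t") (auto simp: dist_commute)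
      show "0 \<le> K * B + (L + kI * K)"
        using K0 B(1) gains lipschitz_on_nonneg[OF L] by simp
    qed
    show "negligible (N \<union> N')" using v(3) h(2) by (rule negligible_Un)
    fix t assume t: "0 < t" "t < T" "t \<notin> N \<union> N'" "z t \<noteq> 0"
    have xd: "((\<lambda>t. (z t, w t)) has_vector_derivative v t) (at t)"
      using v(5) t by auto
    have fl: "v t \<in> filippov (closed_loop \<phi> t) (z t, w t)"
      using v(4) t by auto
    have zd: "((\<lambda>t. scaling lam (z t)) has_vector_derivative scaling lam (fst (v t))) (at t)"
      using bounded_linear.has_vector_derivative[OF bounded_linear_compose[OF bounded_linear_scaling bounded_linear_fst] xd]
      by simp
    have wd: "(w has_vector_derivative snd (v t)) (at t)"
      using bounded_linear.has_vector_derivative[OF bounded_linear_snd xd] by simp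
    have \<phi>d: "(\<phi> has_vector_derivative h t) (at t)"
      using h(3) t by (simp add: has_real_derivative_iff_has_vector_derivative)
    have "((\<lambda>t. \<phi> t - kI * w t) has_vector_derivative (h t - kI * snd (v t))) (at t)"
      by (intro has_vector_derivative_diff \<phi>d has_vector_derivative_mult_right wd)
    then have "(state has_vector_derivative (scaling lam (fst (v t)), h t - kI * snd (v t))) (at t)"
      unfolding state_def by (intro has_vector_derivative_Pair zd)
    moreover have "scaling lam (fst (v t)) = lam *\<^sub>R integrator_chain (fst (state t)) (input t)"
      using filippov_closed_loop(1)[OF fl] by (simp add: scaling_integrator_chain input_eq state_def)
    moreover have "kI * snd (v t) = lam * kI * partial_last V (fst (state t))"
      using filippov_closed_loop(3)[OF fl] t by (simp add: state_def)
    ultimately show "\<exists>h. \<bar>h\<bar> \<le> M \<and> (state has_vector_derivative state_velocity h t) (at t)"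
      using h(1)[of t] by (intro exI[of _ "h t"]) (simp add: state_velocity_def)
  qed
qed

lemma lyap_root_decrease_off_origin:
  assumes "0 \<le> s" "s \<le> t" "ereal t < b" and nz: "\<And>u. s \<le> u \<Longrightarrow> u \<le> t \<Longrightarrow> z u \<noteq> 0"
  shows "lyap_root (state t) \<le> lyap_root (state s) - lam * k / 12 * (t - s)"
proof -
  have "0 \<le> t" using assms by simp
  then obtain K N where KN: "K-lipschitz_on {0..t} state" "negligible N"
    "\<And>u. 0 < u \<Longrightarrow> u < t \<Longrightarrow> u \<notin> N \<Longrightarrow> z u \<noteq> 0 \<Longrightarrow>
      \<exists>h. \<bar>h\<bar> \<le> M \<and> (state has_vector_derivative state_velocity h u) (at u)"
    using state_derivative[OF _ assms(3)] by metis
  show ?thesis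
  proof (rule decreasing_along_gradient[OF _ _ lyap_root_grad_cont _ _ KN(2)])
    show "open {x :: (real^'n::_) \<times> real. fst x \<noteq> 0}"
    proof -
      have "{x :: (real^'n::_) \<times> real. fst x \<noteq> 0} = (- {0}) \<times> UNIV" by auto
      then show ?thesis by (simp add: open_Times open_Compl)
    qed
    show "K-lipschitz_on {s..t} state"
      using KN(1) by (rule lipschitz_on_subset) (use assms in auto)
    show "\<exists>v. (state has_vector_derivative v) (at u) \<and> lyap_root_grad (state u) \<bullet> v \<le> - (lam * k / 12)"
      if u: "s < u" "u < t" "u \<notin> N" for u
    proof -
      have zu: "z u \<noteq> 0" "0 < u" using nz u assms(1) by auto
      obtain h where h: "\<bar>h\<bar> \<le> M" "(state has_vector_derivative state_velocity h u) (at u)"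
        using KN(3)[of u] u zu by auto
      then show ?thesis
        using lyap_root_rate[of "fst (state u)" h "snd (state u)"] zu(1) fst_state[of u]
        by (auto simp: input_def state_velocity_def)
    qed
  qed (use assms nz fst_state lyap_root_derivative in auto)
qed

text \<open>
  At a zero of \<open>z\<close> the nominal feedback vanishes and the input is the second component of the state. If it
  is nonzero, the last coordinate moves away from zero with nonzero speed.
\<close>
lemma leaves_origin_component:
  assumes "0 \<le> t" "ereal t < b" "z t = 0" "state t \<noteq> 0"
  obtains \<delta> where "\<delta> > 0" "\<And>s. t < s \<Longrightarrow> s < t + \<delta> \<Longrightarrow> ereal s < b \<Longrightarrow> z s \<noteq> 0"
proof -
  obtain T where T: "t < T" "ereal T < b"
    using assms(2) ereal_dense2[of "ereal t" b] by auto
  have "scaling lam (z t) = 0" using assms fst_state[of t] by (simp add: state_def)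
  then have in0: "input t = snd (state t)" "input t \<noteq> 0"
    using assms by (auto simp: input_def state_def u0_0 zero_prod_def)
  have "continuous (at t within {0..T}) input"
    using input_cont[OF T(2)] T assms by (simp add: continuous_on_eq_continuous_within)
  then obtain \<delta>0 where \<delta>0: "\<delta>0 > 0"
    "\<And>u. u \<in> {0..T} \<Longrightarrow> dist u t < \<delta>0 \<Longrightarrow> dist (input u) (input t) < \<bar>input t\<bar> / 2"
    using in0 unfolding continuous_within_eps_delta by (metis half_gt_zero zero_less_abs_iff)
  define \<delta> where "\<delta> = min \<delta>0 (T - t)"
  show ?thesis
  proof
    show "\<delta> > 0" using \<delta>0 T by (simp add: \<delta>_def)
    fix s assume s: "t < s" "s < t + \<delta>" "ereal s < b"
    have sgn: "\<bar>input t\<bar> / 2 \<le> sgn (input t) * input u" if "u \<in> {t..s}" for u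
    proof -
      have "dist (input u) (input t) < \<bar>input t\<bar> / 2"
        using that s T assms by (intro \<delta>0(2)) (auto simp: \<delta>_def dist_real_def)
      then show ?thesis
        by (auto simp: dist_real_def sgn_if abs_if field_simps split: if_splits)
    qed
    have "continuous_on {t..s} input"
      by (rule continuous_on_subset[OF input_cont[OF T(2)]]) (use s assms in \<open>auto simp: \<delta>_def\<close>)
    then have "(\<lambda>u. sgn (input t) * input u) integrable_on {t..s}"
      by (intro integrable_continuous_real continuous_intros)
    have "\<bar>input t\<bar> / 2 * (s - t) = integral {t..s} (\<lambda>_. \<bar>input t\<bar> / 2)"
      using s by simp
    also have "\<dots> \<le> integral {t..s} (\<lambda>u. sgn (input t) * input u)"
      using sgn \<open>_ integrable_on {t..s}\<close> by (intro integral_le) auto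
    also have "\<dots> = sgn (input t) * integral {t..s} input" by simp
    also have "\<dots> = sgn (input t) * z s $ last_idx"
      using last_component_increment[of t s] s assms by simp
    finally have "sgn (input t) * z s $ last_idx > 0"
      by (rule less_le_trans[rotated]) (use in0 s in simp)
    then show "z s \<noteq> 0" by auto
  qed
qed

text \<open>
  Times with \<open>z \<noteq> 0\<close> are covered by differentiation. A time with \<open>z = 0\<close> is followed by an
  interval of such times, and the estimate passes to its left end by continuity.
\<close>
lemma lyap_root_decrease_nonzero:
  assumes "0 \<le> s" "s \<le> t" "ereal t < b" and nz: "\<And>u. s \<le> u \<Longrightarrow> u \<le> t \<Longrightarrow> state u \<noteq> 0"
  shows "lyap_root (state t) + lam * k / 12 * t \<le> lyap_root (state s) + lam * k / 12 * s"
proof (rule continuous_locally_decreasing_imp_le[OF _ \<open>s \<le> t\<close>])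
  let ?g = "\<lambda>u. lyap_root (state u) + lam * k / 12 * u"
  have sc: "continuous_on {s..t} state"
    by (rule continuous_on_subset[OF state_cont[OF assms(3)]]) (use assms in auto)
  show gc: "continuous_on {s..t} ?g"
    by (intro continuous_intros continuous_on_compose2[OF lyap_root_cont[of UNIV] sc]) auto
  have zc: "continuous_on {s..t} z"
    by (rule continuous_on_subset[OF z_cont]) (use assms less_end in auto)
  fix u assume u: "s \<le> u" "u < t"
  have ub: "ereal u < b" using less_end[of u t] u assms(3) by simp
  have dec: "?g y \<le> ?g x" if "s \<le> x" "x \<le> y" "y \<le> t" "\<And>r. x \<le> r \<Longrightarrow> r \<le> y \<Longrightarrow> z r \<noteq> 0" for x y
    using lyap_root_decrease_off_origin[of x y] that assms(1,3) less_end[of y t]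
    by (simp add: algebra_simps diff_divide_distrib)
  show "\<exists>\<delta>>0. \<forall>v. u < v \<longrightarrow> v < u + \<delta> \<longrightarrow> v \<le> t \<longrightarrow> ?g v \<le> ?g u"
  proof (cases "z u = 0")
    case False
    have "continuous (at u within {s..t}) z"
      using zc u by (simp add: continuous_on_eq_continuous_within)
    then obtain \<delta> where \<delta>: "\<delta> > 0" "\<And>v. v \<in> {s..t} \<Longrightarrow> dist v u < \<delta> \<Longrightarrow> dist (z v) (z u) < norm (z u)"
      using False unfolding continuous_within_eps_delta by (metis zero_less_norm_iff)
    have nz: "z v \<noteq> 0" if "v \<in> {s..t}" "dist v u < \<delta>" for v
      using \<delta>(2)[OF that] by (auto simp: dist_norm)
    show ?thesis
      by (intro exI[of _ \<delta>] conjI allI impI \<delta>(1) dec nz) (use u in \<open>auto simp: dist_real_def\<close>)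
  next
    case True
    obtain \<delta> where \<delta>: "\<delta> > 0" "\<And>v. u < v \<Longrightarrow> v < u + \<delta> \<Longrightarrow> ereal v < b \<Longrightarrow> z v \<noteq> 0"
      using leaves_origin_component[OF _ ub True nz] u assms(1) by (metis less_imp_le order_trans)
    show ?thesis
    proof (intro exI[of _ \<delta>] conjI allI impI \<delta>(1))
      fix v assume v: "u < v" "v < u + \<delta>" "v \<le> t"
      show "?g v \<le> ?g u"
      proof (rule continuous_le_at_left_end[of u v ?g])
        show "continuous_on {u..v} ?g"
          by (rule continuous_on_subset[OF gc]) (use u v in auto)
        show "?g v \<le> ?g x" if "u < x" "x < v" for x
          using that v u \<delta>(2) less_end[OF _ assms(3)] by (intro dec) auto
      qed (use v in simp)
    qed
  qed
qed

text \<open>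
  The origin cannot be left: after the last visit to it the Lyapunov function would have to decrease
  from zero to a positive value.
\<close>
lemma lyap_root_decrease:
  assumes "0 \<le> s" "s \<le> t" "ereal t < b" "state t \<noteq> 0"
  shows "lyap_root (state t) + lam * k / 12 * t \<le> lyap_root (state s) + lam * k / 12 * s"
proof (rule lyap_root_decrease_nonzero[OF assms(1-3)])
  fix u assume u: "s \<le> u" "u \<le> t"
  show "state u \<noteq> 0"
  proof
    assume u0: "state u = 0"
    define Z where "Z = {v\<in>{u..t}. state v = 0}"
    have sc: "continuous_on {u..t} state"
      by (rule continuous_on_subset[OF state_cont[OF assms(3)]]) (use assms u in auto)
    have Z: "closed Z" "Z \<noteq> {}" "bdd_above Z"
      using continuous_closed_preimage[OF sc closed_atLeastAtMost, of "{0}"] u u0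
      by (auto simp: Z_def vimage_def Int_def bdd_above_def)
    define r where "r = Sup Z"
    have r: "r \<in> Z" unfolding r_def using closed_contains_Sup[OF Z(2,3,1)] .
    then have rt: "u \<le> r" "r < t" "state r = 0"
      using assms(4) by (auto simp: Z_def less_le)
    have nz: "state v \<noteq> 0" if "r < v" "v \<le> t" for v
      using cSup_upper[OF _ Z(3), of v] that rt by (auto simp: Z_def r_def)
    have "lyap_root (state t) \<le> lyap_root (state r)"
    proof (rule continuous_le_at_left_end[of r t])
      show "continuous_on {r..t} (\<lambda>v. lyap_root (state v))"
        by (intro continuous_on_compose2[OF lyap_root_cont[of UNIV] continuous_on_subset[OF sc]]) (use rt in auto)
      fix v assume v: "r < v" "v < t"
      have "lyap_root (state t) + lam * k / 12 * t \<le> lyap_root (state v) + lam * k / 12 * v"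
        using v rt u assms nz by (intro lyap_root_decrease_nonzero) auto
      moreover have "lam * k / 12 * v \<le> lam * k / 12 * t"
        using v gains k by (intro mult_left_mono) auto
      ultimately show "lyap_root (state t) \<le> lyap_root (state v)" by linarith
    qed (rule rt)
    then have "lyap_root (state t) \<le> 0"
      using rt lyap_root_eq_0_iff[of 0] by simp
    then show False
      using assms(4) lyap_root_pos_iff[of "state t"] by simp
  qed
qed

lemma lyap_root_mono:
  assumes "0 \<le> t" "ereal t < b"
  shows "lyap_root (state t) \<le> lyap_root (state 0)"
proof (cases "state t = 0")
  case True
  then show ?thesis using lyap_root_eq_0_iff[of 0] by simp
next
  case False
  have "0 \<le> lam * k / 12 * t" using assms gains k by simp
  then show ?thesis
    using lyap_root_decrease[of 0 t] assms False by simp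
qed

lemma state_eventually_zero:
  assumes "t > lyap_root (state 0) / (lam * k / 12)" "ereal t < b"
  shows "state t = 0"
proof (rule ccontr)
  assume "state t \<noteq> 0"
  have "lam * k / 12 > 0" using gains k by simp
  moreover have "0 \<le> lyap_root (state 0) / (lam * k / 12)"
    using \<open>lam * k / 12 > 0\<close> by (intro divide_nonneg_pos) auto
  then have "0 \<le> t" using assms(1) by linarith
  then have "lyap_root (state t) + lam * k / 12 * t \<le> lyap_root (state 0)"
    using lyap_root_decrease[of 0 t] assms \<open>state t \<noteq> 0\<close> by simp
  then have "lam * k / 12 * t \<le> lyap_root (state 0)"
    using lyap_root_nonneg[of "state t"] by linarith
  ultimately show False
    using assms(1) by (simp add: pos_divide_less_eq mult.commute)
qed

end

section \<open>Stability and continuation of trajectories\<close>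

context super_twisting_loop
begin

lemma snd_le_lyap_root: "\<bar>snd x\<bar> \<le> 2 * sqrt (2 * kI) * lyap_root x"
proof -
  have "(snd x)\<^sup>2 \<le> 2 * kI * energy x"
    using gains by (simp add: energy_def field_simps)
  then have "\<bar>snd x\<bar> \<le> sqrt (2 * kI) * sqrt (energy x)"
    by (metis real_sqrt_abs real_sqrt_le_mono real_sqrt_mult)
  also have "\<dots> \<le> sqrt (2 * kI) * (2 * lyap_root x)"
    using gains by (intro mult_left_mono sqrt_energy_le) auto
  finally show ?thesis by simp
qed

lemma V_le_lyap_root: "V (fst x) \<le> 4 * (lyap_root x)\<^sup>2"
proof -
  have "V (fst x) \<le> energy x" using gains by (simp add: energy_def)
  also have "\<dots> = (sqrt (energy x))\<^sup>2" using energy_nonneg[of x] by simp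
  also have "\<dots> \<le> (2 * lyap_root x)\<^sup>2"
    using energy_nonneg[of x] by (intro power_mono sqrt_energy_le) auto
  finally show ?thesis by (simp add: power_mult_distrib)
qed

lemma lyap_root_small:
  assumes "r > 0"
  shows "\<exists>\<eta>>0. \<forall>x. lyap_root x < \<eta> \<longrightarrow> norm (fst x) < r \<and> \<bar>snd x\<bar> < r"
proof -
  obtain \<eta> where \<eta>: "\<eta> > 0" "\<And>z. V z < \<eta> \<Longrightarrow> norm z < r"
    using V_small[OF assms] by blast
  define a where "a = 2 * sqrt (2 * kI)"
  have a: "a > 0" using gains by (simp add: a_def)
  show ?thesis
  proof (intro exI[of _ "min (sqrt (\<eta> / 4)) (r / a)"] conjI allI impI)
    show "0 < min (sqrt (\<eta> / 4)) (r / a)" using \<eta> a assms by simp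
    fix x assume x: "lyap_root x < min (sqrt (\<eta> / 4)) (r / a)"
    have "(lyap_root x)\<^sup>2 < (sqrt (\<eta> / 4))\<^sup>2"
      using x by (intro power_strict_mono) auto
    then have "V (fst x) < \<eta>" using V_le_lyap_root[of x] \<eta> by simp
    then show "norm (fst x) < r" by (rule \<eta>(2))
    have "a * lyap_root x < r" using x a by (simp add: pos_less_divide_eq mult.commute)
    then show "\<bar>snd x\<bar> < r" using snd_le_lyap_root[of x] by (simp add: a_def)
  qed
qed

lemma lyap_root_bounded: "\<exists>B. \<forall>x. lyap_root x \<le> R \<longrightarrow> norm (fst x) \<le> B \<and> \<bar>snd x\<bar> \<le> B"
proof -
  obtain B where B: "\<And>z. V z \<le> 4 * R\<^sup>2 \<Longrightarrow> norm z \<le> B"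
    using V_bounded by blast
  have "norm (fst x) \<le> max B (2 * sqrt (2 * kI) * R) \<and> \<bar>snd x\<bar> \<le> max B (2 * sqrt (2 * kI) * R)"
    if "lyap_root x \<le> R" for x
  proof -
    have "(lyap_root x)\<^sup>2 \<le> R\<^sup>2" using that by (intro power_mono) auto
    then have "norm (fst x) \<le> B" using V_le_lyap_root[of x] by (intro B) simp
    moreover have "2 * sqrt (2 * kI) * lyap_root x \<le> 2 * sqrt (2 * kI) * R"
      using that gains by (intro mult_left_mono) auto
    ultimately show ?thesis using snd_le_lyap_root[of x] by auto
  qed
  then show ?thesis by blast
qed

lemma scaling_inverse: "scaling (1 / lam) (scaling lam z) = z"
  using gains by (simp add: scaling_def vec_eq_iff power_divide)

lemma norm_le_scaling: "\<exists>B>0. \<forall>z :: real^'n::_. norm z \<le> B * norm (scaling lam z)"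
proof -
  obtain B where B: "B > 0" "\<And>x :: real^'n::_. norm (scaling (1 / lam) x) \<le> norm x * B"
    using bounded_linear.pos_bounded[OF bounded_linear_scaling] by blast
  then have "norm z \<le> B * norm (scaling lam z)" for z :: "real^'n::_"
    using B(2)[of "scaling lam z"] by (simp add: scaling_inverse mult.commute)
  then show ?thesis using B(1) by blast
qed

text \<open>
  The number \<open>\<delta>\<close> comes from the continuity of \<open>lyap_root\<close> at the origin and so serves all
  perturbations and trajectories.
\<close>
lemma closed_loop_lyapunov_stable:
  assumes "r > 0"
  shows "\<exists>\<delta>>0. \<forall>\<phi> b z w. admissible_perturbation M \<phi> \<longrightarrow>
      filippov_solution (closed_loop \<phi>) b (\<lambda>t. (z t, w t)) \<longrightarrow> w 0 = 0 \<longrightarrow>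
      norm (z 0, \<phi> 0) < \<delta> \<longrightarrow> (\<forall>t\<ge>0. ereal t < b \<longrightarrow> norm (z t, \<phi> t - kI * w t) < r)"
proof -
  obtain B where B: "B > 0" "\<And>z :: real^'n::_. norm z \<le> B * norm (scaling lam z)"
    using norm_le_scaling by blast
  define r' where "r' = r / (2 * (B + 1))"
  have r': "r' > 0" "2 * (B + 1) * r' = r" using assms B by (auto simp: r'_def)
  obtain \<eta> where \<eta>: "\<eta> > 0" "\<And>x. lyap_root x < \<eta> \<Longrightarrow> norm (fst x) < r' \<and> \<bar>snd x\<bar> < r'"
    using lyap_root_small[OF r'(1)] by blast
  let ?f = "\<lambda>x :: (real^'n::_) \<times> real. lyap_root (scaling lam (fst x), snd x)"
  have "continuous_on UNIV ?f"
    by (intro continuous_on_compose2[OF lyap_root_cont[of UNIV]] continuous_intros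
        bounded_linear.continuous_on[OF bounded_linear_scaling]) auto
  then have "isCont ?f 0"
    using continuous_on_eq_continuous_at[OF open_UNIV] by blast
  then obtain \<delta> where \<delta>: "\<delta> > 0" "\<And>x :: (real^'n::_) \<times> real. dist x 0 < \<delta> \<Longrightarrow>
      dist (?f x) (?f 0) < \<eta>"
    using \<eta>(1) unfolding continuous_at_eps_delta by blast
  have "scaling lam (0 :: real^'n::_) = 0" using gains by (simp add: scaling_eq_0)
  then have l0: "?f 0 = 0"
    by (simp add: lyap_root_eq_0_iff zero_prod_def)
  show ?thesis
  proof (intro exI[of _ \<delta>] conjI allI impI \<delta>(1))
    fix \<phi> b z w t
    assume *: "admissible_perturbation M \<phi>"
      "filippov_solution (closed_loop \<phi>) b (\<lambda>t. (z t, w t))"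
      and w0: "w 0 = 0" and init: "norm (z 0, \<phi> 0) < \<delta>" and t: "0 \<le> t" "ereal t < b"
    interpret super_twisting_trajectory u0 V G c Cu Cy Cd mp mn kP kI M eps lam k \<gamma> \<phi> b z w
      by unfold_locales fact+
    have "lyap_root (state 0) < \<eta>"
      using \<delta>(2)[of "(z 0, \<phi> 0)"] init w0 unfolding l0 by (simp add: state_def dist_real_def)
    then have "lyap_root (state t) < \<eta>"
      using lyap_root_mono[OF t] by simp
    then have s: "norm (scaling lam (z t)) < r'" "\<bar>\<phi> t - kI * w t\<bar> < r'"
      using \<eta>(2)[of "state t"] by (auto simp: state_def)
    have "norm (z t, \<phi> t - kI * w t) \<le> norm (z t) + \<bar>\<phi> t - kI * w t\<bar>"
      by (metis norm_Pair_le real_norm_def)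
    also have "norm (z t) \<le> B * r'"
      by (rule order_trans[OF B(2) mult_left_mono]) (use s B(1) in auto)
    finally have "norm (z t, \<phi> t - kI * w t) < B * r' + r'"
      using s(2) by simp
    also have "\<dots> \<le> r"
    proof -
      have "0 < (B + 1) * r'" using r' B(1) by simp
      then show ?thesis using r'(2) by (simp add: algebra_simps)
    qed
    finally show "norm (z t, \<phi> t - kI * w t) < r" .
  qed
qed

text \<open>
  Approaching the origin along the two halves of the last axis gives the velocities \<open>lam * mp\<close> and
  \<open>- lam * mn\<close> of the integral state in the limit, while the velocity of \<open>z\<close> tends to zero. The
  Filippov set is convex and contains everything between.
\<close>
lemma zero_in_filippov_closed_loop:
  assumes "\<phi> t = kI * w" "- (lam * mn) \<le> \<mu>" "\<mu> \<le> lam * mp"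
  shows "(0, \<mu>) \<in> filippov (closed_loop \<phi> t) (0, w)"
proof -
  let ?F = "closed_loop \<phi> t"
  let ?e = "axis last_idx 1 :: real^'n::_"
  have lim: "(0, lam * m) \<in> filippov ?F (0, w)"
    if \<sigma>: "\<sigma> \<noteq> 0" and m: "\<And>s. s > 0 \<Longrightarrow> partial_last V ((s * \<sigma>) *\<^sub>R ?e) = m" for \<sigma> m :: real
  proof -
    let ?X = "\<lambda>n. (inverse (real (Suc n)) * \<sigma>) *\<^sub>R ?e"
    have X0: "?X \<longlonglongrightarrow> 0"
      using tendsto_scaleR[OF tendsto_mult[OF LIMSEQ_inverse_real_of_nat tendsto_const[of \<sigma>]] tendsto_const[of ?e]]
      by simp
    have nz: "?X n \<noteq> 0" for n using \<sigma> by simp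
    show ?thesis
    proof (rule filippov_limit)
      show "(\<lambda>n. (?X n, w)) \<longlonglongrightarrow> (0, w)" by (intro tendsto_Pair X0 tendsto_const)
      show "isCont ?F (?X n, w)" for n
        using gains nz by (intro isCont_closed_loop u0_cont isCont_partial) auto
      have pl: "partial_last V (scaling lam (?X n)) = m" for n
      proof -
        have "scaling lam (?X n) = ((lam * inverse (real (Suc n))) * \<sigma>) *\<^sub>R ?e"
          by (auto simp: scaling_def vec_eq_iff axis_def card_ge_last_idx)
        then show ?thesis using m[of "lam * inverse (real (Suc n))"] gains by simp
      qed
      have "continuous_on UNIV (\<lambda>z :: real^'n::_. integrator_chain z (kP * u0 (scaling lam z)))"
        by (intro continuous_intros)
      then have "isCont (\<lambda>z :: real^'n::_. integrator_chain z (kP * u0 (scaling lam z))) 0"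
        using continuous_on_eq_continuous_at[OF open_UNIV] by blast
      then have "(\<lambda>n. integrator_chain (?X n) (kP * u0 (scaling lam (?X n)))) \<longlonglongrightarrow>
          integrator_chain 0 (kP * u0 (scaling lam 0))"
        by (rule isCont_tendsto_compose[OF _ X0])
      moreover have "scaling lam 0 = (0 :: real^'n::_)" using gains by (simp add: scaling_eq_0)
      ultimately have "(\<lambda>n. integrator_chain (?X n) (kP * u0 (scaling lam (?X n)))) \<longlonglongrightarrow> 0"
        by (simp add: u0_0 integrator_chain_0)
      then have "(\<lambda>n. (integrator_chain (?X n) (kP * u0 (scaling lam (?X n))), lam * m)) \<longlonglongrightarrow> (0, lam * m)"
        by (intro tendsto_Pair tendsto_const)
      then show "(\<lambda>n. ?F (?X n, w)) \<longlonglongrightarrow> (0, lam * m)"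
        by (simp only: closed_loop_eq fst_conv snd_conv pl assms(1) diff_self add_0_right)
    qed
  qed
  have "(0, lam * mp) \<in> filippov ?F (0, w)"
    by (rule lim[of 1]) (simp_all add: partial_axis(1))
  moreover have "(0, lam * (- mn)) \<in> filippov ?F (0, w)"
    by (rule lim[of "- 1"]) (use partial_axis(2) in simp_all)
  ultimately have "closed_segment (0, lam * (- mn)) (0, lam * mp) \<subseteq> filippov ?F (0, w)"
    by (intro closed_segment_subset convex_filippov)
  moreover have "(0, \<mu>) \<in> closed_segment (0 :: real^'n::_, lam * (- mn)) (0, lam * mp)"
  proof -
    have "lam * (- mn) \<le> lam * mp" using gains const_signs by (intro mult_left_mono) auto
    then have "\<mu> \<in> closed_segment (lam * (- mn)) (lam * mp)"
      using assms(2,3) by (simp add: closed_segment_eq_real_ivl)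
    then obtain u where "0 \<le> u" "u \<le> 1" "\<mu> = (1 - u) *\<^sub>R (lam * (- mn)) + u *\<^sub>R (lam * mp)"
      unfolding closed_segment_def by blast
    then show ?thesis unfolding closed_segment_def by auto
  qed
  ultimately show ?thesis by blast
qed

text \<open>
  From the rest point the solution continues with \<open>z = 0\<close> and an integral state that follows the
  perturbation. From any other point \<open>local_solution_of_directed_field\<close> applies: if \<open>z \<noteq> 0\<close>, the
  field is continuous nearby; if \<open>z = 0\<close>, the last coordinate has nonzero speed, and the region
  entered by the solution contains no point with \<open>z = 0\<close>.
\<close>
lemma closed_loop_local_solution:
  assumes adm: "admissible_perturbation M \<phi>" and "T \<ge> 0"
  shows "\<exists>\<delta>>0. \<exists>y. filippov_solution (\<lambda>s. closed_loop \<phi> (T + s)) (ereal \<delta>) y \<and> y 0 = x1"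
proof (cases "fst x1 = 0 \<and> \<phi> T = kI * snd x1")
  case True
  obtain h N where h: "\<And>a b. h absolutely_integrable_on {a..b}" "\<And>t. \<bar>h t\<bar> \<le> M"
    "\<And>a b. 0 \<le> a \<Longrightarrow> a \<le> b \<Longrightarrow> \<phi> b - \<phi> a = integral {a..b} h"
    using admissible_perturbation_integral[OF adm gains(3)] by metis
  define y where "y = (\<lambda>s. (0 :: real^'n::_, \<phi> (T + s) / kI))"
  define u where "u = (\<lambda>s. (0 :: real^'n::_, h (T + s) / kI))"
  have bl: "bounded_linear (\<lambda>r. (0 :: real^'n::_, r / kI))"
    by (intro bounded_linear_Pair bounded_linear_zero bounded_linear_divide)
  have u: "u integrable_on {0..t}" "y t = y 0 + integral {0..t} u" if "t \<ge> 0" for t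
  proof -
    have "(h has_integral (\<phi> (T + t) - \<phi> T)) {T..T + t}"
      using h(1)[of T "T + t"] h(3)[of T "T + t"] that assms(2) set_lebesgue_integral_eq_integral(1)
      by (auto simp: has_integral_integrable_integral)
    then have "((\<lambda>s. h (s + T)) has_integral (\<phi> (T + t) - \<phi> T)) {0..t}"
      using has_integral_shift_real_ivl[of h "\<phi> (T + t) - \<phi> T" T "T + t" T] by simp
    from has_integral_linear[OF this bl]
    have "(u has_integral (0, (\<phi> (T + t) - \<phi> T) / kI)) {0..t}"
      by (simp add: u_def o_def add.commute)
    then show "u integrable_on {0..t}" "y t = y 0 + integral {0..t} u"
      by (auto simp: y_def integral_unique diff_divide_distrib)
  qed
  have ua: "u absolutely_integrable_on {0..t}" if "t \<ge> 0" for t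
  proof (rule absolutely_integrable_integrable_bound[OF _ u(1)[OF that]])
    show "norm (u s) \<le> M / kI" for s
      using h(2)[of "T + s"] gains by (simp add: u_def norm_Pair divide_right_mono)
  qed auto
  have "u s \<in> filippov (closed_loop \<phi> (T + s)) (y s)" for s
  proof -
    have 1: "\<bar>h (T + s) / kI\<bar> \<le> M / kI"
      using h(2)[of "T + s"] gains by (simp add: divide_right_mono)
    have 2: "M / kI \<le> lam * mp" "M / kI \<le> lam * mn"
      using lam_large(2,3) gains by (simp_all add: pos_divide_le_eq mult.commute mult.left_commute)
    show ?thesis
      unfolding u_def y_def
    proof (rule zero_in_filippov_closed_loop)
      show "\<phi> (T + s) = kI * (\<phi> (T + s) / kI)" using gains by simp
      show "- (lam * mn) \<le> h (T + s) / kI" "h (T + s) / kI \<le> lam * mp"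
        using 1 2 by linarith+
    qed
  qed
  then have "{t. 0 \<le> t \<and> ereal t < ereal 1 \<and>
      u t \<notin> filippov (closed_loop \<phi> (T + t)) (y t)} = {}"
    by blast
  then have "filippov_solution (\<lambda>s. closed_loop \<phi> (T + s)) (ereal 1) y"
    unfolding filippov_solution_def
  proof (intro conjI exI[of _ u] allI impI)
    show "negligible {t. 0 \<le> t \<and> ereal t < ereal 1 \<and>
        u t \<notin> filippov (closed_loop \<phi> (T + t)) (y t)}"
      by (simp only: \<open>_ = {}\<close> negligible_empty)
    show "u absolutely_integrable_on {0..t}" "y t = y 0 + integral {0..t} u" if "0 \<le> t" for t
      using that by (rule ua, rule u(2))
  qed simp
  moreover have "y 0 = x1"
    using True gains by (cases x1) (simp add: y_def)
  ultimately show ?thesis by (intro exI[of _ 1]) auto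
next
  case False
  define f where "f = (\<lambda>s x. closed_loop \<phi> (T + s) x)"
  have \<phi>c: "continuous_on {0..} \<phi>"
    using adm lipschitz_on_continuous_on by (auto simp: admissible_perturbation_def)
  have \<phi>s: "continuous_on ({0..} \<times> S) (\<lambda>p. \<phi> (T + fst p))" for S :: "((real^'n::_) \<times> real) set"
    using assms(2) by (intro continuous_on_compose2[OF \<phi>c] continuous_intros) auto
  define drift where "drift = (\<lambda>p. kP * u0 (scaling lam (fst (snd p))) + (\<phi> (T + fst p) - kI * snd (snd p)))"
  have drift_cont: "continuous_on ({0..} \<times> S) drift" for S
    unfolding drift_def by (intro continuous_intros \<phi>s)
  have f_eq: "f s x = (integrator_chain (fst x) (drift (s, x)), lam * partial_last V (scaling lam (fst x)))" for s x
    by (simp add: f_def drift_def closed_loop_eq)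
  let ?P = "{x :: (real^'n::_) \<times> real. fst x \<noteq> 0}"
  have f_cont: "continuous_on ({0..} \<times> ?P) (\<lambda>(s, x). f s x)"
  proof -
    have "continuous_on ({0..} \<times> ?P) (\<lambda>p. partial_last V (scaling lam (fst (snd p))))"
      using gains by (intro continuous_on_compose2[OF partial_cont]
          bounded_linear.continuous_on[OF bounded_linear_scaling] continuous_intros)
        (auto simp: scaling_eq_0)
    then have "continuous_on ({0..} \<times> ?P) (\<lambda>p. (integrator_chain (fst (snd p)) (drift p),
        lam * partial_last V (scaling lam (fst (snd p)))))"
      by (intro continuous_intros drift_cont)
    then show ?thesis by (simp add: case_prod_beta f_eq)
  qed
  obtain e \<eta> \<rho> \<tau>0 where \<rho>: "\<rho> > 0" and \<tau>0: "\<tau>0 > 0"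
    and dir: "\<And>s x. 0 \<le> s \<Longrightarrow> s \<le> \<tau>0 \<Longrightarrow> norm (x - x1) \<le> \<rho> \<Longrightarrow> \<eta> \<le> e \<bullet> f s x"
    and nz: "\<And>s x. 0 < s \<Longrightarrow> norm (x - x1) \<le> \<rho> \<Longrightarrow> \<eta> * s \<le> e \<bullet> (x - x1) \<Longrightarrow> fst x \<noteq> 0"
  proof (cases "fst x1 = 0")
    case False
    show thesis
    proof (rule that[of "norm (fst x1) / 2" 1 0 0])
      show "fst x \<noteq> 0" if "norm (x - x1) \<le> norm (fst x1) / 2" for x
      proof
        assume "fst x = 0"
        have "norm (fst (x - x1)) \<le> norm (x - x1)"
          by (metis norm_fst_le prod.collapse)
        moreover have "norm (fst (x - x1)) = norm (fst x1)"
          using \<open>fst x = 0\<close> by simp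
        moreover have "norm (fst x1) > 0" using False by simp
        ultimately show False using that by linarith
      qed
    qed (use False in auto)
  next
    case True
    define \<xi> where "\<xi> = drift (0, x1)"
    have "scaling lam 0 = (0 :: real^'n::_)" using gains by (simp add: scaling_eq_0)
    then have \<xi>: "\<xi> \<noteq> 0" using False True by (simp add: \<xi>_def drift_def u0_0)
    have "continuous (at (0, x1) within {0..} \<times> UNIV) drift"
      using drift_cont[of UNIV] unfolding continuous_on_eq_continuous_within by (rule bspec) simp
    then obtain d where d: "d > 0" "\<And>p. p \<in> {0..} \<times> UNIV \<Longrightarrow> dist p (0, x1) < d \<Longrightarrow> dist (drift p) \<xi> < \<bar>\<xi>\<bar> / 2"
      using \<xi> unfolding continuous_within_eps_delta \<xi>_def by (metis half_gt_zero zero_less_abs_iff)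
    \<comment> \<open>The last coordinate moves in the direction of the sign of \<open>\<xi>\<close>, at half its speed or more.\<close>
    let ?e = "(sgn \<xi> *\<^sub>R axis last_idx 1, 0) :: (real^'n::_) \<times> real"
    show thesis
    proof (rule that[of "d / 3" "d / 3" "\<bar>\<xi>\<bar> / 2" ?e])
      show "\<bar>\<xi>\<bar> / 2 \<le> ?e \<bullet> f s x" if "0 \<le> s" "s \<le> d / 3" "norm (x - x1) \<le> d / 3" for s x
      proof -
        have "dist (s, x) (0, x1) \<le> dist s 0 + dist x x1"
          using norm_Pair_le[of "s - 0" "x - x1"] by (simp add: dist_norm)
        also have "\<dots> < d" using that d(1) by (simp add: dist_norm)
        finally have "dist (drift (s, x)) \<xi> < \<bar>\<xi>\<bar> / 2" using that by (intro d(2)) auto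
        then have "\<bar>\<xi>\<bar> / 2 \<le> sgn \<xi> * drift (s, x)"
          by (auto simp: dist_real_def sgn_if abs_if field_simps split: if_splits)
        then show ?thesis by (simp add: f_eq inner_axis' integrator_chain_nth_last)
      qed
      show "fst x \<noteq> 0" if "0 < s" "\<bar>\<xi>\<bar> / 2 * s \<le> ?e \<bullet> (x - x1)" for s x
      proof
        assume "fst x = 0"
        then have "?e \<bullet> (x - x1) = 0" using True by (cases x; cases x1) simp
        moreover have "0 < \<bar>\<xi>\<bar> / 2 * s" using \<xi> that by simp
        ultimately show False using that by simp
      qed
    qed (use d in auto)
  qed
  have "continuous_on ({0..\<tau>0} \<times> cball x1 \<rho>) (\<lambda>p. integrator_chain (fst (snd p)) (drift p))"
    by (rule continuous_on_subset[of "{0..} \<times> UNIV"]) (auto intro!: continuous_intros drift_cont)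
  then obtain K1 where "K1 \<ge> 0" and
    K1: "\<And>p. p \<in> {0..\<tau>0} \<times> cball x1 \<rho> \<Longrightarrow> norm (integrator_chain (fst (snd p)) (drift p)) \<le> K1"
    using compact_continuous_norm_bound[OF compact_Times[OF compact_Icc compact_cball]] by blast
  define K where "K = K1 + lam * Cd"
  have fK: "norm (f s x) \<le> K" if "0 \<le> s" "s \<le> \<tau>0" "norm (x - x1) \<le> \<rho>" for s x
  proof -
    have "norm (f s x) \<le> norm (integrator_chain (fst x) (drift (s, x))) + \<bar>lam * partial_last V (scaling lam (fst x))\<bar>"
      unfolding f_eq by (metis norm_Pair_le real_norm_def)
    also have "\<dots> \<le> K1 + lam * Cd"
    proof (rule add_mono)
      show "norm (integrator_chain (fst x) (drift (s, x))) \<le> K1"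
        using K1[of "(s, x)"] that by (simp add: dist_norm norm_minus_commute)
      show "\<bar>lam * partial_last V (scaling lam (fst x))\<bar> \<le> lam * Cd"
        using partial_le gains by (simp add: abs_mult)
    qed
    finally show ?thesis by (simp add: K_def)
  qed
  define \<tau> where "\<tau> = min \<tau>0 (\<rho> / (K + 1))"
  have "K \<ge> 0" using \<open>K1 \<ge> 0\<close> gains const_signs by (simp add: K_def)
  have "K * \<tau> \<le> K * (\<rho> / (K + 1))" using \<open>K \<ge> 0\<close> by (intro mult_left_mono) (auto simp: \<tau>_def)
  also have "\<dots> \<le> \<rho>" using \<open>K \<ge> 0\<close> \<rho> by (simp add: field_simps)
  finally have K\<tau>: "K * \<tau> \<le> \<rho>" .
  have \<tau>: "\<tau> > 0" "\<tau> \<le> \<tau>0" using \<tau>0 \<rho> \<open>K \<ge> 0\<close> by (auto simp: \<tau>_def)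
  obtain y where y: "y 0 = x1"
    "\<And>t. 0 \<le> t \<Longrightarrow> t \<le> \<tau> \<Longrightarrow> (\<lambda>s. f s (y s)) absolutely_integrable_on {0..t}"
    "\<And>t. 0 \<le> t \<Longrightarrow> t \<le> \<tau> \<Longrightarrow> y t = x1 + integral {0..t} (\<lambda>s. f s (y s))"
    "\<And>t. 0 \<le> t \<Longrightarrow> t \<le> \<tau> \<Longrightarrow> norm (y t - x1) \<le> \<rho>"
    "\<And>t. 0 \<le> t \<Longrightarrow> t \<le> \<tau> \<Longrightarrow> \<eta> * t \<le> e \<bullet> (y t - x1)"
  proof (rule local_solution_of_directed_field[OF \<tau>(1) \<open>K \<ge> 0\<close> K\<tau>, of x1 f \<eta> e])
    show "norm (f s x) \<le> K" if "0 \<le> s" "s \<le> \<tau>" "norm (x - x1) \<le> \<rho>" for s x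
      using fK that \<tau>(2) by simp
    show "\<eta> \<le> e \<bullet> f s x" if "0 \<le> s" "s \<le> \<tau>" "norm (x - x1) \<le> \<rho>" for s x
      using dir that \<tau>(2) by simp
    show "continuous (at (t, x) within {0..\<tau>} \<times> UNIV) (\<lambda>(t, x). f t x)"
      if "0 < t" "t \<le> \<tau>" "norm (x - x1) \<le> \<rho>" "\<eta> * t \<le> e \<bullet> (x - x1)" for t x
    proof -
      have x: "fst x \<noteq> 0" using nz that by blast
      have "continuous (at (t, x) within {0..} \<times> ?P) (\<lambda>(t, x). f t x)"
        using f_cont unfolding continuous_on_eq_continuous_within by (rule bspec) (use x that(1) in simp)
      then have c: "continuous (at (t, x) within {0..\<tau>} \<times> ?P) (\<lambda>(t, x). f t x)"
        by (rule continuous_within_subset) auto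
      have P: "?P = (- {0}) \<times> UNIV" by (auto simp: mem_Times_iff)
      have "at (t, x) within {0..\<tau>} \<times> ?P = at (t, x) within {0..\<tau>} \<times> UNIV"
        by (rule at_within_nhd[of _ "UNIV \<times> ?P"]) (use x in \<open>auto simp: P mem_Times_iff intro!: open_Times open_Compl\<close>)
      with c show ?thesis by simp
    qed
  qed blast
  have "filippov_solution (\<lambda>s. closed_loop \<phi> (T + s)) (ereal \<tau>) y"
    unfolding filippov_solution_def
  proof (intro conjI exI[of _ "\<lambda>s. f s (y s)"] allI impI)
    show "0 < ereal \<tau>" using \<tau> by simp
    show "(\<lambda>s. f s (y s)) absolutely_integrable_on {0..t}" if "0 \<le> t" "ereal t < ereal \<tau>" for t
      using y(2) that by simp
    show "y t = y 0 + integral {0..t} (\<lambda>s. f s (y s))" if "0 \<le> t" "ereal t < ereal \<tau>" for t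
      unfolding y(1) using y(3)[of t] that by simp
    show "negligible {t. 0 \<le> t \<and> ereal t < ereal \<tau> \<and> f t (y t) \<notin> filippov (closed_loop \<phi> (T + t)) (y t)}"
    proof (rule negligible_subset[of "{0}"])
      have "f t (y t) \<in> filippov (closed_loop \<phi> (T + t)) (y t)" if "0 < t" "t < \<tau>" for t
      proof -
        have "fst (y t) \<noteq> 0" using nz[of t "y t"] y(4,5)[of t] that by simp
        then have "isCont (closed_loop \<phi> (T + t)) (fst (y t), snd (y t))"
          using gains by (intro isCont_closed_loop u0_cont isCont_partial) auto
        then show ?thesis
          by (simp add: filippov_isCont f_def)
      qed
      then show "{t. 0 \<le> t \<and> ereal t < ereal \<tau> \<and> f t (y t) \<notin> filippov (closed_loop \<phi> (T + t)) (y t)} \<subseteq> {0}"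
        by (auto simp: less_le)
    qed auto
  qed
  then show ?thesis using \<tau>(1) y(1) by blast
qed

end

context super_twisting_trajectory
begin

text \<open>
  The Lyapunov function bounds the state, hence the velocity, uniformly up to the end time.
\<close>
lemma velocity_bounded:
  obtains K where "\<And>t v. 0 \<le> t \<Longrightarrow> ereal t < b \<Longrightarrow>
      v \<in> filippov (closed_loop \<phi> t) (z t, w t) \<Longrightarrow> norm v \<le> K"
proof -
  obtain B where B: "\<And>x. lyap_root x \<le> lyap_root (state 0) \<Longrightarrow> norm (fst x) \<le> B \<and> \<bar>snd x\<bar> \<le> B"
    using lyap_root_bounded by blast
  obtain B' where B': "B' > 0" "\<And>z :: real^'n::_. norm z \<le> B' * norm (scaling lam z)"
    using norm_le_scaling by blast
  let ?S = "cball (0 :: real^'n::_) (B' * B) \<times> cball (0 :: real) B"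
  obtain K1 where K1: "\<And>p. p \<in> ?S \<Longrightarrow> norm (integrator_chain (fst p) (kP * u0 (scaling lam (fst p)) + snd p)) \<le> K1"
  proof (rule compact_continuous_norm_bound)
    show "continuous_on ?S (\<lambda>p. integrator_chain (fst p) (kP * u0 (scaling lam (fst p)) + snd p))"
      by (intro continuous_intros)
  qed (use that in \<open>auto intro: compact_Times\<close>)
  show ?thesis
  proof
    fix t v assume t: "0 \<le> t" "ereal t < b"
      and v: "v \<in> filippov (closed_loop \<phi> t) (z t, w t)"
    have s: "norm (scaling lam (z t)) \<le> B" "\<bar>\<phi> t - kI * w t\<bar> \<le> B"
      using B[OF lyap_root_mono[OF t]] by (auto simp: state_def)
    have "norm (z t) \<le> B' * B"
      by (rule order_trans[OF B'(2) mult_left_mono]) (use s B'(1) in auto)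
    then have "(z t, \<phi> t - kI * w t) \<in> ?S" using s by simp
    then have "norm (fst v) \<le> K1"
      using K1[of "(z t, \<phi> t - kI * w t)"] filippov_closed_loop(1)[OF v] by simp
    moreover have "\<bar>snd v\<bar> \<le> lam * Cd" using filippov_closed_loop(2)[OF v] .
    ultimately show "norm v \<le> K1 + lam * Cd"
      using norm_Pair_le[of "fst v" "snd v"] by simp
  qed
qed

lemma maximal_trajectory_complete:
  assumes "maximal_solution (closed_loop \<phi>) b (\<lambda>t. (z t, w t))"
  shows "b = \<infinity>"
proof (rule ccontr)
  assume "b \<noteq> \<infinity>"
  moreover have "0 < b" using sol by (simp add: filippov_solution_def)
  ultimately obtain T where T: "b = ereal T" "T > 0" by (cases b) auto
  obtain K where K: "\<And>t v. 0 \<le> t \<Longrightarrow> t < T \<Longrightarrow>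
      v \<in> filippov (closed_loop \<phi> t) (z t, w t) \<Longrightarrow> norm v \<le> K"
    using velocity_bounded T by (metis less_ereal.simps(1))
  have "\<not> maximal_solution (closed_loop \<phi>) (ereal T) (\<lambda>t. (z t, w t))"
  proof (rule bounded_solution_not_maximal[OF _ K])
    show "filippov_solution (closed_loop \<phi>) (ereal T) (\<lambda>t. (z t, w t))"
      using sol T by simp
    show "\<exists>\<delta>>0. \<exists>y. filippov_solution (\<lambda>s. closed_loop \<phi> (T + s)) (ereal \<delta>) y \<and> y 0 = x1" for x1
      using closed_loop_local_solution[OF adm] T by simp
  qed
  then show False using assms T by simp
qed

lemma control_continuous:
  "continuous_on {t. 0 \<le> t \<and> ereal t < b} (\<lambda>t. st_control \<gamma> kP kI lam u0 (z t) (w t))"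
  unfolding st_control_def by (intro continuous_intros z_cont w_cont)

end

context super_twisting_loop
begin

lemma stabilizes: "st_stabilizes M \<gamma> kP kI lam u0 V"
  unfolding st_stabilizes_def
proof (intro conjI allI impI closed_loop_lyapunov_stable)
  fix \<phi> b z w
  assume "admissible_perturbation M \<phi>"
    and max: "maximal_solution (closed_loop \<phi>) b (\<lambda>t. (z t, w t))"
  then interpret super_twisting_trajectory u0 V G c Cu Cy Cd mp mn kP kI M eps lam k \<gamma> \<phi> b z w
    by unfold_locales (simp_all add: maximal_solution_def)
  show b: "b = \<infinity>" using max by (rule maximal_trajectory_complete)
  have "lam * k / 12 > 0" using gains k by simp
  then have T: "lyap_root (state 0) / (lam * k / 12) \<ge> 0"
    by (intro divide_nonneg_pos) auto
  show "\<exists>T\<ge>0. \<forall>t\<ge>T. z t = 0"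
  proof (intro exI[of _ "lyap_root (state 0) / (lam * k / 12) + 1"] conjI allI impI)
    fix t assume "lyap_root (state 0) / (lam * k / 12) + 1 \<le> t"
    then have "state t = 0" by (intro state_eventually_zero) (simp_all add: b)
    then show "z t = 0" using fst_state[of t] by simp
  qed (use T in simp)
qed

end

section \<open>Finite-time stabilization\<close>

lemma super_twisting_constants:
  fixes c Cu Cy Cd mp mn kP kI M :: real
  assumes "c > 0" "Cu \<ge> 0" "Cy \<ge> 0" "Cd \<ge> 0" "mp > 0" "mn > 0" "kP \<ge> 1" "kI > 0" "M \<ge> 0"
  obtains eps lam k where "eps > 0" "lam > 0" "k > 0" "k \<le> c" "k \<le> 2 * kI * eps"
    "eps * (kP * sqrt (2 * kI) * Cu + kI * Cd * Cy) \<le> c / 2" "eps * (sqrt (2 * kI) * Cy) \<le> 1 / 2"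
    "M * (3 / 2 * sqrt (2 * kI) / kI + eps * Cy) \<le> lam * k / 2"
    "M \<le> lam * kI * mp" "M \<le> lam * kI * mn"
proof -
  define a where "a = kP * sqrt (2 * kI) * Cu + kI * Cd * Cy"
  define b where "b = sqrt (2 * kI) * Cy"
  have a: "a \<ge> 0" and b: "b \<ge> 0" using assms by (auto simp: a_def b_def)
  define eps where "eps = min (c / (2 * (a + 1))) (1 / (2 * (b + 1)))"
  have eps0: "eps > 0" using assms a b by (simp add: eps_def)
  define k where "k = min c (2 * kI * eps)"
  have k: "k > 0" using assms eps0 by (simp add: k_def)
  define e where "e = M * (3 / 2 * sqrt (2 * kI) / kI + eps * Cy)"
  have e: "e \<ge> 0" unfolding e_def using assms eps0 by (intro mult_nonneg_nonneg add_nonneg_nonneg) auto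
  define lam where "lam = 1 + 2 * e / k + M / (kI * mp) + M / (kI * mn)"
  have pos: "2 * e / k \<ge> 0" "M / (kI * mp) \<ge> 0" "M / (kI * mn) \<ge> 0" using assms e k by auto
  show ?thesis
  proof (rule that[of eps lam k])
    show "eps > 0" "k > 0" by fact+
    show "lam > 0" using pos by (simp add: lam_def)
    show "k \<le> c" "k \<le> 2 * kI * eps" by (simp_all add: k_def)
    have "eps * a \<le> c / (2 * (a + 1)) * a" using a by (intro mult_right_mono) (auto simp: eps_def)
    also have "\<dots> \<le> c / 2" using a assms(1) by (simp add: field_simps)
    finally show "eps * (kP * sqrt (2 * kI) * Cu + kI * Cd * Cy) \<le> c / 2" by (simp add: a_def)
    have "eps * b \<le> 1 / (2 * (b + 1)) * b" using b by (intro mult_right_mono) (auto simp: eps_def)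
    also have "\<dots> \<le> 1 / 2" using b by (simp add: field_simps)
    finally show "eps * (sqrt (2 * kI) * Cy) \<le> 1 / 2" by (simp add: b_def)
    have "2 * e / k \<le> lam" using pos by (simp add: lam_def)
    then have "e \<le> lam * k / 2" using k by (simp add: pos_divide_le_eq)
    then show "M * (3 / 2 * sqrt (2 * kI) / kI + eps * Cy) \<le> lam * k / 2"
      unfolding e_def .
    have "M / (kI * mp) \<le> lam" "M / (kI * mn) \<le> lam" using pos by (auto simp: lam_def)
    then show "M \<le> lam * kI * mp" "M \<le> lam * kI * mn"
      using assms by (simp_all add: pos_divide_le_eq mult.assoc)
  qed
qed

text \<open>
  The relation between \<open>p\<close> and \<open>\<kappa>\<close> makes the weights multiples of \<open>d = - \<kappa>\<close>: they are positive, and the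
  last one is \<open>2 * d\<close>, which is also the degree of \<open>V\<close>. So \<open>u0\<close> has degree \<open>d\<close>, the last partial
  derivative of \<open>V\<close> has degree \<open>0\<close>, and the derivative of \<open>V\<close> along the nominal system has degree
  \<open>\<kappa> + 2 * d = d\<close>. Each estimate is then a comparison with a power of \<open>V\<close>. The decay
  estimate with exponent \<open>\<alpha>\<close> shows that the last of these is negative off the origin, which
  homogeneity turns into a decay rate of order \<open>V powr (1/2)\<close>.
\<close>
lemma super_twisting_data_of_homogeneous:
  fixes u0 V :: "real^'n::{finite,linorder} \<Rightarrow> real"
  assumes "\<kappa> < 0" and p: "p + (real CARD('n) + 1) * \<kappa> = 0"
    and u0_cont: "continuous_on UNIV u0"
    and u0_hom: "homogeneous_on UNIV (weight p \<kappa>) (p + real CARD('n) * \<kappa>) u0"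
    and field_hom: "homogeneous_field (weight p \<kappa>) \<kappa> (\<lambda>z. integrator_chain z (u0 z))"
    and V_cont: "continuous_on UNIV V"
    and V_pd: "positive_definite_fun V"
    and V_C1: "C1_off_origin V"
    and V_hom: "homogeneous_on UNIV (weight p \<kappa>) (2 * (p + real CARD('n) * \<kappa>)) V"
    and decay: "\<And>b x t. filippov_solution (\<lambda>t z. integrator_chain z (u0 z)) b x \<Longrightarrow> x 0 \<noteq> 0 \<Longrightarrow>
        \<exists>D. ((\<lambda>s. V (x s)) has_real_derivative D) (at 0 within {s. 0 \<le> s \<and> ereal s < b}) \<and>
            D \<le> - c * V (x 0) powr \<alpha>"
    and "c > 0"
    and nonpos: "\<And>z. partial_last V z * u0 z \<le> 0"
  obtains G c' Cu Cy Cd mp mn where "super_twisting_data u0 V G c' Cu Cy Cd mp mn"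
proof -
  define d where "d = - \<kappa>"
  let ?w = "weight p \<kappa> :: 'n \<Rightarrow> real"
  have d: "d > 0" and deg: "p + real CARD('n) * \<kappa> = d" using p assms(1) by (auto simp: d_def algebra_simps)
  have w_last: "?w last_idx = 2 * d"
    using deg by (simp add: weight_def card_less_last_idx of_nat_diff d_def algebra_simps)
  have w: "?w i > 0" for i
  proof -
    have "real (card {j. j < i}) \<le> real CARD('n) - 1"
      using card_less_le[of i] by (simp add: of_nat_diff nat_le_real_less)
    then have "real (card {j. j < i}) * d \<le> (real CARD('n) - 1) * d"
      using d by (intro mult_right_mono) auto
    then show ?thesis using deg d by (simp add: weight_def d_def algebra_simps)
  qed
  obtain G where G_cont: "continuous_on (- {0}) G"
    and G: "\<And>z. z \<noteq> 0 \<Longrightarrow> (V has_derivative (\<lambda>h. G z \<bullet> h)) (at z)"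
    using V_C1 by (auto simp: C1_off_origin_def)
  have V0: "V 0 = 0" and Vpos: "\<And>z. z \<noteq> 0 \<Longrightarrow> V z > 0"
    using V_pd by (auto simp: positive_definite_fun_def)
  have hom: "homogeneous_on UNIV ?w (2 * d) V" using V_hom by (simp add: deg)
  have V: "continuous_on (- {0}) V" "homogeneous_on (- {0}) ?w (2 * d) V"
    using continuous_on_subset[OF V_cont] hom by (auto simp: homogeneous_on_def)
  have d2: "2 * d \<noteq> 0" using d by simp
  note abs_bound = homogeneous_abs_le_powr[of ?w _ _ V "2 * d", OF w _ _ V Vpos d2]
  have Gd: "G (dilation ?w \<epsilon> z) \<bullet> dilation ?w \<epsilon> h = \<epsilon> powr (2 * d) * (G z \<bullet> h)" if "\<epsilon> > 0" "z \<noteq> 0" for \<epsilon> z h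
    by (rule gradient_homogeneous[OF hom \<open>\<epsilon> > 0\<close>]) (use that in \<open>auto intro!: G simp: dilation_eq_0_iff\<close>)
  have sq: "V z powr (d / (2 * d)) = sqrt (V z)" for z
    using d Vpos[of z] V0 by (cases "z = 0") (auto simp: powr_half_sqrt)
  have "\<exists>Cu\<ge>0. \<forall>z. z \<noteq> 0 \<longrightarrow> \<bar>u0 z\<bar> \<le> Cu * sqrt (V z)"
  proof -
    have "continuous_on (- {0}) u0" "homogeneous_on (- {0}) ?w d u0"
      using continuous_on_subset[OF u0_cont] u0_hom by (auto simp: homogeneous_on_def deg)
    from abs_bound[OF this] show ?thesis unfolding sq by metis
  qed
  then obtain Cu where Cu: "Cu \<ge> 0" "\<And>z. z \<noteq> 0 \<Longrightarrow> \<bar>u0 z\<bar> \<le> Cu * sqrt (V z)" by blast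
  have u00: "u0 0 = 0"
  proof -
    have "dilation ?w 2 0 = 0" by (simp add: vec_eq_iff)
    then have "u0 0 = 2 powr d * u0 0"
      using u0_hom unfolding homogeneous_on_def deg by (metis UNIV_I zero_less_numeral)
    moreover have "2 powr d \<noteq> (1 :: real)" using d by simp
    ultimately show ?thesis by simp
  qed
  have "\<exists>Cy\<ge>0. \<forall>z. z \<noteq> 0 \<longrightarrow> \<bar>z $ last_idx\<bar> \<le> Cy * V z"
  proof -
    have "continuous_on (- {0}) (\<lambda>z :: real^'n::_. z $ last_idx)"
      "homogeneous_on (- {0}) ?w (2 * d) (\<lambda>z. z $ last_idx)"
      by (auto intro: continuous_intros simp: homogeneous_on_def w_last)
    from abs_bound[OF this] obtain C where "C \<ge> 0" "\<And>z. z \<noteq> 0 \<Longrightarrow> \<bar>z $ last_idx\<bar> \<le> C * V z powr (2 * d / (2 * d))"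
      by metis
    then show ?thesis using d Vpos by (intro exI[of _ C]) (auto simp: less_imp_le)
  qed
  then obtain Cy where Cy: "Cy \<ge> 0" "\<And>z. z \<noteq> 0 \<Longrightarrow> \<bar>z $ last_idx\<bar> \<le> Cy * V z" by blast
  have "\<exists>C\<ge>0. \<forall>z. z \<noteq> 0 \<longrightarrow> \<bar>partial_last V z\<bar> \<le> C"
  proof -
    have c: "continuous_on (- {0}) (\<lambda>z. G z \<bullet> axis last_idx 1)"
      by (intro continuous_intros G_cont)
    have h: "homogeneous_on (- {0}) ?w 0 (\<lambda>z. G z \<bullet> axis last_idx 1)"
      unfolding homogeneous_on_def
    proof (intro allI impI ballI)
      fix \<epsilon> :: real and z :: "real^'n::_" assume *: "\<epsilon> > 0" "z \<in> - {0}"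
      then show "G (dilation ?w \<epsilon> z) \<bullet> axis last_idx 1 = \<epsilon> powr 0 * (G z \<bullet> axis last_idx 1)"
        using Gd[of \<epsilon> z "axis last_idx 1"] by (simp add: dilation_axis w_last)
    qed
    from abs_bound[OF c h] obtain C where "C \<ge> 0" "\<And>z. z \<noteq> 0 \<Longrightarrow> \<bar>G z \<bullet> axis last_idx 1\<bar> \<le> C * V z powr (0 / (2 * d))"
      by metis
    moreover have "V z powr (0 / (2 * d)) = 1" if "z \<noteq> 0" for z
      using Vpos[OF that] by simp
    ultimately show ?thesis
      using partial_last_eq_gradient[OF G] by (intro exI[of _ C]) simp
  qed
  then obtain C where C: "C \<ge> 0" "\<And>z. z \<noteq> 0 \<Longrightarrow> \<bar>partial_last V z\<bar> \<le> C" by blast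
  define g where "g = (\<lambda>z. G z \<bullet> integrator_chain z (u0 z))"
  have g_neg: "g z < 0" if "z \<noteq> 0" for z
  proof -
    have "g z \<le> - c * V z powr \<alpha>"
      unfolding g_def
    proof (rule derivative_along_continuous_field[OF _ G[OF that]])
      show "continuous_on UNIV (\<lambda>z. integrator_chain z (u0 z))"
        by (intro continuous_intros u0_cont)
    qed (use decay that in blast)
    also have "\<dots> < 0" using \<open>c > 0\<close> Vpos[OF that] by simp
    finally show ?thesis .
  qed
  have g_cont: "continuous_on (- {0}) g"
    unfolding g_def by (intro continuous_intros G_cont continuous_on_subset[OF u0_cont]) auto
  have g_hom: "homogeneous_on (- {0}) ?w d g"
    unfolding homogeneous_on_def
  proof (intro allI impI ballI)
    fix \<epsilon> :: real and z :: "real^'n::_" assume *: "\<epsilon> > 0" "z \<in> - {0}"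
    have "g (dilation ?w \<epsilon> z) = \<epsilon> powr \<kappa> * (\<epsilon> powr (2 * d) * g z)"
      using field_hom Gd[of \<epsilon> z] * by (simp add: g_def homogeneous_field_def)
    also have "\<dots> = \<epsilon> powr d * g z"
      using *(1) by (simp add: d_def flip: powr_add mult.assoc)
    finally show "g (dilation ?w \<epsilon> z) = \<epsilon> powr d * g z" .
  qed
  obtain z0 where z0: "z0 \<noteq> 0" "\<And>z. z \<noteq> 0 \<Longrightarrow> g z \<le> g z0 / sqrt (V z0) * sqrt (V z)"
    using homogeneous_le_powr[of ?w g d V "2 * d", OF w g_cont g_hom V Vpos d2] unfolding sq by metis
  define c' where "c' = - (g z0 / sqrt (V z0))"
  have c': "c' > 0" using g_neg[OF z0(1)] Vpos[OF z0(1)] by (simp add: c'_def divide_less_0_iff)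
  note axis = partial_last_axis[OF hom d2 w_last]
  have ne: "axis last_idx a \<noteq> (0 :: real^'n::_)" if "a \<noteq> 0" for a :: real
    using that by (simp add: axis_eq_0_iff)
  have "super_twisting_data u0 V G c' Cu Cy (max C \<bar>partial_last V 0\<bar>) (V (axis last_idx 1)) (V (axis last_idx (- 1)))"
  proof
    show "\<bar>u0 z\<bar> \<le> Cu * sqrt (V z)" for z using Cu(2) u00 V0 by (cases "z = 0") auto
    show "\<bar>z $ last_idx\<bar> \<le> Cy * V z" for z using Cy(2) V0 by (cases "z = 0") auto
    show "\<bar>partial_last V z\<bar> \<le> max C \<bar>partial_last V 0\<bar>" for z
      using C(2) by (cases "z = 0") (auto simp: le_max_iff_disj)
    show "G z \<bullet> integrator_chain z (u0 z) \<le> - c' * sqrt (V z)" if "z \<noteq> 0" for z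
      using z0(2)[OF that] by (simp add: c'_def g_def)
    show "\<exists>\<eta>>0. \<forall>z. V z < \<eta> \<longrightarrow> norm z < r" if "r > 0" for r
      by (rule sublevel_sets_of_homogeneous(2)[OF w _ V Vpos V0 that]) (use d in simp)
    show "\<exists>B. \<forall>z. V z \<le> R \<longrightarrow> norm z \<le> B" for R
      by (rule sublevel_sets_of_homogeneous(1)[OF w _ V Vpos V0]) (use d in simp)
  qed (use u0_cont V_cont V0 Vpos G_cont G nonpos axis c' Cu(1) Cy(1) C(1) ne in auto)
  then show ?thesis by (rule that)
qed

theorem theorem2:
  fixes u0 V1 :: "real^'n::{finite,linorder} \<Rightarrow> real"
    and \<kappa> p c \<alpha> kP kI M :: real
  assumes "\<kappa> < 0" and "p > 0" and "p + (real CARD('n) + 1) * \<kappa> = 0"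
    and u0_cont: "continuous_on UNIV u0"
    and u0_hom: "homogeneous_on UNIV (weight p \<kappa>) (p + real CARD('n) * \<kappa>) u0"
    and u0_fts: "finite_time_stable (\<lambda>t z. integrator_chain z (u0 z))"
    and field_hom: "homogeneous_field (weight p \<kappa>) \<kappa> (\<lambda>z. integrator_chain z (u0 z))"
    and V1_cont: "continuous_on UNIV V1"
    and V1_pd: "positive_definite_fun V1"
    and V1_C1: "C1_off_origin V1"
    and V1_hom: "homogeneous_on UNIV (weight p \<kappa>) (2 * (p + real CARD('n) * \<kappa>)) V1"
    and "c > 0" and "0 < \<alpha>" and "\<alpha> < 1"
    and V1_decay: "\<And>b x t. filippov_solution (\<lambda>t z. integrator_chain z (u0 z)) b x \<Longrightarrow>
        0 \<le> t \<Longrightarrow> ereal t < b \<Longrightarrow> x t \<noteq> 0 \<Longrightarrow>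
        \<exists>D. ((\<lambda>s. V1 (x s)) has_real_derivative D) (at t within {s. 0 \<le> s \<and> ereal s < b}) \<and>
            D \<le> - c * V1 (x t) powr \<alpha>"
    and dV1_hom: "\<exists>q\<ge>0. homogeneous_on (- {0}) (weight p \<kappa>) q (partial_last V1)"
    and dV1_u0: "\<And>z. partial_last V1 z * u0 z \<le> 0"
    and "kP \<ge> 1" and "kI > 0" and "M \<ge> 0"
  shows "\<exists>lam>0. \<forall>\<gamma>>0.
      st_stabilizes M \<gamma> kP kI lam u0 V1 \<and>
      (\<forall>\<phi> b z w. admissible_perturbation M \<phi> \<longrightarrow>
         filippov_solution (st_closed_loop \<gamma> kP kI lam u0 V1 \<phi>) b (\<lambda>t. (z t, w t)) \<longrightarrow> w 0 = 0 \<longrightarrow>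
         continuous_on {t. 0 \<le> t \<and> ereal t < b} (\<lambda>t. st_control \<gamma> kP kI lam u0 (z t) (w t))) \<and>
      (\<forall>y. continuous_on {0..} y \<longrightarrow> continuous_on {0..} (super_twisting kP kI u0 V1 y))"
proof -
  have "\<exists>D. ((\<lambda>s. V1 (x s)) has_real_derivative D) (at 0 within {s. 0 \<le> s \<and> ereal s < b}) \<and>
      D \<le> - c * V1 (x 0) powr \<alpha>"
    if "filippov_solution (\<lambda>t z. integrator_chain z (u0 z)) b x" "x 0 \<noteq> 0" for b x
    using V1_decay[OF that(1), of 0] that by (simp add: filippov_solution_def zero_ereal_def)
  from super_twisting_data_of_homogeneous[OF \<open>\<kappa> < 0\<close> assms(3) u0_cont u0_hom field_hom V1_cont V1_pd
      V1_C1 V1_hom this \<open>c > 0\<close> dV1_u0]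
  obtain G c' Cu Cy Cd mp mn where data: "super_twisting_data u0 V1 G c' Cu Cy Cd mp mn"
    by blast
  interpret super_twisting_data u0 V1 G c' Cu Cy Cd mp mn by (rule data)
  obtain eps lam k where const: "eps > 0" "lam > 0" "k > 0" "k \<le> c'" "k \<le> 2 * kI * eps"
    "eps * (kP * sqrt (2 * kI) * Cu + kI * Cd * Cy) \<le> c' / 2" "eps * (sqrt (2 * kI) * Cy) \<le> 1 / 2"
    "M * (3 / 2 * sqrt (2 * kI) / kI + eps * Cy) \<le> lam * k / 2"
    "M \<le> lam * kI * mp" "M \<le> lam * kI * mn"
    using super_twisting_constants[OF const_signs \<open>kP \<ge> 1\<close> \<open>kI > 0\<close> \<open>M \<ge> 0\<close>] by metis
  have loop: "super_twisting_loop u0 V1 G c' Cu Cy Cd mp mn kP kI M eps lam k \<gamma>" if "\<gamma> > 0" for \<gamma>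
    by unfold_locales (use const that assms in auto)
  show ?thesis
  proof (intro exI[of _ lam] conjI allI impI)
    show "lam > 0" by fact
    show "st_stabilizes M \<gamma> kP kI lam u0 V1" if "\<gamma> > 0" for \<gamma>
      using super_twisting_loop.stabilizes[OF loop[OF that]] .
    show "continuous_on {t. 0 \<le> t \<and> ereal t < b} (\<lambda>t. st_control \<gamma> kP kI lam u0 (z t) (w t))"
      if "\<gamma> > 0" "admissible_perturbation M \<phi>"
        "filippov_solution (st_closed_loop \<gamma> kP kI lam u0 V1 \<phi>) b (\<lambda>t. (z t, w t))" for \<gamma> \<phi> b z w
    proof -
      interpret super_twisting_loop u0 V1 G c' Cu Cy Cd mp mn kP kI M eps lam k \<gamma>
        by (rule loop) fact
      interpret super_twisting_trajectory u0 V1 G c' Cu Cy Cd mp mn kP kI M eps lam k \<gamma> \<phi> b z w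
        by unfold_locales fact+
      show ?thesis by (rule control_continuous)
    qed
    show "continuous_on {0..} (super_twisting kP kI u0 V1 y)" if "continuous_on {0..} y" for y
      using that by (rule super_twisting_continuous)
  qed
qed

end
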